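(* Let $G$ be a finitely generated free group acting on a standard probability space $(X,\mu)$ by measure preserving bijections. Suppose that this action admits a generating partition $\alpha$ having finite Shannon entropy. Then for any free generating set $S$ for $G$ and any finite non-empty right $S$-connected set $\Delta\subseteq G$ we have $$f_G(X,\mu)\leq\frac{\mathrm{H}(\Delta\cdot\alpha)}{|\Delta|}\leq\mathrm{H}(\alpha).$$
   Context: The right $S$-Cayley graph of $G$ is the tree with vertex set $G$ and edges $(g,gs)$ for $g\in G$, $s\in S\cup S^{-1}$. A set $\Delta\subseteq G$ is right $S$-connected if for any two elements of $\Delta$ the unique non-self-intersecting path between them in this tree visits only vertices of $\Delta$. For a countable measurable partition $\alpha$ of $X$, $g\in G$ and finite $F\subseteq G$, put $g\cdot\alpha=\{g\cdot A : A\in\alpha\}$ and $F\cdot\alpha=\bigvee_{f\in F} f\cdot\alpha$ (join of partitions). The Shannon entropy is $\mathrm{H}(\alpha)=\sum_{A\in\alpha}-\mu(A)\log\mu(A)$. A countable measurable partition $\alpha$ is generating if the smallest $G$-invariant $\sigma$-algebra containing $\alpha$ contains all measurable sets up to null sets. f-invariant entropy: with $r=|S|$ and $\mathrm{H}(\alpha)<\infty$ set $F_G(X,\mu,S,\alpha)=(1-2r)\mathrm{H}(\alpha)+\sum_{s\in S}\mathrm{H}(s\cdot\alpha\vee\alpha)$. Let $B_S(n)$ be the ball of radius $n$ about $1_G$ for the $S$-word length. If there is a generating partition $\alpha$ with $\mathrm{H}(\alpha)<\infty$, define $f_G(X,\mu)=\lim_{n\to\infty}F_G(X,\mu,S,B_S(n)\cdot\alpha)$.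 By theorems of Bowen the sequence is non-increasing, so the limit exists in $[-\infty,\infty)$, and it does not depend on the choice of $S$ or of the finite Shannon entropy generating partition $\alpha$. *)

theory Defs
  imports
    "HOL-Probability.Probability"
    "HOL-Algebra.Generated_Groups"
    "HOL-Algebra.Group_Action"
begin

section \<open>Free groups and their Cayley trees\<close>

text \<open>
  Words are lists of formal letters \<open>(s, b)\<close>, where \<open>(s, True)\<close> stands for \<open>s\<close> and
  \<open>(s, False)\<close> for the inverse of \<open>s\<close>.  Keeping the letters formal matters: a set containing
  both \<open>s\<close> and its inverse must not count as a free generating set.
\<close>

fun letter_val :: "('g, 'm) monoid_scheme \<Rightarrow> 'g \<times> bool \<Rightarrow> 'g" where
  "letter_val G (s, b) = (if b then s else inv\<^bsub>G\<^esub> s)"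

definition word_val :: "('g, 'm) monoid_scheme \<Rightarrow> ('g \<times> bool) list \<Rightarrow> 'g" where
  "word_val G w = foldr (\<lambda>l x. letter_val G l \<otimes>\<^bsub>G\<^esub> x) w \<one>\<^bsub>G\<^esub>"

definition words_over :: "'g set \<Rightarrow> ('g \<times> bool) list set" where
  "words_over S = lists (S \<times> UNIV)"

definition reduced_word :: "('g \<times> bool) list \<Rightarrow> bool" where
  "reduced_word = successively (\<lambda>x y. \<not> (fst x = fst y \<and> snd x \<noteq> snd y))"

definition free_generating_set :: "('g, 'm) monoid_scheme \<Rightarrow> 'g set \<Rightarrow> bool" where
  "free_generating_set G S \<longleftrightarrow>
     S \<subseteq> carrier G \<and> generate G S = carrier G \<and>
     (\<forall>w \<in> words_over S. reduced_word w \<and> w \<noteq> [] \<longrightarrow> word_val G w \<noteq> \<one>\<^bsub>G\<^esub>)"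

definition free_group :: "('g, 'm) monoid_scheme \<Rightarrow> bool" where
  "free_group G \<longleftrightarrow> group G \<and> (\<exists>S. free_generating_set G S)"

definition finitely_generated_group :: "('g, 'm) monoid_scheme \<Rightarrow> bool" where
  "finitely_generated_group G \<longleftrightarrow>
     group G \<and> (\<exists>T. finite T \<and> T \<subseteq> carrier G \<and> generate G T = carrier G)"

definition word_ball :: "('g, 'm) monoid_scheme \<Rightarrow> 'g set \<Rightarrow> nat \<Rightarrow> 'g set" where
  "word_ball G S n = word_val G ` {w \<in> words_over S. length w \<le> n}"

definition cayley_adj :: "('g, 'm) monoid_scheme \<Rightarrow> 'g set \<Rightarrow> 'g \<Rightarrow> 'g \<Rightarrow> bool" where
  "cayley_adj G S g h \<longleftrightarrow>
     g \<in> carrier G \<and> (\<exists>s\<in>S. h = g \<otimes>\<^bsub>G\<^esub> s \<or> h = g \<otimes>\<^bsub>G\<^esub> inv\<^bsub>G\<^esub> s)"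

definition cayley_simple_path ::
    "('g, 'm) monoid_scheme \<Rightarrow> 'g set \<Rightarrow> 'g \<Rightarrow> 'g list \<Rightarrow> 'g \<Rightarrow> bool" where
  "cayley_simple_path G S x p y \<longleftrightarrow>
     p \<noteq> [] \<and> hd p = x \<and> last p = y \<and> set p \<subseteq> carrier G \<and> distinct p \<and>
     successively (cayley_adj G S) p"

text \<open>
  For a free generating set \<open>S\<close> there is exactly one simple path between any two
  group elements, so the quantifier over \<open>p\<close> below refers to that path.
\<close>

definition right_connected :: "('g, 'm) monoid_scheme \<Rightarrow> 'g set \<Rightarrow> 'g set \<Rightarrow> bool" where
  "right_connected G S D \<longleftrightarrow>
     D \<subseteq> carrier G \<and>
     (\<forall>x\<in>D. \<forall>y\<in>D. \<forall>p. cayley_simple_path G S x p y \<longrightarrow> set p \<subseteq> D)"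


section \<open>Measure preserving actions on standard probability spaces\<close>

text \<open>
  A standard probability space is a standard Borel space (the Borel sets of a Polish topology
  on the underlying set) with a Borel probability measure; the measure is not completed.
\<close>

definition standard_borel_space :: "'x measure \<Rightarrow> bool" where
  "standard_borel_space M \<longleftrightarrow>
     (\<exists>T. topspace T = space M \<and> completely_metrizable_space T \<and> separable_space T \<and>
          sets M = sigma_sets (space M) {U. openin T U})"

definition standard_prob_space :: "'x measure \<Rightarrow> bool" where
  "standard_prob_space M \<longleftrightarrow> prob_space M \<and> standard_borel_space M"

definition pmp_action ::
    "('g, 'm) monoid_scheme \<Rightarrow> 'x measure \<Rightarrow> ('g \<Rightarrow> 'x \<Rightarrow> 'x) \<Rightarrow> bool" where
  "pmp_action G M \<phi> \<longleftrightarrow>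
     group_action G (space M) \<phi> \<and>
     (\<forall>g \<in> carrier G. \<phi> g \<in> M \<rightarrow>\<^sub>M M \<and> distr M M (\<phi> g) = M)"


section \<open>Partitions and Shannon entropy\<close>

definition countable_partition :: "'x measure \<Rightarrow> 'x set set \<Rightarrow> bool" where
  "countable_partition M \<alpha> \<longleftrightarrow> countable \<alpha> \<and> \<alpha> \<subseteq> sets M \<and> partition_on (space M) \<alpha>"

definition translate :: "('g \<Rightarrow> 'x \<Rightarrow> 'x) \<Rightarrow> 'g \<Rightarrow> 'x set set \<Rightarrow> 'x set set" where
  "translate \<phi> g \<alpha> = (\<lambda>A. \<phi> g ` A) ` \<alpha>"

definition translates_join :: "('g \<Rightarrow> 'x \<Rightarrow> 'x) \<Rightarrow> 'g set \<Rightarrow> 'x set set \<Rightarrow> 'x set set" where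
  "translates_join \<phi> F \<alpha> = common_refinement ((\<lambda>g. translate \<phi> g \<alpha>) ` F)"

text \<open>
  Entropy uses the natural logarithm and takes values in \<open>[0, \<infinity>]\<close>.  All terms are
  nonnegative, so the unordered sum always exists in \<open>ereal\<close>.
\<close>

definition shannon_entropy :: "'x measure \<Rightarrow> 'x set set \<Rightarrow> ereal" where
  "shannon_entropy M \<alpha> = (\<Sum>\<^sub>\<infinity>A\<in>\<alpha>. ereal (- measure M A * ln (measure M A)))"

definition invariant_sigma_algebra ::
    "('g, 'm) monoid_scheme \<Rightarrow> 'x measure \<Rightarrow> ('g \<Rightarrow> 'x \<Rightarrow> 'x) \<Rightarrow> 'x set set \<Rightarrow> bool" where
  "invariant_sigma_algebra G M \<phi> \<A> \<longleftrightarrow>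
     sigma_algebra (space M) \<A> \<and> (\<forall>g \<in> carrier G. \<forall>A \<in> \<A>. \<phi> g ` A \<in> \<A>)"

definition generated_invariant_sigma_algebra ::
    "('g, 'm) monoid_scheme \<Rightarrow> 'x measure \<Rightarrow> ('g \<Rightarrow> 'x \<Rightarrow> 'x) \<Rightarrow> 'x set set \<Rightarrow> 'x set set" where
  "generated_invariant_sigma_algebra G M \<phi> \<alpha> =
     \<Inter> {\<A>. invariant_sigma_algebra G M \<phi> \<A> \<and> \<alpha> \<subseteq> \<A>}"

definition generating_partition ::
    "('g, 'm) monoid_scheme \<Rightarrow> 'x measure \<Rightarrow> ('g \<Rightarrow> 'x \<Rightarrow> 'x) \<Rightarrow> 'x set set \<Rightarrow> bool" where
  "generating_partition G M \<phi> \<alpha> \<longleftrightarrow>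
     countable_partition M \<alpha> \<and>
     (\<forall>B \<in> sets M. \<exists>A \<in> generated_invariant_sigma_algebra G M \<phi> \<alpha>. sym_diff A B \<in> null_sets M)"


section \<open>The f-invariant\<close>

text \<open>Only meaningful when \<open>S\<close> is finite and \<open>\<alpha>\<close> has finite entropy.\<close>

definition F_entropy ::
    "'x measure \<Rightarrow> ('g \<Rightarrow> 'x \<Rightarrow> 'x) \<Rightarrow> 'g set \<Rightarrow> 'x set set \<Rightarrow> ereal" where
  "F_entropy M \<phi> S \<alpha> =
     ereal (1 - 2 * real (card S)) * shannon_entropy M \<alpha> +
     (\<Sum>s\<in>S. shannon_entropy M (common_refinement {translate \<phi> s \<alpha>, \<alpha>}))"

text \<open>
  \<open>f_invariant G M \<phi>\<close> depends on the action only.  It is the limit of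
  \<open>F_entropy M \<phi> S (B\<^sub>S(n) \<cdot> \<alpha>)\<close> for some free generating set \<open>S\<close> and some
  generating partition \<open>\<alpha>\<close> of finite entropy.  By theorems of Bowen the limit exists in
  \<open>[-\<infinity>, \<infinity>)\<close> and is the same for all such \<open>S\<close> and \<open>\<alpha>\<close>, so the choice is
  immaterial.
\<close>

definition f_invariant ::
    "('g, 'm) monoid_scheme \<Rightarrow> 'x measure \<Rightarrow> ('g \<Rightarrow> 'x \<Rightarrow> 'x) \<Rightarrow> ereal" where
  "f_invariant G M \<phi> =
     (SOME L. \<exists>S \<alpha>. free_generating_set G S \<and> generating_partition G M \<phi> \<alpha> \<and>
        shannon_entropy M \<alpha> < \<infinity> \<and>
        (\<lambda>n. F_entropy M \<phi> S (translates_join \<phi> (word_ball G S n) \<alpha>)) \<longlonglongrightarrow> L)"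

end

theory Submission
  imports Defs "HOL-Library.Transitive_Closure_Table"
begin

text \<open>
  For a finite graph whose vertices carry partitions and whose edges carry group elements, the
  Bethe functional is the sum of the vertex entropies minus the mutual informations
  along the edges.  Joining to the partition at a vertex the translate of a partition seen along an
  edge never increases it, and on the rose with petals \<open>S\<close> it is the functional \<open>F\<close>.

  Right multiplication by \<open>s\<close> is a partial injection of \<open>\<Delta>\<close>; extending it to a permutation for
  every \<open>s \<in> S\<close> makes \<open>\<Delta>\<close> a finite covering of the rose.  Placing a translate of
  \<open>\<Delta> \<cdot> \<alpha>\<close> at one vertex and the trivial partition elsewhere gives a functional of at most
  \<open>H(\<Delta> \<cdot> \<alpha>)\<close>; as \<open>\<Delta>\<close> is connected, finitely many joins along edges lead from there to a family
  refining \<open>\<alpha>\<close> at all vertices, and then to the constant family with value a ball over \<open>\<alpha>\<close>, on which the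
  functional is \<open>|\<Delta>|\<close> times \<open>F\<close>.

  The definition of the f-invariant leaves the basis and the generating partition open.
  Passing from one generating partition to another is a comparison of joins of balls over both.  A
  change of basis is a sequence of Stallings folds from the subdivided rose of the old basis
  to the rose of the new one, and each fold respects lower bounds of the Bethe functional.
\<close>

section \<open>Entropy on a lattice of partitions\<close>

text \<open>The combinatorial part rests on monotonicity, submodularity and invariance of entropy
  alone, so it is carried out over an abstract lattice with a real-valued \<open>H\<close>. The
  extension of the partial injections is arbitrary, and its extra edges have no meaning in the
  Cayley tree. They do no harm, because mutual information is nonnegative and joins may run along
  any edge; they are wanted because a constant family yields \<open>card \<Delta>\<close> times
  \<open>F\<close> only if every petal is present at every vertex. The family reached from
  \<open>\<Delta>\<close> is not constant. It is kept as a bystander: joined with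
  \<open>\<alpha>\<close> it remains itself, joined with a large ball it disappears, and passing
  from \<open>\<alpha>\<close> to the ball lowers the functional. Independence of the choices enters
  as a one-sided bound: a limit \<open>L\<close> obtained from any basis \<open>T\<close> and any
  generating partition satisfies \<open>L \<le> F T b\<close> for all \<open>b\<close> refining
  \<open>\<alpha>\<close>, and a bound of this shape passes from \<open>T\<close> to
  \<open>S\<close>.\<close>

locale entropy_lattice =
  fixes C :: "'p set" and le :: "'p \<Rightarrow> 'p \<Rightarrow> bool" (infix "\<preceq>" 50)
    and Jn :: "'p set \<Rightarrow> 'p" and H :: "'p \<Rightarrow> real" and bt :: 'p
  assumes le_refl: "a \<in> C \<Longrightarrow> a \<preceq> a"
    and le_trans: "a \<preceq> b \<Longrightarrow> b \<preceq> c \<Longrightarrow> a \<preceq> c"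
    and le_antisym: "a \<preceq> b \<Longrightarrow> b \<preceq> a \<Longrightarrow> a = b"
    and Jn_closed: "finite X \<Longrightarrow> X \<noteq> {} \<Longrightarrow> X \<subseteq> C \<Longrightarrow> Jn X \<in> C"
    and Jn_upper: "finite X \<Longrightarrow> X \<subseteq> C \<Longrightarrow> a \<in> X \<Longrightarrow> a \<preceq> Jn X"
    and Jn_least: "finite X \<Longrightarrow> X \<noteq> {} \<Longrightarrow> X \<subseteq> C \<Longrightarrow> c \<in> C \<Longrightarrow> (\<And>a. a \<in> X \<Longrightarrow> a \<preceq> c) \<Longrightarrow> Jn X \<preceq> c"
    and bt_closed: "bt \<in> C" and bt_le: "a \<in> C \<Longrightarrow> bt \<preceq> a" and H_bt: "H bt = 0"
    and H_mono: "a \<in> C \<Longrightarrow> b \<in> C \<Longrightarrow> a \<preceq> b \<Longrightarrow> H a \<le> H b"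
    and H_submod: "a \<in> C \<Longrightarrow> b \<in> C \<Longrightarrow> c \<in> C \<Longrightarrow> c \<preceq> a \<Longrightarrow> c \<preceq> b \<Longrightarrow> H (Jn {a, b}) + H c \<le> H a + H b"
begin

declare le_trans [trans]

definition join :: "'p \<Rightarrow> 'p \<Rightarrow> 'p" (infixl "\<curlyvee>" 65) where "a \<curlyvee> b = Jn {a, b}"

text \<open>Mutual information. As a difference it relies on \<open>H\<close> being real-valued,
  which is why partitions of infinite entropy are kept out of the lattice.\<close>

definition I :: "'p \<Rightarrow> 'p \<Rightarrow> real" where "I a b = H a + H b - H (a \<curlyvee> b)"

lemma join_closed [simp, intro]: "a \<in> C \<Longrightarrow> b \<in> C \<Longrightarrow> a \<curlyvee> b \<in> C"
  unfolding join_def by (rule Jn_closed) auto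

lemma join_ub1: "a \<in> C \<Longrightarrow> b \<in> C \<Longrightarrow> a \<preceq> a \<curlyvee> b"
  and join_ub2: "a \<in> C \<Longrightarrow> b \<in> C \<Longrightarrow> b \<preceq> a \<curlyvee> b"
  unfolding join_def by (auto intro!: Jn_upper)

lemma join_least: "a \<in> C \<Longrightarrow> b \<in> C \<Longrightarrow> c \<in> C \<Longrightarrow> a \<preceq> c \<Longrightarrow> b \<preceq> c \<Longrightarrow> a \<curlyvee> b \<preceq> c"
  unfolding join_def by (rule Jn_least) auto

lemma le_join1: "c \<preceq> a \<Longrightarrow> a \<in> C \<Longrightarrow> b \<in> C \<Longrightarrow> c \<preceq> a \<curlyvee> b"
  using le_trans join_ub1 by blast

lemma le_join2: "c \<preceq> b \<Longrightarrow> a \<in> C \<Longrightarrow> b \<in> C \<Longrightarrow> c \<preceq> a \<curlyvee> b"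
  using le_trans join_ub2 by blast

lemma join_commute: "a \<curlyvee> b = b \<curlyvee> a"
  unfolding join_def by (simp add: insert_commute)

lemma join_assoc: "a \<in> C \<Longrightarrow> b \<in> C \<Longrightarrow> c \<in> C \<Longrightarrow> a \<curlyvee> b \<curlyvee> c = a \<curlyvee> (b \<curlyvee> c)"
  by (rule le_antisym) (intro join_least le_join1 le_join2 join_closed le_refl
      le_join1[of _ a] le_join2[of _ "b \<curlyvee> c"] le_join2[of _ c]; simp add: le_refl join_ub1 join_ub2)+

lemma join_left_commute: "a \<in> C \<Longrightarrow> b \<in> C \<Longrightarrow> c \<in> C \<Longrightarrow> a \<curlyvee> (b \<curlyvee> c) = b \<curlyvee> (a \<curlyvee> c)"
  using join_assoc join_commute by metis

lemma join_absorb1: "a \<in> C \<Longrightarrow> b \<in> C \<Longrightarrow> a \<preceq> b \<Longrightarrow> a \<curlyvee> b = b"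
  by (rule le_antisym) (auto intro: join_least join_ub2 le_refl)

lemma join_absorb2: "a \<in> C \<Longrightarrow> b \<in> C \<Longrightarrow> b \<preceq> a \<Longrightarrow> a \<curlyvee> b = a"
  using join_absorb1 join_commute by metis

lemma join_mono: "a \<in> C \<Longrightarrow> b \<in> C \<Longrightarrow> a' \<in> C \<Longrightarrow> b' \<in> C \<Longrightarrow> a \<preceq> a' \<Longrightarrow> b \<preceq> b' \<Longrightarrow> a \<curlyvee> b \<preceq> a' \<curlyvee> b'"
  by (intro join_least le_join1 le_join2) auto

section \<open>Consequences of submodularity for conditional entropy and mutual information\<close>

lemma submodular: "a \<in> C \<Longrightarrow> b \<in> C \<Longrightarrow> c \<in> C \<Longrightarrow> c \<preceq> a \<Longrightarrow> c \<preceq> b \<Longrightarrow> H (a \<curlyvee> b) + H c \<le> H a + H b"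
  unfolding join_def by (rule H_submod)

lemma subadditive: "a \<in> C \<Longrightarrow> b \<in> C \<Longrightarrow> H (a \<curlyvee> b) \<le> H a + H b"
  using submodular[of a b bt] by (simp add: bt_closed bt_le H_bt)

lemma I_nonneg: "a \<in> C \<Longrightarrow> b \<in> C \<Longrightarrow> 0 \<le> I a b"
  unfolding I_def using subadditive by fastforce

lemma I_commute: "I a b = I b a"
  unfolding I_def by (simp add: join_commute)

text \<open>Here \<open>H (a \<curlyvee> c) - H c\<close> is the conditional entropy of
  \<open>a\<close> given \<open>c\<close>. The inequality is submodularity for
  \<open>a \<curlyvee> b\<close> and \<open>c\<close>, with \<open>b\<close> as their common lower
  bound.\<close>

lemma cond_entropy_antimono:
  assumes "a \<in> C" "b \<in> C" "c \<in> C" "b \<preceq> c"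
  shows "H (a \<curlyvee> c) - H c \<le> H (a \<curlyvee> b) - H b"
proof -
  have "a \<curlyvee> b \<curlyvee> c = a \<curlyvee> c"
    using assms by (simp add: join_assoc join_absorb1)
  with submodular[of "a \<curlyvee> b" c b] assms show ?thesis
    by (simp add: join_ub2)
qed

lemma cond_entropy_mono:
  assumes "a \<in> C" "a' \<in> C" "c \<in> C" "a \<preceq> a'"
  shows "H (a \<curlyvee> c) - H c \<le> H (a' \<curlyvee> c) - H c"
  using H_mono[of "a \<curlyvee> c" "a' \<curlyvee> c"] assms by (simp add: join_mono le_refl)

text \<open>Chain rule: the left side is the entropy of \<open>a\<close> given
  \<open>b \<curlyvee> c\<close> plus that of \<open>b\<close> given \<open>c\<close>; forgetting
  \<open>b\<close> in the first condition can only increase it.\<close>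

lemma cond_entropy_subadditive:
  assumes "a \<in> C" "b \<in> C" "c \<in> C"
  shows "H (a \<curlyvee> b \<curlyvee> c) - H c \<le> (H (a \<curlyvee> c) - H c) + (H (b \<curlyvee> c) - H c)"
  using cond_entropy_antimono[of a c "b \<curlyvee> c"] assms by (simp add: join_assoc join_ub2)

text \<open>Triangle inequality for conditional entropy: \<open>b\<close> is inserted, and then
  \<open>c\<close> is dropped from the condition of the first term.\<close>

lemma cond_entropy_chain:
  assumes "a \<in> C" "b \<in> C" "c \<in> C"
  shows "H (a \<curlyvee> c) - H c \<le> (H (a \<curlyvee> b) - H b) + (H (b \<curlyvee> c) - H c)"
proof -
  have "H (a \<curlyvee> c) \<le> H (a \<curlyvee> (b \<curlyvee> c))"
    using assms by (intro H_mono) (auto intro: join_mono join_ub2 le_refl)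
  with cond_entropy_antimono[of a b "b \<curlyvee> c"] assms show ?thesis
    by (simp add: join_ub1)
qed

lemma cond_entropy_nonneg: "a \<in> C \<Longrightarrow> c \<in> C \<Longrightarrow> 0 \<le> H (a \<curlyvee> c) - H c"
  using H_mono[of c "a \<curlyvee> c"] by (simp add: join_ub2)

text \<open>\<open>I a b\<close> is \<open>H b\<close> minus the entropy of \<open>b\<close> given
  \<open>a\<close>, so a finer condition increases it; by symmetry the two arguments can be enlarged
  one after the other.\<close>

lemma I_mono:
  assumes "a \<in> C" "b \<in> C" "a' \<in> C" "b' \<in> C" "a \<preceq> a'" "b \<preceq> b'"
  shows "I a b \<le> I a' b'"
  using cond_entropy_antimono[of b a a'] cond_entropy_antimono[of a' b b'] assms
  unfolding I_def by (simp add: join_commute)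

end

section \<open>Entropy lattices with a group acting by automorphisms\<close>

locale entropy_action = entropy_lattice + group G
  for G :: "('g, 'm) monoid_scheme" (structure) +
  fixes act :: "'g \<Rightarrow> 'a \<Rightarrow> 'a"
  assumes act_closed [simp, intro]: "g \<in> carrier G \<Longrightarrow> a \<in> C \<Longrightarrow> act g a \<in> C"
    and act_mono: "g \<in> carrier G \<Longrightarrow> a \<in> C \<Longrightarrow> b \<in> C \<Longrightarrow> a \<preceq> b \<Longrightarrow> act g a \<preceq> act g b"
    and act_act: "g \<in> carrier G \<Longrightarrow> h \<in> carrier G \<Longrightarrow> a \<in> C \<Longrightarrow> act g (act h a) = act (g \<otimes> h) a"
    and act_one [simp]: "a \<in> C \<Longrightarrow> act \<one> a = a"
    and H_act [simp]: "g \<in> carrier G \<Longrightarrow> a \<in> C \<Longrightarrow> H (act g a) = H a"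
begin

lemma act_inv_act [simp]: "g \<in> carrier G \<Longrightarrow> a \<in> C \<Longrightarrow> act (inv g) (act g a) = a"
  and act_act_inv [simp]: "g \<in> carrier G \<Longrightarrow> a \<in> C \<Longrightarrow> act g (act (inv g) a) = a"
  by (simp_all add: act_act)

text \<open>The action is only assumed to respect the order; joins follow because
  \<open>act (inv g)\<close> carries an upper bound of the translates back to an upper bound of
  \<open>X\<close>.\<close>

lemma act_Jn:
  assumes g: "g \<in> carrier G" and X: "finite X" "X \<noteq> {}" "X \<subseteq> C"
  shows "act g (Jn X) = Jn (act g ` X)"
proof (rule le_antisym)
  have JX: "Jn X \<in> C" and JgX: "Jn (act g ` X) \<in> C"
    using assms by (auto intro!: Jn_closed)
  have "Jn X \<preceq> act (inv g) (Jn (act g ` X))"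
  proof (rule Jn_least)
    fix a assume "a \<in> X"
    then have "act g a \<preceq> Jn (act g ` X)" using assms by (intro Jn_upper) auto
    then have "act (inv g) (act g a) \<preceq> act (inv g) (Jn (act g ` X))"
      using JgX assms \<open>a \<in> X\<close> by (intro act_mono) auto
    then show "a \<preceq> act (inv g) (Jn (act g ` X))" using \<open>a \<in> X\<close> assms by auto
  qed (use assms JgX in auto)
  then have "act g (Jn X) \<preceq> act g (act (inv g) (Jn (act g ` X)))"
    using JgX JX g by (intro act_mono) auto
  then show "act g (Jn X) \<preceq> Jn (act g ` X)" using JgX g by simp
  show "Jn (act g ` X) \<preceq> act g (Jn X)"
    using assms JX by (intro Jn_least) (auto intro!: act_mono Jn_upper)
qed

lemma act_join: "g \<in> carrier G \<Longrightarrow> a \<in> C \<Longrightarrow> b \<in> C \<Longrightarrow> act g (a \<curlyvee> b) = act g a \<curlyvee> act g b"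
  unfolding join_def by (subst act_Jn) auto

lemma I_act: "g \<in> carrier G \<Longrightarrow> a \<in> C \<Longrightarrow> b \<in> C \<Longrightarrow> I (act g a) (act g b) = I a b"
  unfolding I_def by (simp flip: act_join)

text \<open>The weight of an edge can be read from either end, which makes edges reversible.\<close>

lemma I_act_inv: "g \<in> carrier G \<Longrightarrow> a \<in> C \<Longrightarrow> b \<in> C \<Longrightarrow> I a (act (inv g) b) = I b (act g a)"
  using I_act[of g a "act (inv g) b"] by (simp add: I_commute)

definition orbit_join :: "'g set \<Rightarrow> 'a \<Rightarrow> 'a" where
  "orbit_join F a = Jn ((\<lambda>g. act g a) ` F)"

lemma orbit_join_closed: "finite F \<Longrightarrow> F \<noteq> {} \<Longrightarrow> F \<subseteq> carrier G \<Longrightarrow> a \<in> C \<Longrightarrow> orbit_join F a \<in> C"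
  unfolding orbit_join_def by (intro Jn_closed) auto

lemma orbit_join_upper: "finite F \<Longrightarrow> F \<subseteq> carrier G \<Longrightarrow> a \<in> C \<Longrightarrow> g \<in> F \<Longrightarrow> act g a \<preceq> orbit_join F a"
  unfolding orbit_join_def by (intro Jn_upper) auto

lemma orbit_join_least:
  "finite F \<Longrightarrow> F \<noteq> {} \<Longrightarrow> F \<subseteq> carrier G \<Longrightarrow> a \<in> C \<Longrightarrow> c \<in> C \<Longrightarrow> (\<And>g. g \<in> F \<Longrightarrow> act g a \<preceq> c)
    \<Longrightarrow> orbit_join F a \<preceq> c"
  unfolding orbit_join_def by (rule Jn_least) auto

lemma orbit_join_mono:
  assumes "finite F" "F \<noteq> {}" "F \<subseteq> carrier G" "a \<in> C" "b \<in> C" "a \<preceq> b"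
  shows "orbit_join F a \<preceq> orbit_join F b"
  using assms
  by (intro orbit_join_least orbit_join_closed) (auto intro: le_trans act_mono orbit_join_upper)

lemma orbit_join_subset:
  assumes "finite F'" "F \<noteq> {}" "F \<subseteq> F'" "F' \<subseteq> carrier G" "a \<in> C"
  shows "orbit_join F a \<preceq> orbit_join F' a"
  using assms by (intro orbit_join_least orbit_join_closed orbit_join_upper) (auto dest: finite_subset)

lemma act_orbit_join:
  assumes "g \<in> carrier G" "finite F" "F \<noteq> {}" "F \<subseteq> carrier G" "a \<in> C"
  shows "act g (orbit_join F a) = orbit_join ((\<lambda>h. g \<otimes> h) ` F) a"
proof -
  have "act g ` (\<lambda>h. act h a) ` F = (\<lambda>h. act h a) ` (\<lambda>h. g \<otimes> h) ` F"
    using assms by (auto simp: image_image act_act subset_iff intro!: image_cong)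
  then show ?thesis
    using assms unfolding orbit_join_def by (subst act_Jn) auto
qed

text \<open>Subadditivity and invariance, one translate at a time. With \<open>\<Delta>\<close> in
  place of \<open>F\<close> this is the right-hand inequality of the theorem.\<close>

lemma H_orbit_join_le:
  assumes "finite F" "F \<noteq> {}" "F \<subseteq> carrier G" "a \<in> C"
  shows "H (orbit_join F a) \<le> real (card F) * H a"
  using assms
proof (induction rule: finite_ne_induct)
  case (singleton g)
  then have "orbit_join {g} a \<preceq> act g a"
    by (intro orbit_join_least) (auto intro: le_refl)
  then show ?case using singleton H_mono[of "orbit_join {g} a" "act g a"] 
    by (simp add: orbit_join_closed)
next
  case (insert g F)
  have J: "orbit_join F a \<in> C"
    using insert by (intro orbit_join_closed) auto
  have "orbit_join (insert g F) a \<preceq> act g a \<curlyvee> orbit_join F a"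
  proof (rule orbit_join_least)
    fix h assume h: "h \<in> insert g F"
    show "act h a \<preceq> act g a \<curlyvee> orbit_join F a"
    proof (cases "h = g")
      case True
      then show ?thesis using insert J by (simp add: join_ub1)
    next
      case False
      then show ?thesis using h insert J by (intro le_join2 orbit_join_upper) auto
    qed
  qed (use insert J in auto)
  then have "H (orbit_join (insert g F) a) \<le> H (act g a \<curlyvee> orbit_join F a)"
    using insert J by (intro H_mono orbit_join_closed) auto
  also have "\<dots> \<le> H (act g a) + H (orbit_join F a)"
    using insert J by (intro subadditive) auto
  also have "\<dots> \<le> real (card (insert g F)) * H a"
    using insert by (simp add: algebra_simps)
  finally show ?case .
qed

end

section \<open>The Bethe functional of a finite graph of partitions\<close>

context entropy_action
begin

text \<open>An edge \<open>(v, g, w)\<close> compares the partition at \<open>v\<close> with the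
  translate by \<open>g\<close> of the one at \<open>w\<close>. Edges form a multiset because
  folding can make edges with equal labels parallel, and every copy counts.\<close>

definition bethe :: "'v set \<Rightarrow> ('v \<times> 'g \<times> 'v) multiset \<Rightarrow> ('v \<Rightarrow> 'a) \<Rightarrow> real" where
  "bethe V E \<beta> = (\<Sum>v\<in>V. H (\<beta> v)) - (\<Sum>(v, g, w)\<in>#E. I (\<beta> v) (act g (\<beta> w)))"

definition graph :: "'v set \<Rightarrow> ('v \<times> 'g \<times> 'v) multiset \<Rightarrow> bool" where
  "graph V E \<longleftrightarrow> finite V \<and> set_mset E \<subseteq> V \<times> carrier G \<times> V"

definition rev_edge :: "'v \<times> 'g \<times> 'v \<Rightarrow> 'v \<times> 'g \<times> 'v" where
  "rev_edge = (\<lambda>(v, g, w). (w, inv g, v))"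

lemma graph_rev: "graph V E \<Longrightarrow> graph V (image_mset rev_edge E)"
  unfolding graph_def rev_edge_def by auto

lemma bethe_rev:
  assumes "graph V E" "\<And>v. v \<in> V \<Longrightarrow> \<beta> v \<in> C"
  shows "bethe V (image_mset rev_edge E) \<beta> = bethe V E \<beta>"
proof -
  have "(\<Sum>(v, g, w)\<in>#image_mset rev_edge E. I (\<beta> v) (act g (\<beta> w)))
      = (\<Sum>(v, g, w)\<in>#E. I (\<beta> v) (act g (\<beta> w)))"
    unfolding image_mset.compositionality comp_def
  proof (rule arg_cong[of _ _ sum_mset], rule image_mset_cong)
    fix e assume "e \<in># E"
    then show "(case rev_edge e of (v, g, w) \<Rightarrow> I (\<beta> v) (act g (\<beta> w))) =
        (case e of (v, g, w) \<Rightarrow> I (\<beta> v) (act g (\<beta> w)))"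
      using assms unfolding graph_def rev_edge_def by (cases e) (auto simp: I_act_inv)
  qed
  then show ?thesis unfolding bethe_def by simp
qed

lemma bethe_cong:
  assumes "graph V E" "\<And>v. v \<in> V \<Longrightarrow> \<beta> v = \<beta>' v"
  shows "bethe V E \<beta> = bethe V E \<beta>'"
proof -
  have "(\<Sum>(v, g, w)\<in>#E. I (\<beta> v) (act g (\<beta> w))) = (\<Sum>(v, g, w)\<in>#E. I (\<beta>' v) (act g (\<beta>' w)))"
    using assms by (intro arg_cong[of _ _ sum_mset] image_mset_cong) (force simp: graph_def)
  with assms(2) show ?thesis unfolding bethe_def by simp
qed

lemma sum_I_mono:
  assumes "set_mset E \<subseteq> V \<times> carrier G \<times> V"
    and "\<And>v. v \<in> V \<Longrightarrow> \<beta> v \<in> C" "\<And>v. v \<in> V \<Longrightarrow> \<beta>' v \<in> C" "\<And>v. v \<in> V \<Longrightarrow> \<beta> v \<preceq> \<beta>' v"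
  shows "(\<Sum>(v, g, w)\<in>#E. I (\<beta> v) (act g (\<beta> w))) \<le> (\<Sum>(v, g, w)\<in>#E. I (\<beta>' v) (act g (\<beta>' w)))"
  using assms by (intro sum_mset_mono) (auto intro!: I_mono act_mono)

lemma sum_I_nonneg:
  assumes "set_mset E \<subseteq> V \<times> carrier G \<times> V" "\<And>v. v \<in> V \<Longrightarrow> \<beta> v \<in> C"
  shows "0 \<le> (\<Sum>(v, g, w)\<in>#E. I (\<beta> v) (act g (\<beta> w)))"
  using sum_mset_mono[of E "\<lambda>_. 0" "\<lambda>(v, g, w). I (\<beta> v) (act g (\<beta> w))"] assms
  by (auto intro!: I_nonneg act_closed)

lemma sum_fun_upd:
  assumes "finite V" "v \<in> V"
  shows "(\<Sum>u\<in>V. H ((\<beta>(v := x)) u)) = (\<Sum>u\<in>V. H (\<beta> u)) - H (\<beta> v) + H x"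
  using assms by (simp add: sum.remove[of V v])

text \<open>
  The entropy gained at \<open>v\<close> is outweighed by the mutual information gained along the edge
  over which the translate of \<open>\<theta>\<close> was fetched.
\<close>
lemma bethe_split:
  assumes G: "graph V E" and e: "(v, g, w) \<in># E" and \<theta>: "\<theta> \<in> C" "\<theta> \<preceq> \<beta> w"
    and \<beta>: "\<And>u. u \<in> V \<Longrightarrow> \<beta> u \<in> C"
  shows "bethe V E (\<beta>(v := \<beta> v \<curlyvee> act g \<theta>)) \<le> bethe V E \<beta>"
proof -
  define \<beta>' where "\<beta>' = \<beta>(v := \<beta> v \<curlyvee> act g \<theta>)"
  obtain E0 where E0: "E = add_mset (v, g, w) E0"
    using e by (metis mset_add)
  have V: "v \<in> V" "w \<in> V" "g \<in> carrier G" "finite V" "set_mset E0 \<subseteq> V \<times> carrier G \<times> V"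
    using G E0 unfolding graph_def by auto
  have \<beta>'C: "\<beta>' u \<in> C" if "u \<in> V" for u
    using that V \<beta> \<theta> unfolding \<beta>'_def by auto
  have le: "\<beta> u \<preceq> \<beta>' u" if "u \<in> V" for u
    using that V \<beta> \<theta> unfolding \<beta>'_def by (auto intro: le_refl join_ub1)
  \<comment> \<open>On a loop \<open>w\<close> is \<open>v\<close>, so the partition at the far end
    may have grown as well.\<close>
  have "I (\<beta>' v) (act g (\<beta> w)) \<le> I (\<beta>' v) (act g (\<beta>' w))"
    using V \<beta> \<beta>'C le by (intro I_mono act_mono act_closed) (auto intro: le_refl)
  moreover have "act g \<theta> \<preceq> act g (\<beta> w)"
    using V \<beta> \<theta> by (intro act_mono) auto
  then have "\<beta>' v \<curlyvee> act g (\<beta> w) = \<beta> v \<curlyvee> act g (\<beta> w)"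
    using V \<beta> \<theta> by (simp add: \<beta>'_def join_assoc join_absorb1)
  \<comment> \<open>\<open>H x - I x y\<close> equals \<open>H (x \<curlyvee> y) - H y\<close>, and
    joining with \<open>act g (\<beta> w)\<close> hides the change at \<open>v\<close>.\<close>
  ultimately have "H (\<beta>' v) - I (\<beta>' v) (act g (\<beta>' w)) \<le> H (\<beta> v) - I (\<beta> v) (act g (\<beta> w))"
    unfolding I_def by simp
  moreover have "(\<Sum>u\<in>V. H (\<beta>' u)) = (\<Sum>u\<in>V. H (\<beta> u)) - H (\<beta> v) + H (\<beta>' v)"
    unfolding \<beta>'_def using sum_fun_upd[OF V(4,1), of \<beta>] by simp
  moreover have "(\<Sum>(v, g, w)\<in>#E0. I (\<beta> v) (act g (\<beta> w))) \<le> (\<Sum>(v, g, w)\<in>#E0. I (\<beta>' v) (act g (\<beta>' w)))"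
    using V \<beta> \<beta>'C le by (intro sum_I_mono) auto
  ultimately show ?thesis
    unfolding bethe_def E0 \<beta>'_def[symmetric] by simp
qed

text \<open>The same move against the direction of an edge, by reversing the whole graph.\<close>

lemma bethe_split_rev:
  assumes G: "graph V E" and e: "(w, g, v) \<in># E" and \<theta>: "\<theta> \<in> C" "\<theta> \<preceq> \<beta> w"
    and \<beta>: "\<And>u. u \<in> V \<Longrightarrow> \<beta> u \<in> C"
  shows "bethe V E (\<beta>(v := \<beta> v \<curlyvee> act (inv g) \<theta>)) \<le> bethe V E \<beta>"
proof -
  have e': "(v, inv g, w) \<in># image_mset rev_edge E"
    using e by (force simp: rev_edge_def)
  have g: "g \<in> carrier G"
    using G e by (auto simp: graph_def)
  have "bethe V (image_mset rev_edge E) (\<beta>(v := \<beta> v \<curlyvee> act (inv g) \<theta>)) \<le> bethe V (image_mset rev_edge E) \<beta>"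
    using graph_rev[OF G] e' \<theta> \<beta> by (rule bethe_split)
  then show ?thesis
    using \<beta> \<theta> g by (subst (asm) (1 2) bethe_rev[OF G]) auto
qed

text \<open>The join with a bystander family \<open>\<kappa>\<close> makes this relation compatible with joins.\<close>

definition expands :: "'v set \<Rightarrow> ('v \<times> 'g \<times> 'v) multiset \<Rightarrow> ('v \<Rightarrow> 'a) \<Rightarrow> ('v \<Rightarrow> 'a) \<Rightarrow> bool" where
  "expands V E \<beta> \<beta>' \<longleftrightarrow> (\<forall>\<kappa>. (\<forall>v\<in>V. \<kappa> v \<in> C) \<longrightarrow>
      bethe V E (\<lambda>v. \<beta>' v \<curlyvee> \<kappa> v) \<le> bethe V E (\<lambda>v. \<beta> v \<curlyvee> \<kappa> v))"

lemma expands_refl: "expands V E \<beta> \<beta>"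
  unfolding expands_def by simp

lemma expands_trans: "expands V E \<beta> \<beta>' \<Longrightarrow> expands V E \<beta>' \<beta>'' \<Longrightarrow> expands V E \<beta> \<beta>''"
  unfolding expands_def by (meson order_trans)

lemma expandsD: "expands V E \<beta> \<beta>' \<Longrightarrow> (\<And>v. v \<in> V \<Longrightarrow> \<kappa> v \<in> C) \<Longrightarrow>
    bethe V E (\<lambda>v. \<beta>' v \<curlyvee> \<kappa> v) \<le> bethe V E (\<lambda>v. \<beta> v \<curlyvee> \<kappa> v)"
  unfolding expands_def by blast

lemma expandsD_plain:
  assumes "expands V E \<beta> \<beta>'" "graph V E" "\<And>v. v \<in> V \<Longrightarrow> \<beta> v \<in> C" "\<And>v. v \<in> V \<Longrightarrow> \<beta>' v \<in> C"
  shows "bethe V E \<beta>' \<le> bethe V E \<beta>"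
proof -
  have bt: "x \<curlyvee> bt = x" if "x \<in> C" for x
    using that by (simp add: join_absorb2 bt_closed bt_le)
  have "bethe V E (\<lambda>v. \<beta>' v \<curlyvee> bt) \<le> bethe V E (\<lambda>v. \<beta> v \<curlyvee> bt)"
    using assms(1) by (rule expandsD) (simp add: bt_closed)
  also have "bethe V E (\<lambda>v. \<beta> v \<curlyvee> bt) = bethe V E \<beta>"
    using assms by (intro bethe_cong) (auto simp: bt)
  also have "bethe V E (\<lambda>v. \<beta>' v \<curlyvee> bt) = bethe V E \<beta>'"
    using assms by (intro bethe_cong) (auto simp: bt)
  finally show ?thesis .
qed

text \<open>The bystander is harmless because the fetched \<open>\<theta>\<close> need only lie
  below the partition at \<open>w\<close>, and it still does after \<open>\<kappa> w\<close> is
  joined there. The slack between \<open>\<theta>\<close> and \<open>\<beta> w\<close> is used again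
  when many fetches are made in turn.\<close>

lemma expands_split:
  assumes G: "graph V E" and v: "v \<in> V" "w \<in> V" and \<theta>: "\<theta> \<in> C" "\<theta> \<preceq> \<beta> w"
    and \<beta>: "\<And>u. u \<in> V \<Longrightarrow> \<beta> u \<in> C" and g: "g \<in> carrier G"
    and e: "(v, g, w) \<in># E \<or> (w, inv g, v) \<in># E"
  shows "expands V E \<beta> (\<beta>(v := \<beta> v \<curlyvee> act g \<theta>))"
  unfolding expands_def
proof (intro allI impI)
  fix \<kappa> assume \<kappa>: "\<forall>v\<in>V. \<kappa> v \<in> C"
  define \<gamma> where "\<gamma> = (\<lambda>u. \<beta> u \<curlyvee> \<kappa> u)"
  have \<gamma>: "\<gamma> u \<in> C" if "u \<in> V" for u
    using that \<kappa> \<beta> unfolding \<gamma>_def by auto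
  have \<theta>': "\<theta> \<preceq> \<gamma> w"
    unfolding \<gamma>_def using v \<kappa> \<beta> \<theta> by (intro le_join1) auto
  have "bethe V E (\<gamma>(v := \<gamma> v \<curlyvee> act g \<theta>)) \<le> bethe V E \<gamma>"
    using e
  proof
    assume "(v, g, w) \<in># E"
    then show ?thesis using G \<theta> \<theta>' \<gamma> by (intro bethe_split) auto
  next
    assume "(w, inv g, v) \<in># E"
    from bethe_split_rev[of V E w "inv g" v \<theta> \<gamma>, OF G this \<theta>(1) \<theta>' \<gamma>] g show ?thesis
      by simp
  qed
  also have "bethe V E (\<gamma>(v := \<gamma> v \<curlyvee> act g \<theta>)) = bethe V E (\<lambda>u. (\<beta>(v := \<beta> v \<curlyvee> act g \<theta>)) u \<curlyvee> \<kappa> u)"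
    using G
  proof (rule bethe_cong)
    fix u assume "u \<in> V"
    show "(\<gamma>(v := \<gamma> v \<curlyvee> act g \<theta>)) u = (\<beta>(v := \<beta> v \<curlyvee> act g \<theta>)) u \<curlyvee> \<kappa> u"
      using v \<kappa> \<beta> \<theta> g unfolding \<gamma>_def
      by (simp add: join_assoc join_commute[of "\<kappa> v" "act g \<theta>"])
  qed
  finally show "bethe V E (\<lambda>u. (\<beta>(v := \<beta> v \<curlyvee> act g \<theta>)) u \<curlyvee> \<kappa> u) \<le> bethe V E (\<lambda>v. \<beta> v \<curlyvee> \<kappa> v)"
    unfolding \<gamma>_def .
qed

end

section \<open>Words and balls\<close>

declare letter_val.simps [simp del]

context group
begin

lemma letter_val_closed [simp]: "fst l \<in> carrier G \<Longrightarrow> letter_val G l \<in> carrier G"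
  by (cases l) (auto simp: letter_val.simps)

lemma word_val_Nil [simp]: "word_val G [] = \<one>"
  and word_val_Cons [simp]: "word_val G (l # w) = letter_val G l \<otimes> word_val G w"
  unfolding word_val_def by auto

lemma words_over_Nil [simp]: "[] \<in> words_over S"
  and words_over_Cons [simp]: "l # w \<in> words_over S \<longleftrightarrow> fst l \<in> S \<and> w \<in> words_over S"
  and words_over_append [simp]: "u @ w \<in> words_over S \<longleftrightarrow> u \<in> words_over S \<and> w \<in> words_over S"
  unfolding words_over_def by (cases l; auto)+

lemma word_val_closed:
  "S \<subseteq> carrier G \<Longrightarrow> w \<in> words_over S \<Longrightarrow> word_val G w \<in> carrier G"
  by (induction w) auto

lemma word_val_append:
  "S \<subseteq> carrier G \<Longrightarrow> u \<in> words_over S \<Longrightarrow> w \<in> words_over S \<Longrightarrow> word_val G (u @ w) = word_val G u \<otimes> word_val G w"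
  by (induction u) (auto simp: m_assoc word_val_closed subset_iff)

lemma generate_word:
  assumes "S \<subseteq> carrier G" "g \<in> generate G S"
  obtains w where "w \<in> words_over S" "word_val G w = g"
proof -
  have "\<exists>w\<in>words_over S. word_val G w = g"
    using assms(2)
  proof induction
    case one
    show ?case by (rule bexI[of _ "[]"]) auto
  next
    case (incl h)
    then show ?case using assms(1) by (intro bexI[of _ "[(h, True)]"]) (auto simp: letter_val.simps)
  next
    case (inv h)
    then show ?case using assms(1) by (intro bexI[of _ "[(h, False)]"]) (auto simp: letter_val.simps)
  next
    case (eng h1 h2)
    then obtain w1 w2 where "w1 \<in> words_over S" "w2 \<in> words_over S" "word_val G w1 = h1" "word_val G w2 = h2"
      by blast
    then show ?case using word_val_append[OF assms(1)] by (intro bexI[of _ "w1 @ w2"]) auto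
  qed
  then show ?thesis using that by blast
qed

lemma word_ball_subset: "S \<subseteq> carrier G \<Longrightarrow> word_ball G S n \<subseteq> carrier G"
  unfolding word_ball_def using word_val_closed by auto

lemma word_ball_mono: "m \<le> n \<Longrightarrow> word_ball G S m \<subseteq> word_ball G S n"
  unfolding word_ball_def by auto

lemma one_in_word_ball: "\<one> \<in> word_ball G S n"
  unfolding word_ball_def by (rule image_eqI[of _ _ "[]"]) auto

lemma word_ball_nonempty [simp]: "word_ball G S n \<noteq> {}"
  using one_in_word_ball by auto

lemma word_ball_0 [simp]: "word_ball G S 0 = {\<one>}"
  unfolding word_ball_def by force

text \<open>The new letter is split off on the left, the side on which \<open>act\<close> composes,
  so that one round of fetching from all neighbours enlarges a ball by one.\<close>

lemma word_ball_Suc: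
  "word_ball G S (Suc n) = word_ball G S n \<union> (\<Union>l\<in>S \<times> UNIV. (\<lambda>h. letter_val G l \<otimes> h) ` word_ball G S n)"
proof (intro equalityI subsetI)
  fix g assume "g \<in> word_ball G S (Suc n)"
  then obtain w where w: "w \<in> words_over S" "length w \<le> Suc n" "g = word_val G w"
    unfolding word_ball_def by auto
  show "g \<in> word_ball G S n \<union> (\<Union>l\<in>S \<times> UNIV. (\<lambda>h. letter_val G l \<otimes> h) ` word_ball G S n)"
  proof (cases w)
    case Nil
    then show ?thesis using w one_in_word_ball by auto
  next
    case (Cons l u)
    then have "word_val G u \<in> word_ball G S n" "l \<in> S \<times> UNIV"
      using w unfolding word_ball_def by (auto simp: mem_Times_iff)
    then show ?thesis using w Cons by auto
  qed
next
  fix g assume "g \<in> word_ball G S n \<union> (\<Union>l\<in>S \<times> UNIV. (\<lambda>h. letter_val G l \<otimes> h) ` word_ball G S n)"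
  then consider "g \<in> word_ball G S n"
    | l u where "l \<in> S \<times> UNIV" "u \<in> words_over S" "length u \<le> n" "g = letter_val G l \<otimes> word_val G u"
    unfolding word_ball_def by auto
  then show "g \<in> word_ball G S (Suc n)"
  proof cases
    case 1
    then show ?thesis using word_ball_mono[of n "Suc n" S] by auto
  next
    case 2
    then show ?thesis unfolding word_ball_def by (intro image_eqI[of _ _ "l # u"]) auto
  qed
qed

lemma finite_word_ball: "finite S \<Longrightarrow> finite (word_ball G S n)"
  by (induction n) (auto simp: word_ball_Suc)

lemma word_ball_mult:
  assumes "S \<subseteq> carrier G" "g \<in> word_ball G S m" "h \<in> word_ball G S n"
  shows "g \<otimes> h \<in> word_ball G S (m + n)"
proof -
  obtain u w where "u \<in> words_over S" "length u \<le> m" "g = word_val G u"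
    "w \<in> words_over S" "length w \<le> n" "h = word_val G w"
    using assms unfolding word_ball_def by auto
  then show ?thesis
    unfolding word_ball_def using word_val_append[OF assms(1)] by (intro image_eqI[of _ _ "u @ w"]) auto
qed

lemma finite_subset_word_ball:
  assumes "S \<subseteq> carrier G" "generate G S = carrier G" "finite F" "F \<subseteq> carrier G"
  obtains n where "F \<subseteq> word_ball G S n"
proof -
  have "\<exists>n. g \<in> word_ball G S n" if g: "g \<in> F" for g
  proof -
    obtain w where "w \<in> words_over S" "word_val G w = g"
      using generate_word[OF assms(1), of g] assms(2,4) g by blast
    then show ?thesis unfolding word_ball_def by auto
  qed
  then obtain N where N: "\<And>g. g \<in> F \<Longrightarrow> g \<in> word_ball G S (N g)"
    by metis
  have "F \<subseteq> word_ball G S (Max (insert 0 (N ` F)))"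
  proof
    fix g assume g: "g \<in> F"
    then have "N g \<le> Max (insert 0 (N ` F))" using assms(3) by auto
    then show "g \<in> word_ball G S (Max (insert 0 (N ` F)))"
      using N[OF g] word_ball_mono by blast
  qed
  then show ?thesis using that by blast
qed

end

section \<open>Expansion over permutation graphs\<close>

text \<open>The \<open>\<pi> s\<close> will be bijections of the whole type, so
  \<open>inv_into UNIV\<close> is their true inverse and inverse letters move backwards.\<close>

definition letter_move :: "('g \<Rightarrow> 'v \<Rightarrow> 'v) \<Rightarrow> 'g \<times> bool \<Rightarrow> 'v \<Rightarrow> 'v" where
  "letter_move \<pi> l = (if snd l then \<pi> (fst l) else inv_into UNIV (\<pi> (fst l)))"

text \<open>The covering of the rose given by the permutations: every vertex has one outgoing and,
  by bijectivity, one incoming edge for each label.\<close>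

definition perm_graph :: "'v set \<Rightarrow> 'g set \<Rightarrow> ('g \<Rightarrow> 'v \<Rightarrow> 'v) \<Rightarrow> ('v \<times> 'g \<times> 'v) multiset" where
  "perm_graph V S \<pi> = mset_set ((\<lambda>(v, s). (v, s, \<pi> s v)) ` (V \<times> S))"

lemma letter_move_closed:
  "(\<And>s. s \<in> S \<Longrightarrow> \<pi> s permutes V) \<Longrightarrow> fst l \<in> S \<Longrightarrow> v \<in> V \<Longrightarrow> letter_move \<pi> l v \<in> V"
  unfolding letter_move_def by (auto simp: permutes_in_image permutes_inv)

context entropy_action
begin

lemma Jn_insert:
  assumes "finite X" "X \<noteq> {}" "X \<subseteq> C" "x \<in> C"
  shows "Jn (insert x X) = Jn X \<curlyvee> x"
proof (rule le_antisym)
  have JX: "Jn X \<in> C" "Jn (insert x X) \<in> C" using assms by (auto intro!: Jn_closed)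
  show "Jn (insert x X) \<preceq> Jn X \<curlyvee> x"
  proof (rule Jn_least)
    fix y assume "y \<in> insert x X"
    then consider "y = x" | "y \<in> X" by blast
    then show "y \<preceq> Jn X \<curlyvee> x"
      using assms JX by cases (auto intro: join_ub2 le_join1 Jn_upper)
  qed (use assms JX in auto)
  show "Jn X \<curlyvee> x \<preceq> Jn (insert x X)"
    using assms JX by (intro join_least Jn_least Jn_upper) auto
qed

text \<open>The Bethe functional of the rose; \<open>F_eq\<close> brings it to the usual
  expression.\<close>

definition F :: "'g set \<Rightarrow> 'a \<Rightarrow> real" where
  "F S a = H a - (\<Sum>s\<in>S. I a (act s a))"

lemma graph_perm_graph:
  "finite V \<Longrightarrow> finite S \<Longrightarrow> S \<subseteq> carrier G \<Longrightarrow> (\<And>s. s \<in> S \<Longrightarrow> \<pi> s permutes V) \<Longrightarrow> graph V (perm_graph V S \<pi>)"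
  unfolding graph_def perm_graph_def by (auto simp: permutes_in_image)

text \<open>Each vertex has exactly one outgoing edge for every element of \<open>S\<close> and so
  contributes a full copy of \<open>F S a\<close>. A partial injection in place of a permutation
  would lose terms here.\<close>

lemma bethe_perm_graph_const:
  assumes "finite V" "finite S"
  shows "bethe V (perm_graph V S \<pi>) (\<lambda>_. a) = real (card V) * F S a"
proof -
  have "inj_on (\<lambda>(v, s). (v, s, \<pi> s v)) (V \<times> S)" by (auto simp: inj_on_def)
  then have "(\<Sum>(v, g, w)\<in>#perm_graph V S \<pi>. I a (act g a)) = (\<Sum>(v, s)\<in>V \<times> S. I a (act s a))"
    unfolding perm_graph_def sum_unfold_sum_mset[symmetric]
    by (subst sum.reindex) (auto intro!: sum.cong)
  also have "\<dots> = real (card V) * (\<Sum>s\<in>S. I a (act s a))"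
    by (subst sum.cartesian_product[symmetric]) simp
  finally show ?thesis
    unfolding bethe_def F_def by (simp add: algebra_simps)
qed

lemma perm_graph_letter:
  assumes "finite V" "finite S" "S \<subseteq> carrier G" "\<And>s. s \<in> S \<Longrightarrow> \<pi> s permutes V" "fst l \<in> S" "v \<in> V"
  shows "(v, letter_val G l, letter_move \<pi> l v) \<in># perm_graph V S \<pi> \<or>
         (letter_move \<pi> l v, inv (letter_val G l), v) \<in># perm_graph V S \<pi>"
proof -
  obtain s b where l: "l = (s, b)" by force
  have s: "s \<in> S" "s \<in> carrier G" "\<pi> s permutes V" using assms l by auto
  have fin: "finite ((\<lambda>(v, s). (v, s, \<pi> s v)) ` (V \<times> S))" using assms by auto
  show ?thesis
  proof (cases b)
    case True
    then show ?thesis using l s assms fin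
      by (auto simp: letter_move_def perm_graph_def letter_val.simps)
  next
    case False
    have "inv\<^bsub>G\<^esub> (letter_val G l) = s" using False l s by (simp add: letter_val.simps)
    moreover have "letter_move \<pi> l v \<in> V" using assms letter_move_closed by metis
    moreover have "\<pi> s (letter_move \<pi> l v) = v"
      using False l s by (simp add: letter_move_def permutes_inverses)
    ultimately have "(letter_move \<pi> l v, inv\<^bsub>G\<^esub> (letter_val G l), v) \<in> (\<lambda>(v, s). (v, s, \<pi> s v)) ` (V \<times> S)"
      using s by (intro image_eqI[of _ _ "(letter_move \<pi> l v, s)"]) auto
    then show ?thesis using fin by (simp add: perm_graph_def)
  qed
qed

text \<open>All letters fetch from the old family \<open>\<beta>\<close> at once, which keeps the
  result an explicit join.\<close>

definition expand :: "'g set \<Rightarrow> ('g \<Rightarrow> 'v \<Rightarrow> 'v) \<Rightarrow> ('v \<Rightarrow> 'a) \<Rightarrow> 'v \<Rightarrow> 'a" where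
  "expand S \<pi> \<beta> v = Jn (insert (\<beta> v) ((\<lambda>l. act (letter_val G l) (\<beta> (letter_move \<pi> l v))) ` (S \<times> UNIV)))"

context
  fixes V :: "'v set" and S and \<pi>
  assumes V: "finite V" and S: "finite S" "S \<subseteq> carrier G" and \<pi>: "\<And>s. s \<in> S \<Longrightarrow> \<pi> s permutes V"
begin

lemma expand_family:
  assumes "\<And>v. v \<in> V \<Longrightarrow> \<beta> v \<in> C" "v \<in> V"
  shows "finite (insert (\<beta> v) ((\<lambda>l. act (letter_val G l) (\<beta> (letter_move \<pi> l v))) ` (S \<times> UNIV)))"
    and "insert (\<beta> v) ((\<lambda>l. act (letter_val G l) (\<beta> (letter_move \<pi> l v))) ` (S \<times> UNIV)) \<subseteq> C"
  using assms S letter_move_closed[of S \<pi> V, OF \<pi>] by (auto intro!: act_closed letter_val_closed)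

lemma expand_closed: "(\<And>v. v \<in> V \<Longrightarrow> \<beta> v \<in> C) \<Longrightarrow> v \<in> V \<Longrightarrow> expand S \<pi> \<beta> v \<in> C"
  unfolding expand_def using expand_family[of \<beta> v] by (intro Jn_closed) auto

lemma le_expand: "(\<And>v. v \<in> V \<Longrightarrow> \<beta> v \<in> C) \<Longrightarrow> v \<in> V \<Longrightarrow> \<beta> v \<preceq> expand S \<pi> \<beta> v"
  unfolding expand_def using expand_family[of \<beta> v] by (intro Jn_upper) auto

lemma act_le_expand:
  "(\<And>v. v \<in> V \<Longrightarrow> \<beta> v \<in> C) \<Longrightarrow> v \<in> V \<Longrightarrow> fst l \<in> S \<Longrightarrow>
    act (letter_val G l) (\<beta> (letter_move \<pi> l v)) \<preceq> expand S \<pi> \<beta> v"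
  unfolding expand_def using expand_family[of \<beta> v]
  by (intro Jn_upper) (auto simp: mem_Times_iff intro!: imageI)

lemma expand_least:
  assumes "\<And>v. v \<in> V \<Longrightarrow> \<beta> v \<in> C" "v \<in> V" "c \<in> C" "\<beta> v \<preceq> c"
    and "\<And>l. fst l \<in> S \<Longrightarrow> act (letter_val G l) (\<beta> (letter_move \<pi> l v)) \<preceq> c"
  shows "expand S \<pi> \<beta> v \<preceq> c"
  unfolding expand_def using expand_family[of \<beta> v] assms
  by (intro Jn_least) (auto)

text \<open>The fetches are made one pair \<open>(v, l)\<close> at a time. Each uses the original
  \<open>\<beta>\<close> at the neighbour, which stays below the current partition there, so the
  order is immaterial and the outcome is the simultaneous update.\<close>

lemma expands_expand:
  assumes \<beta>: "\<And>v. v \<in> V \<Longrightarrow> \<beta> v \<in> C"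
  shows "expands V (perm_graph V S \<pi>) \<beta> (expand S \<pi> \<beta>)"
proof -
  let ?a = "\<lambda>v l. act (letter_val G l) (\<beta> (letter_move \<pi> l v))"
  \<comment> \<open>The family after the fetches listed in \<open>U\<close>.\<close>
  define \<gamma> where "\<gamma> = (\<lambda>U v. Jn (insert (\<beta> v) (?a v ` {l. (v, l) \<in> U})))"
  have fin: "finite {l. (v, l) \<in> U}" if "finite U" for U :: "('v \<times> 'g \<times> bool) set" and v
    using finite_imageI[OF that, of snd] by (rule rev_finite_subset) force
  have a: "?a v l \<in> C" if "v \<in> V" "fst l \<in> S" for v l
    using that expand_family(2)[of \<beta> v, OF \<beta>] by (auto simp: mem_Times_iff)
  have "expands V (perm_graph V S \<pi>) \<beta> (\<gamma> U)" if "U \<subseteq> V \<times> (S \<times> UNIV)" for U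
  proof -
    have "finite U" using that V S by (auto intro: finite_subset)
    then show ?thesis using that
    proof (induction U rule: finite_induct)
      case empty
      have "bethe V (perm_graph V S \<pi>) (\<lambda>v. \<gamma> {} v \<curlyvee> \<kappa> v) = bethe V (perm_graph V S \<pi>) (\<lambda>v. \<beta> v \<curlyvee> \<kappa> v)" for \<kappa>
      proof (rule bethe_cong[OF graph_perm_graph[OF V S \<pi>]])
        fix v assume "v \<in> V"
        then have "\<gamma> {} v = \<beta> v" unfolding \<gamma>_def
          using \<beta> by (intro le_antisym Jn_least Jn_upper) (auto intro: le_refl)
        then show "\<gamma> {} v \<curlyvee> \<kappa> v = \<beta> v \<curlyvee> \<kappa> v" by simp
      qed
      then show ?case unfolding expands_def by simp
    next
      case (insert e U)
      obtain v l where e: "e = (v, l)" by (rule prod.exhaust)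
      have vl: "v \<in> V" "fst l \<in> S" using insert e by auto
      have C: "?a u m \<in> C" if "(u, m) \<in> U" for u m using that insert a by auto
      have \<gamma>C: "\<gamma> U u \<in> C" if "u \<in> V" for u
        unfolding \<gamma>_def using that \<beta> C fin[OF \<open>finite U\<close>] by (intro Jn_closed) auto
      have "expands V (perm_graph V S \<pi>) (\<gamma> U) ((\<gamma> U)(v := \<gamma> U v \<curlyvee> ?a v l))"
      proof (rule expands_split[OF graph_perm_graph[OF V S \<pi>]])
        show "letter_move \<pi> l v \<in> V" using letter_move_closed[of S \<pi> V, OF \<pi>] vl by auto
        then show "\<beta> (letter_move \<pi> l v) \<preceq> \<gamma> U (letter_move \<pi> l v)" "\<beta> (letter_move \<pi> l v) \<in> C"
          unfolding \<gamma>_def using \<beta> C fin[OF \<open>finite U\<close>] by (auto intro!: Jn_upper)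
        show "letter_val G l \<in> carrier G" using vl S by (auto)
        show "(v, letter_val G l, letter_move \<pi> l v) \<in># perm_graph V S \<pi> \<or>
           (letter_move \<pi> l v, inv (letter_val G l), v) \<in># perm_graph V S \<pi>"
          using V S \<pi> vl by (intro perm_graph_letter) auto
      qed (use vl \<gamma>C in auto)
      moreover have "(\<gamma> U)(v := \<gamma> U v \<curlyvee> ?a v l) = \<gamma> (insert e U)"
      proof
        fix u
        show "((\<gamma> U)(v := \<gamma> U v \<curlyvee> ?a v l)) u = \<gamma> (insert e U) u"
        proof (cases "u = v")
          case True
          have "{m. (v, m) \<in> insert e U} = insert l {m. (v, m) \<in> U}" using e by auto
          then have "\<gamma> (insert e U) v = Jn (insert (?a v l) (insert (\<beta> v) (?a v ` {m. (v, m) \<in> U})))"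
            unfolding \<gamma>_def by (simp add: insert_commute)
          also have "\<dots> = \<gamma> U v \<curlyvee> ?a v l"
            unfolding \<gamma>_def using fin[OF \<open>finite U\<close>] \<beta> C a vl by (intro Jn_insert) auto
          finally show ?thesis using True by simp
        next
          case False
          then show ?thesis unfolding \<gamma>_def e by simp
        qed
      qed
      ultimately show ?case using insert by (auto intro: expands_trans)
    qed
  qed
  from this[of "V \<times> (S \<times> UNIV)"] have "expands V (perm_graph V S \<pi>) \<beta> (\<gamma> (V \<times> (S \<times> UNIV)))"
    by simp
  moreover have "\<gamma> (V \<times> (S \<times> UNIV)) v = expand S \<pi> \<beta> v" if "v \<in> V" for v
  proof -
    have "{l. (v, l) \<in> V \<times> (S \<times> (UNIV :: bool set))} = S \<times> UNIV" using that by auto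
    then show ?thesis unfolding \<gamma>_def expand_def by simp
  qed
  then have "bethe V (perm_graph V S \<pi>) (\<lambda>v. \<gamma> (V \<times> (S \<times> UNIV)) v \<curlyvee> \<kappa> v) =
      bethe V (perm_graph V S \<pi>) (\<lambda>v. expand S \<pi> \<beta> v \<curlyvee> \<kappa> v)" for \<kappa>
    by (intro bethe_cong[OF graph_perm_graph[OF V S \<pi>]]) auto
  ultimately show ?thesis unfolding expands_def by simp
qed

text \<open>On a constant family all neighbours look alike, so the permutations drop out and the
  recursion \<open>word_ball_Suc\<close> remains.\<close>

lemma expand_orbit_join:
  assumes a: "a \<in> C" and v: "v \<in> V"
  shows "expand S \<pi> (\<lambda>_. orbit_join (word_ball G S n) a) v = orbit_join (word_ball G S (Suc n)) a"
proof -
  let ?B = "\<lambda>n. orbit_join (word_ball G S n) a"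
  have B: "?B m \<in> C" for m
    using S a by (intro orbit_join_closed finite_word_ball word_ball_subset) auto
  show ?thesis
  proof (rule le_antisym)
    show "expand S \<pi> (\<lambda>_. ?B n) v \<preceq> ?B (Suc n)"
    proof (rule expand_least)
      show "?B n \<preceq> ?B (Suc n)"
        using S a by (intro orbit_join_subset finite_word_ball word_ball_mono word_ball_subset) auto
      fix l :: "'g \<times> bool" assume l: "fst l \<in> S"
      have "act (letter_val G l) (?B n) = orbit_join ((\<lambda>h. letter_val G l \<otimes> h) ` word_ball G S n) a"
        using S a l by (intro act_orbit_join finite_word_ball word_ball_subset letter_val_closed) auto
      also have "\<dots> \<preceq> ?B (Suc n)"
        using S a l by (intro orbit_join_subset finite_word_ball word_ball_subset)
          (auto simp: word_ball_Suc mem_Times_iff intro: bexI[of _ l])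
      finally show "act (letter_val G l) (?B n) \<preceq> ?B (Suc n)" .
    qed (use B v in auto)
    show "?B (Suc n) \<preceq> expand S \<pi> (\<lambda>_. ?B n) v"
    proof (rule orbit_join_least)
      show EC: "expand S \<pi> (\<lambda>_. ?B n) v \<in> C" using B v by (intro expand_closed) auto
      fix g assume "g \<in> word_ball G S (Suc n)"
      then consider "g \<in> word_ball G S n"
        | l h where "fst l \<in> S" "h \<in> word_ball G S n" "g = letter_val G l \<otimes> h"
        unfolding word_ball_Suc by auto
      then show "act g a \<preceq> expand S \<pi> (\<lambda>_. ?B n) v"
      proof cases
        case 1
        then have "act g a \<preceq> ?B n"
          using S a by (intro orbit_join_upper finite_word_ball word_ball_subset) auto
        moreover have "?B n \<preceq> expand S \<pi> (\<lambda>_. ?B n) v"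
          using le_expand[of "\<lambda>_. ?B n" v] B v by simp
        ultimately show ?thesis by (rule le_trans)
      next
        case 2
        have h: "h \<in> carrier G" using 2 S word_ball_subset by blast
        have l: "letter_val G l \<in> carrier G" using 2 S by (auto)
        have "act h a \<preceq> ?B n"
          using 2 S a by (intro orbit_join_upper finite_word_ball word_ball_subset) auto
        then have "act (letter_val G l) (act h a) \<preceq> act (letter_val G l) (?B n)"
          using l h a B by (intro act_mono) auto
        moreover have "act (letter_val G l) (?B n) \<preceq> expand S \<pi> (\<lambda>_. ?B n) v"
          using act_le_expand[of "\<lambda>_. ?B n" v l] B v 2 by simp
        ultimately have "act (letter_val G l) (act h a) \<preceq> expand S \<pi> (\<lambda>_. ?B n) v"
          by (rule le_trans)
        then show ?thesis
          using l h a 2 by (simp add: act_act)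
      qed
    qed (use S a finite_word_ball word_ball_subset in auto)
  qed
qed

lemma expands_orbit_join:
  assumes a: "a \<in> C"
  shows "expands V (perm_graph V S \<pi>) (\<lambda>_. a) (\<lambda>_. orbit_join (word_ball G S n) a)"
proof (induction n)
  case 0
  have "orbit_join {\<one>} a = a"
    using a unfolding orbit_join_def by (intro le_antisym Jn_least Jn_upper) (auto intro: le_refl)
  then show ?case by (simp add: expands_refl)
next
  case (Suc n)
  let ?B = "\<lambda>n. orbit_join (word_ball G S n) a"
  have B: "?B m \<in> C" for m
    using S a by (intro orbit_join_closed finite_word_ball word_ball_subset) auto
  have "bethe V (perm_graph V S \<pi>) (\<lambda>v. expand S \<pi> (\<lambda>_. ?B n) v \<curlyvee> \<kappa> v) =
      bethe V (perm_graph V S \<pi>) (\<lambda>v. ?B (Suc n) \<curlyvee> \<kappa> v)" for \<kappa>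
    using expand_orbit_join[OF a] by (intro bethe_cong[OF graph_perm_graph[OF V S \<pi>]]) auto
  then have "expands V (perm_graph V S \<pi>) (\<lambda>_. ?B n) (\<lambda>_. ?B (Suc n))"
    using expands_expand[of "\<lambda>_. ?B n"] B unfolding expands_def by simp
  with Suc show ?case by (rule expands_trans)
qed

end

end

section \<open>Dependence on the partition\<close>

context entropy_action
begin

text \<open>Invariance turns \<open>I a (act s a)\<close> into
  \<open>2 * H a - H (a \<curlyvee> act s a)\<close>; this is the origin of the coefficient
  \<open>1 - 2 * real (card S)\<close>.\<close>

lemma F_eq: "F S a = (1 - 2 * real (card S)) * H a + (\<Sum>s\<in>S. H (a \<curlyvee> act s a))"
  if "S \<subseteq> carrier G" "a \<in> C"
proof -
  have "(\<Sum>s\<in>S. I a (act s a)) = (\<Sum>s\<in>S. 2 * H a - H (a \<curlyvee> act s a))"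
    using that by (intro sum.cong) (auto simp: I_def)
  then show ?thesis unfolding F_def by (simp add: sum_subtractf algebra_simps)
qed

text \<open>A single vertex on which all permutations are trivial; \<open>c\<close> is the bystander
  and is not enlarged.\<close>

lemma F_orbit_join_le:
  assumes "finite S" "S \<subseteq> carrier G" "a \<in> C" "c \<in> C"
  shows "F S (orbit_join (word_ball G S n) a \<curlyvee> c) \<le> F S (a \<curlyvee> c)"
proof -
  have "expands {()} (perm_graph {()} S (\<lambda>_ x. x)) (\<lambda>_. a) (\<lambda>_. orbit_join (word_ball G S n) a)"
    using assms by (intro expands_orbit_join) (auto simp: permutes_def)
  then have "bethe {()} (perm_graph {()} S (\<lambda>_ x. x)) (\<lambda>_. orbit_join (word_ball G S n) a \<curlyvee> c)
      \<le> bethe {()} (perm_graph {()} S (\<lambda>_ x. x)) (\<lambda>_. a \<curlyvee> c)"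
    using assms by (intro expandsD) auto
  then show ?thesis using assms by (simp add: bethe_perm_graph_const)
qed

lemma F_orbit_join_le_plain:
  assumes "finite S" "S \<subseteq> carrier G" "a \<in> C"
  shows "F S (orbit_join (word_ball G S n) a) \<le> F S a"
proof -
  have "orbit_join (word_ball G S n) a \<in> C"
    using assms by (intro orbit_join_closed finite_word_ball word_ball_subset) auto
  with F_orbit_join_le[OF assms bt_closed, of n] assms show ?thesis
    by (simp add: join_absorb2 bt_closed bt_le)
qed

text \<open>Let \<open>x\<close> be the entropy of \<open>a\<close> given \<open>c\<close>. Each
  edge term gains at most \<open>2 * x\<close>, once for \<open>a\<close> and once for its
  translate; the coefficient \<open>1 - 2 * real (card S)\<close> of the vertex term absorbs all of
  this but a single \<open>x\<close>.\<close>

lemma F_join_le: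
  assumes S: "S \<subseteq> carrier G" and ac: "a \<in> C" "c \<in> C"
  shows "F S (c \<curlyvee> a) \<le> F S c + (H (a \<curlyvee> c) - H c)"
proof -
  let ?x = "H (a \<curlyvee> c) - H c"
  have "H ((c \<curlyvee> a) \<curlyvee> act s (c \<curlyvee> a)) \<le> H (c \<curlyvee> act s c) + 2 * ?x" if s: "s \<in> S" for s
  proof -
    have sG: "s \<in> carrier G" using s S by auto
    let ?d = "c \<curlyvee> act s c"
    have "(c \<curlyvee> a) \<curlyvee> act s (c \<curlyvee> a) = a \<curlyvee> act s a \<curlyvee> ?d"
      using ac sG by (simp add: act_join join_assoc join_left_commute join_commute)
    then have "H ((c \<curlyvee> a) \<curlyvee> act s (c \<curlyvee> a)) = H (a \<curlyvee> act s a \<curlyvee> ?d)"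
      by simp
    also have "\<dots> \<le> H ?d + (H (a \<curlyvee> ?d) - H ?d) + (H (act s a \<curlyvee> ?d) - H ?d)"
      using cond_entropy_subadditive[of a "act s a" ?d] ac sG by simp
    also have "H (a \<curlyvee> ?d) - H ?d \<le> ?x"
      using ac sG by (intro cond_entropy_antimono) (auto intro: join_ub1)
    also have "H (act s a \<curlyvee> ?d) - H ?d \<le> H (act s a \<curlyvee> act s c) - H (act s c)"
      using ac sG by (intro cond_entropy_antimono) (auto intro: join_ub2)
    also have "\<dots> = ?x"
      using ac sG by (simp flip: act_join)
    finally show ?thesis by simp
  qed
  then have "(\<Sum>s\<in>S. H ((c \<curlyvee> a) \<curlyvee> act s (c \<curlyvee> a))) \<le> (\<Sum>s\<in>S. H (c \<curlyvee> act s c) + 2 * ?x)"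
    by (rule sum_mono)
  also have "\<dots> = (\<Sum>s\<in>S. H (c \<curlyvee> act s c)) + 2 * real (card S) * ?x"
    by (simp add: sum.distrib)
  finally show ?thesis
    using S ac by (simp add: F_eq join_commute[of c a] algebra_simps)
qed

text \<open>The edge terms can only grow, so any loss comes from the vertex term with its
  coefficient \<open>1 - 2 * real (card S)\<close>.\<close>

lemma F_join_ge:
  assumes S: "S \<subseteq> carrier G" and ac: "a \<in> C" "c \<in> C"
  shows "F S c - 2 * real (card S) * (H (a \<curlyvee> c) - H c) \<le> F S (c \<curlyvee> a)"
proof -
  have "H (c \<curlyvee> act s c) \<le> H ((c \<curlyvee> a) \<curlyvee> act s (c \<curlyvee> a))" if s: "s \<in> S" for s
  proof -
    have "s \<in> carrier G" using s S by auto
    then show ?thesis using ac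
      by (intro H_mono join_mono act_mono) (auto intro: join_ub1)
  qed
  then have "(\<Sum>s\<in>S. H (c \<curlyvee> act s c)) \<le> (\<Sum>s\<in>S. H ((c \<curlyvee> a) \<curlyvee> act s (c \<curlyvee> a)))"
    by (rule sum_mono)
  moreover have "0 \<le> H (a \<curlyvee> c) - H c"
    using ac by (rule cond_entropy_nonneg)
  ultimately show ?thesis
    using S ac by (simp add: F_eq join_commute[of c a] algebra_simps)
qed

text \<open>The entropic form of being generating. One radius for each \<open>\<epsilon>\<close> is
  enough because the conditional entropy decreases as the ball grows.\<close>

definition asymptotically_fine :: "'g set \<Rightarrow> 'a \<Rightarrow> bool" where
  "asymptotically_fine S a \<longleftrightarrow> (\<forall>c\<in>C. \<forall>\<epsilon>>0. \<exists>n.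
      H (c \<curlyvee> orbit_join (word_ball G S n) a) - H (orbit_join (word_ball G S n) a) < \<epsilon>)"

text \<open>
  Between the balls over \<open>a\<close> and the partition \<open>b\<close> stand the joins of a large ball over \<open>a\<close>
  and a large ball over \<open>b\<close>: \<open>F\<close> decreases when either radius grows.
\<close>
lemma F_ball_le_F:
  assumes S: "finite S" "S \<subseteq> carrier G" and C: "a \<in> C" "b \<in> C" "b' \<in> C"
    and a: "asymptotically_fine S a" and b: "asymptotically_fine S b'" "b' \<preceq> b" and \<epsilon>: "\<epsilon> > 0"
  shows "\<exists>n. F S (orbit_join (word_ball G S n) a) \<le> F S b + \<epsilon>"
proof -
  let ?B = "\<lambda>n x. orbit_join (word_ball G S n) x"
  have B: "?B n x \<in> C" if "x \<in> C" for n x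
    using S that by (intro orbit_join_closed finite_word_ball word_ball_subset) auto
  obtain k where k: "H (a \<curlyvee> ?B k b') - H (?B k b') < \<epsilon> / 2"
    using b(1) C \<epsilon> unfolding asymptotically_fine_def by (meson half_gt_zero)
  \<comment> \<open>\<open>F_join_ge\<close> costs a factor \<open>2 * real (card S)\<close>; the
    additional \<open>1\<close> keeps the denominator positive when \<open>S\<close> is
    empty.\<close>
  define \<delta> where "\<delta> = \<epsilon> / (2 * (2 * real (card S) + 1))"
  have \<delta>: "\<delta> > 0" "2 * real (card S) * \<delta> \<le> \<epsilon> / 2"
    using \<epsilon> unfolding \<delta>_def by (auto simp: field_simps)
  obtain n where n: "H (?B k b \<curlyvee> ?B n a) - H (?B n a) < \<delta>"
    using a B[OF C(2), of k] \<delta> unfolding asymptotically_fine_def by blast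
  have le: "?B k b' \<preceq> ?B k b"
    using S C b by (intro orbit_join_mono finite_word_ball word_ball_subset) auto
  have "F S (?B n a) \<le> F S (?B n a \<curlyvee> ?B k b) + 2 * real (card S) * (H (?B k b \<curlyvee> ?B n a) - H (?B n a))"
    using F_join_ge[OF S(2) B[OF C(2)] B[OF C(1)], of n k] by simp
  also have "2 * real (card S) * (H (?B k b \<curlyvee> ?B n a) - H (?B n a)) \<le> 2 * real (card S) * \<delta>"
    using n by (intro mult_left_mono) auto
  also have "F S (?B n a \<curlyvee> ?B k b) \<le> F S (a \<curlyvee> ?B k b)"
    using S C B by (intro F_orbit_join_le) auto
  also have "F S (a \<curlyvee> ?B k b) \<le> F S (?B k b) + (H (a \<curlyvee> ?B k b) - H (?B k b))"
    using F_join_le[OF S(2) C(1) B[OF C(2)], of k] by (simp add: join_commute)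
  \<comment> \<open>Balls over \<open>b\<close> refine balls over \<open>b'\<close>, so the radius
    chosen for \<open>b'\<close> serves \<open>b\<close>.\<close>
  also have "H (a \<curlyvee> ?B k b) - H (?B k b) \<le> H (a \<curlyvee> ?B k b') - H (?B k b')"
    using C B le by (intro cond_entropy_antimono) auto
  also have "F S (?B k b) \<le> F S b"
    using S C by (intro F_orbit_join_le_plain)
  finally show ?thesis using k \<delta> by (intro exI[of _ n]) auto
qed

end

section \<open>Connected sets\<close>

text \<open>In the finite set \<open>V\<close> the complements of \<open>D\<close> and of its image
  have the same size, so any bijection between them completes \<open>f\<close>.\<close>

lemma permutes_extension:
  assumes "finite V" "D \<subseteq> V" "inj_on f D" "f ` D \<subseteq> V"
  obtains p where "p permutes V" "\<And>x. x \<in> D \<Longrightarrow> p x = f x"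
proof -
  have fin: "finite (V - D)" "finite (V - f ` D)" using assms by auto
  have "card (V - D) = card (V - f ` D)"
    using assms by (simp add: card_Diff_subset finite_subset card_image)
  then obtain h where h: "bij_betw h (V - D) (V - f ` D)"
    using finite_same_card_bij[OF fin] by blast
  define p where "p = (\<lambda>x. if x \<in> D then f x else if x \<in> V then h x else x)"
  have "bij_betw p D (f ` D)"
    using assms(3) by (subst bij_betw_cong[of _ _ f]) (auto simp: p_def bij_betw_def)
  moreover have "bij_betw p (V - D) (V - f ` D)"
    using h by (subst bij_betw_cong[of _ _ h]) (auto simp: p_def)
  ultimately have "bij_betw p (D \<union> (V - D)) (f ` D \<union> (V - f ` D))"
    by (rule bij_betw_combine) auto
  moreover have "D \<union> (V - D) = V" "f ` D \<union> (V - f ` D) = V"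
    using assms by auto
  ultimately have "bij_betw p V V" by simp
  then have "p permutes V"
    by (rule bij_imp_permutes) (use assms in \<open>auto simp: p_def\<close>)
  then show ?thesis using that by (auto simp: p_def)
qed

context group
begin

text \<open>A word for \<open>inv x \<otimes> y\<close> traces a walk from \<open>x\<close> to
  \<open>y\<close>, as its letters are appended on the right; removing the cycles makes the walk
  simple.\<close>

lemma cayley_path:
  assumes S: "S \<subseteq> carrier G" "generate G S = carrier G" and xy: "x \<in> carrier G" "y \<in> carrier G"
  obtains p where "cayley_simple_path G S x p y"
proof -
  obtain w where w: "w \<in> words_over S" "word_val G w = inv x \<otimes> y"
    using generate_word[OF S(1), of "inv x \<otimes> y"] S(2) xy by auto
  have "\<And>z. z \<in> carrier G \<Longrightarrow> (cayley_adj G S)\<^sup>*\<^sup>* z (z \<otimes> word_val G w)"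
    using w(1)
  proof (induction w)
    case Nil
    then show ?case by simp
  next
    case (Cons l w)
    obtain s b where l: "l = (s, b)" by force
    have lS: "s \<in> carrier G" "letter_val G l \<in> carrier G" "s \<in> S" using Cons l S by auto
    have "cayley_adj G S z (z \<otimes> letter_val G l)"
      unfolding cayley_adj_def using Cons lS l
      by (cases b) (auto simp: letter_val.simps)
    moreover have "(cayley_adj G S)\<^sup>*\<^sup>* (z \<otimes> letter_val G l) (z \<otimes> letter_val G l \<otimes> word_val G w)"
      using Cons lS by auto
    ultimately show ?case
      using Cons lS S by (simp add: m_assoc word_val_closed converse_rtranclp_into_rtranclp)
  qed
  from this[OF xy(1)] have "(cayley_adj G S)\<^sup>*\<^sup>* x y"
    using w xy by (simp add: inv_solve_left' m_assoc[symmetric])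
  then obtain xs where "rtrancl_path (cayley_adj G S) x xs y"
    by (auto simp: rtranclp_eq_rtrancl_path)
  then obtain xs where xs: "rtrancl_path (cayley_adj G S) x xs y" "distinct (x # xs)"
    by (rule rtrancl_path_distinct)
  have "last (x # xs) = y \<and> set (x # xs) \<subseteq> carrier G \<and> successively (cayley_adj G S) (x # xs)"
    using xs(1) xy(1)
  proof (induction rule: rtrancl_path.induct)
    case (base x)
    then show ?case by simp
  next
    case (step x x' ys z)
    then have "x' \<in> carrier G"
      using S unfolding cayley_adj_def by auto
    with step show ?case by auto
  qed
  with xs that[of "x # xs"] show ?thesis
    unfolding cayley_simple_path_def by auto
qed

end

context entropy_action
begin

text \<open>A ball appears instead of \<open>a\<close> because the partitions reached from
  \<open>\<Delta>\<close> differ from vertex to vertex; they can be replaced by a constant family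
  once a ball swallows them all.\<close>

theorem F_ball_le_connected:
  assumes S: "finite S" "S \<subseteq> carrier G" "generate G S = carrier G"
    and \<Delta>: "finite \<Delta>" "\<Delta> \<noteq> {}" "right_connected G S \<Delta>" and a: "a \<in> C"
  shows "\<exists>n. real (card \<Delta>) * F S (orbit_join (word_ball G S n) a) \<le> H (orbit_join \<Delta> a)"
proof -
  have \<Delta>G: "\<Delta> \<subseteq> carrier G" using \<Delta> unfolding right_connected_def by auto
  obtain x0 where x0: "x0 \<in> \<Delta>" using \<Delta> by auto
  have x0G: "x0 \<in> carrier G" using x0 \<Delta>G by auto
  have "\<exists>p. p permutes \<Delta> \<and> (\<forall>x\<in>\<Delta>. x \<otimes> s \<in> \<Delta> \<longrightarrow> p x = x \<otimes> s)" if "s \<in> S" for s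
  proof -
    have "inj_on (\<lambda>x. x \<otimes> s) {x \<in> \<Delta>. x \<otimes> s \<in> \<Delta>}"
      using that S \<Delta>G by (auto simp: inj_on_def subset_iff)
    then obtain p where "p permutes \<Delta>" "\<And>x. x \<in> {x \<in> \<Delta>. x \<otimes> s \<in> \<Delta>} \<Longrightarrow> p x = x \<otimes> s"
      using permutes_extension[OF \<Delta>(1), of "{x \<in> \<Delta>. x \<otimes> s \<in> \<Delta>}" "\<lambda>x. x \<otimes> s"] by blast
    then show ?thesis by auto
  qed
  then obtain \<pi> where \<pi>: "\<And>s. s \<in> S \<Longrightarrow> \<pi> s permutes \<Delta>"
      "\<And>s x. s \<in> S \<Longrightarrow> x \<in> \<Delta> \<Longrightarrow> x \<otimes> s \<in> \<Delta> \<Longrightarrow> \<pi> s x = x \<otimes> s"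
    by metis
  \<comment> \<open>Where right multiplication stays in \<open>\<Delta>\<close> the permutations
    agree with it, so the Cayley edges inside \<open>\<Delta>\<close> are edges of the
    covering.\<close>
  have move: "\<exists>l. fst l \<in> S \<and> y = x \<otimes> letter_val G l \<and> letter_move \<pi> l x = y"
    if "cayley_adj G S x y" "x \<in> \<Delta>" "y \<in> \<Delta>" for x y
  proof -
    obtain s where s: "s \<in> S" "y = x \<otimes> s \<or> y = x \<otimes> inv s"
      using \<open>cayley_adj G S x y\<close> unfolding cayley_adj_def by auto
    have sG: "s \<in> carrier G" "x \<in> carrier G" using s S that \<Delta>G by auto
    from s(2) show ?thesis
    proof
      assume "y = x \<otimes> s"
      then show ?thesis using s \<pi> that
        by (intro exI[of _ "(s, True)"]) (auto simp: letter_val.simps letter_move_def)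
    next
      assume y: "y = x \<otimes> inv s"
      then have "y \<otimes> s = x" using sG by (simp add: m_assoc)
      then have "\<pi> s y = x" using \<pi>(2)[OF s(1), of y] that by auto
      then have "inv_into UNIV (\<pi> s) x = y"
        using \<pi>(1)[OF s(1)] by (auto simp: permutes_inverses)
      then show ?thesis using s y
        by (intro exI[of _ "(s, False)"]) (auto simp: letter_val.simps letter_move_def)
    qed
  qed
  define E where "E = perm_graph \<Delta> S \<pi>"
  have graph: "graph \<Delta> E" unfolding E_def using \<Delta> S \<pi> by (intro graph_perm_graph) auto
  let ?B = "\<lambda>n. orbit_join (word_ball G S n) a"
  have B: "?B n \<in> C" for n
    using S a by (intro orbit_join_closed finite_word_ball word_ball_subset) auto
  \<comment> \<open>The vertex \<open>x\<close> ought to carry \<open>\<Delta> \<cdot> a\<close>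
    translated by \<open>inv x\<close>. The start is made with the partition belonging to
    \<open>x0\<close>, which has the same entropy as \<open>\<Delta> \<cdot> a\<close>.\<close>
  define D where "D = (\<lambda>y. inv x0 \<otimes> y) ` \<Delta>"
  have D: "finite D" "D \<noteq> {}" "D \<subseteq> carrier G" unfolding D_def using \<Delta> x0G \<Delta>G by auto
  define \<gamma> where "\<gamma> = (\<lambda>v. if v = x0 then orbit_join D a else bt)"
  define \<gamma>' where "\<gamma>' = (\<lambda>k. (expand S \<pi> ^^ k) \<gamma>)"
  have \<gamma>'0: "\<gamma>' 0 = \<gamma>" and \<gamma>'Suc: "\<gamma>' (Suc k) = expand S \<pi> (\<gamma>' k)" for k
    unfolding \<gamma>'_def by auto
  have \<gamma>'C: "\<gamma>' k v \<in> C" if "v \<in> \<Delta>" for k v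
    using that
  proof (induction k arbitrary: v)
    case 0
    then show ?case using D a by (simp add: \<gamma>'0 \<gamma>_def bt_closed orbit_join_closed)
  next
    case (Suc k)
    show ?case unfolding \<gamma>'Suc by (rule expand_closed[OF \<Delta>(1) S(1,2) \<pi>(1)]) (use Suc in auto)
  qed
  have exp: "expands \<Delta> E \<gamma> (\<gamma>' k)" for k
  proof (induction k)
    case 0
    then show ?case by (simp add: \<gamma>'0 expands_refl)
  next
    case (Suc k)
    have "expands \<Delta> E (\<gamma>' k) (\<gamma>' (Suc k))"
      unfolding E_def \<gamma>'Suc by (rule expands_expand[OF \<Delta>(1) S(1,2) \<pi>(1)]) (use \<gamma>'C in auto)
    with Suc show ?case by (rule expands_trans)
  qed
  have mono: "\<gamma>' k v \<preceq> \<gamma>' (k + m) v" if "v \<in> \<Delta>" for k m v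
  proof (induction m)
    case 0
    then show ?case using that \<gamma>'C by (simp add: le_refl)
  next
    case (Suc m)
    have "\<gamma>' (k + m) v \<preceq> \<gamma>' (Suc (k + m)) v"
      unfolding \<gamma>'Suc by (rule le_expand[OF \<Delta>(1) S(1,2) \<pi>(1)]) (use that \<gamma>'C in auto)
    with Suc show ?case using le_trans by simp
  qed
  \<comment> \<open>Along the path the labels multiply to
    \<open>inv (hd p) \<otimes> last p\<close>, so the vertex \<open>hd p\<close> receives its own
    translate of \<open>\<Delta> \<cdot> a\<close>.\<close>
  have reach: "\<exists>k. act (inv (hd p) \<otimes> last p) (\<gamma> x0) \<preceq> \<gamma>' k (hd p)"
    if "p \<noteq> []" "successively (cayley_adj G S) p" "set p \<subseteq> \<Delta>" "last p = x0" for p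
    using that
  proof (induction p rule: induct_list012)
    case (2 x)
    then show ?case using x0G \<gamma>'C[OF x0, of 0] by (intro exI[of _ 0]) (auto simp: \<gamma>'0 le_refl)
  next
    case (3 x y p)
    then obtain k where k: "act (inv y \<otimes> x0) (\<gamma> x0) \<preceq> \<gamma>' k y" by auto
    have xy: "x \<in> \<Delta>" "y \<in> \<Delta>" "cayley_adj G S x y" using 3 by auto
    then obtain l where l: "fst l \<in> S" "y = x \<otimes> letter_val G l" "letter_move \<pi> l x = y"
      using move by blast
    have G: "x \<in> carrier G" "y \<in> carrier G" "letter_val G l \<in> carrier G"
      using xy \<Delta>G l S by auto
    have \<gamma>0: "\<gamma> x0 \<in> C" using \<gamma>'C[OF x0, of 0] by (simp add: \<gamma>'0)
    have "letter_val G l \<otimes> (inv y \<otimes> x0) = inv x \<otimes> x0"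
      using G x0G l(2) by (simp add: inv_mult_group m_assoc[symmetric])
    then have "act (inv x \<otimes> x0) (\<gamma> x0) = act (letter_val G l) (act (inv y \<otimes> x0) (\<gamma> x0))"
      using G x0G \<gamma>0 by (simp add: act_act)
    also have "\<dots> \<preceq> act (letter_val G l) (\<gamma>' k y)"
      using G x0G \<gamma>0 k \<gamma>'C xy by (intro act_mono) auto
    also have "\<dots> \<preceq> \<gamma>' (Suc k) x"
      unfolding \<gamma>'Suc l(3)[symmetric]
      by (rule act_le_expand[OF \<Delta>(1) S(1,2) \<pi>(1)]) (use \<gamma>'C xy l in auto)
    finally show ?case using 3 by auto
  qed simp
  have "\<exists>k. a \<preceq> \<gamma>' k x" if x: "x \<in> \<Delta>" for x
  proof -
    have xG: "x \<in> carrier G" using x \<Delta>G by auto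
    obtain p where p: "cayley_simple_path G S x p x0"
      using cayley_path[OF S(2,3) xG x0G] by blast
    \<comment> \<open>Connectedness enters here: the path does not leave the vertex set of the
      covering.\<close>
    then have "set p \<subseteq> \<Delta>" using \<Delta>(3) x x0 unfolding right_connected_def by blast
    then obtain k where k: "act (inv x \<otimes> x0) (\<gamma> x0) \<preceq> \<gamma>' k x"
      using reach[of p] p unfolding cayley_simple_path_def by auto
    \<comment> \<open>As \<open>x\<close> lies in \<open>\<Delta>\<close>, the translate of
      \<open>\<Delta> \<cdot> a\<close> received at \<open>x\<close> refines
      \<open>a\<close>.\<close>
    have "act (inv x0 \<otimes> x) a \<preceq> orbit_join D a"
      using D a x by (intro orbit_join_upper) (auto simp: D_def)
    then have "act (inv x \<otimes> x0) (act (inv x0 \<otimes> x) a) \<preceq> act (inv x \<otimes> x0) (\<gamma> x0)"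
      using xG x0G D a by (intro act_mono) (auto simp: \<gamma>_def orbit_join_closed)
    moreover have "(inv x \<otimes> x0) \<otimes> (inv x0 \<otimes> x) = \<one>"
      using xG x0G by (simp add: m_assoc[symmetric] inv_solve_right')
        (simp add: m_assoc)
    ultimately have "a \<preceq> act (inv x \<otimes> x0) (\<gamma> x0)"
      using xG x0G a by (simp add: act_act)
    with k show ?thesis using le_trans by blast
  qed
  then obtain K where K: "\<And>x. x \<in> \<Delta> \<Longrightarrow> a \<preceq> \<gamma>' (K x) x" by metis
  define k where "k = Max (K ` \<Delta>)"
  have ak: "a \<preceq> \<gamma>' k x" if "x \<in> \<Delta>" for x
  proof -
    have "K x \<le> k" unfolding k_def using that \<Delta> by auto
    then show ?thesis using mono[OF that, of "K x" "k - K x"] K[OF that] le_trans by simp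
  qed
  \<comment> \<open>Conversely, everything reached is built from finitely many translates of
    \<open>a\<close> and lies below a ball, whose radius grows by one with each expansion.\<close>
  have "\<exists>n. \<forall>v\<in>\<Delta>. \<gamma>' k v \<preceq> ?B n"
  proof (induction k)
    case 0
    obtain n where "D \<subseteq> word_ball G S n"
      using finite_subset_word_ball[OF S(2,3) D(1,3)] by blast
    then have "orbit_join D a \<preceq> ?B n"
      using D S a by (intro orbit_join_subset finite_word_ball word_ball_subset)
    then show ?case using B bt_le by (intro exI[of _ n]) (auto simp: \<gamma>'0 \<gamma>_def)
  next
    case (Suc k)
    then obtain n where n: "\<And>v. v \<in> \<Delta> \<Longrightarrow> \<gamma>' k v \<preceq> ?B n" by auto
    have "\<gamma>' (Suc k) v \<preceq> expand S \<pi> (\<lambda>_. ?B n) v" if v: "v \<in> \<Delta>" for v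
      unfolding \<gamma>'Suc
    proof (rule expand_least[OF \<Delta>(1) S(1,2) \<pi>(1)])
      show "expand S \<pi> (\<lambda>_. ?B n) v \<in> C"
        by (rule expand_closed[OF \<Delta>(1) S(1,2) \<pi>(1)]) (use B v in auto)
      have "?B n \<preceq> expand S \<pi> (\<lambda>_. ?B n) v"
        by (rule le_expand[OF \<Delta>(1) S(1,2) \<pi>(1)]) (use B v in auto)
      then show "\<gamma>' k v \<preceq> expand S \<pi> (\<lambda>_. ?B n) v" using n[OF v] le_trans by blast
      fix l :: "'g \<times> bool" assume l: "fst l \<in> S"
      have lm: "letter_move \<pi> l v \<in> \<Delta>" using l v by (intro letter_move_closed[of S \<pi> \<Delta>, OF \<pi>(1)]) auto
      have "act (letter_val G l) (\<gamma>' k (letter_move \<pi> l v)) \<preceq> act (letter_val G l) (?B n)"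
        using l S B \<gamma>'C lm n by (intro act_mono) auto
      moreover have "act (letter_val G l) (?B n) \<preceq> expand S \<pi> (\<lambda>_. ?B n) v"
        by (rule act_le_expand[OF \<Delta>(1) S(1,2) \<pi>(1), where \<beta> = "\<lambda>_. ?B n"]) (use B v l in auto)
      ultimately show "act (letter_val G l) (\<gamma>' k (letter_move \<pi> l v)) \<preceq> expand S \<pi> (\<lambda>_. ?B n) v"
        by (rule le_trans)
    qed (use \<gamma>'C v in auto)
    moreover have "expand S \<pi> (\<lambda>_. ?B n) v = ?B (Suc n)" if "v \<in> \<Delta>" for v
      by (rule expand_orbit_join[OF \<Delta>(1) S(1,2) \<pi>(1) a that])
    ultimately show ?case by (intro exI[of _ "Suc n"]) auto
  qed
  then obtain n where n: "\<And>v. v \<in> \<Delta> \<Longrightarrow> \<gamma>' k v \<preceq> ?B n" by auto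
  have "real (card \<Delta>) * F S (?B n) = bethe \<Delta> E (\<lambda>_. ?B n)"
    unfolding E_def using \<Delta> S by (simp add: bethe_perm_graph_const)
  \<comment> \<open>With \<open>\<gamma>' k\<close> as bystander the constant ball is unchanged,
    while the constant family \<open>a\<close> becomes \<open>\<gamma>' k\<close>.\<close>
  also have "\<dots> = bethe \<Delta> E (\<lambda>v. ?B n \<curlyvee> \<gamma>' k v)"
    using B \<gamma>'C n by (intro bethe_cong[OF graph]) (simp add: join_absorb2)
  also have "\<dots> \<le> bethe \<Delta> E (\<lambda>v. a \<curlyvee> \<gamma>' k v)"
  proof (rule expandsD)
    show "expands \<Delta> E (\<lambda>_. a) (\<lambda>_. ?B n)"
      unfolding E_def by (rule expands_orbit_join[OF \<Delta>(1) S(1,2) \<pi>(1) a])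
  qed (rule \<gamma>'C)
  also have "\<dots> = bethe \<Delta> E (\<gamma>' k)"
    using a \<gamma>'C ak by (intro bethe_cong[OF graph]) (simp add: join_absorb1)
  also have "\<dots> \<le> bethe \<Delta> E \<gamma>"
    using exp graph by (rule expandsD_plain) (use \<gamma>'C[of _ 0] \<gamma>'C in \<open>auto simp: \<gamma>'0\<close>)
  \<comment> \<open>The mutual informations are discarded; away from \<open>x0\<close> the partition
    is trivial, so one entropy is left.\<close>
  also have "\<dots> \<le> (\<Sum>v\<in>\<Delta>. H (\<gamma> v))"
    unfolding bethe_def using graph \<gamma>'C[of _ 0] sum_I_nonneg[of E \<Delta> \<gamma>]
    by (auto simp: \<gamma>'0 graph_def)
  also have "\<dots> = H (orbit_join D a)"
    using x0 \<Delta> by (simp add: sum.remove[of \<Delta> x0] \<gamma>_def H_bt sum.neutral)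
  also have "\<dots> = H (act (inv x0) (orbit_join \<Delta> a))"
    unfolding D_def using \<Delta> \<Delta>G x0G a by (simp add: act_orbit_join)
  also have "\<dots> = H (orbit_join \<Delta> a)"
    using \<Delta> \<Delta>G x0G a by (simp add: orbit_join_closed)
  finally show ?thesis ..
qed

end

section \<open>Right actions of free groups\<close>

text \<open>With \<open>fold\<close> the first letter moves first, so words act from the right, as
  on the vertices of a Schreier graph.\<close>

definition word_move :: "('g \<Rightarrow> 'z \<Rightarrow> 'z) \<Rightarrow> ('g \<times> bool) list \<Rightarrow> 'z \<Rightarrow> 'z" where
  "word_move \<pi> = fold (letter_move \<pi>)"

definition inv_word :: "('g \<times> bool) list \<Rightarrow> ('g \<times> bool) list" where
  "inv_word w = rev (map (\<lambda>(s, b). (s, \<not> b)) w)"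

lemma word_move_append: "word_move \<pi> (u @ w) z = word_move \<pi> w (word_move \<pi> u z)"
  unfolding word_move_def by simp

lemma letter_move_cancel:
  assumes "\<And>s. s \<in> S \<Longrightarrow> bij (\<pi> s)" "s \<in> S"
  shows "letter_move \<pi> (s, \<not> b) (letter_move \<pi> (s, b) z) = z"
  using assms(1)[OF assms(2)] unfolding letter_move_def
  by (auto simp: bij_is_inj bij_is_surj surj_f_inv_f)

lemma word_move_inv_word:
  assumes "\<And>s. s \<in> S \<Longrightarrow> bij (\<pi> s)" "w \<in> words_over S"
  shows "word_move \<pi> (inv_word w) (word_move \<pi> w z) = z"
    and "word_move \<pi> w (word_move \<pi> (inv_word w) z) = z"
proof -
  show "word_move \<pi> (inv_word w) (word_move \<pi> w z) = z"
    using assms(2)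
  proof (induction w arbitrary: z)
    case Nil
    then show ?case by (simp add: word_move_def inv_word_def)
  next
    case (Cons l w)
    then show ?case using letter_move_cancel[of S \<pi> "fst l" "snd l", OF assms(1)]
      by (auto simp: word_move_def inv_word_def words_over_def case_prod_beta)
  qed
  show "word_move \<pi> w (word_move \<pi> (inv_word w) z) = z"
    using assms(2)
  proof (induction w arbitrary: z)
    case Nil
    then show ?case by (simp add: word_move_def inv_word_def)
  next
    case (Cons l w)
    then show ?case using letter_move_cancel[of S \<pi> "fst l" "\<not> snd l", OF assms(1)]
      by (auto simp: word_move_def inv_word_def words_over_def case_prod_beta)
  qed
qed

context group
begin

definition right_action :: "('a \<Rightarrow> 'z \<Rightarrow> 'z) \<Rightarrow> bool" where
  "right_action R \<longleftrightarrow> (\<forall>z. R \<one> z = z) \<and>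
     (\<forall>g\<in>carrier G. \<forall>h\<in>carrier G. \<forall>z. R (g \<otimes> h) z = R h (R g z))"

lemma right_action_one: "right_action R \<Longrightarrow> R \<one> z = z"
  unfolding right_action_def by blast

lemma right_action_mult:
  "right_action R \<Longrightarrow> g \<in> carrier G \<Longrightarrow> h \<in> carrier G \<Longrightarrow> R (g \<otimes> h) z = R h (R g z)"
  unfolding right_action_def by blast

lemma right_action_inv:
  "right_action R \<Longrightarrow> g \<in> carrier G \<Longrightarrow> R g y = z \<longleftrightarrow> R (inv g) z = y"
  using right_action_mult[of R g "inv g" y] right_action_mult[of R "inv g" g z]
  by (auto simp: right_action_one)

lemma right_action_fixed:
  assumes "right_action R" "S \<subseteq> carrier G" "\<And>s. s \<in> S \<Longrightarrow> R s z = z" "g \<in> generate G S"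
  shows "R g z = z"
  using assms(4)
proof induction
  case (eng h1 h2)
  then show ?case
    using assms generate_in_carrier[of S] by (simp add: right_action_mult)
next
  case (inv h)
  then show ?case using assms right_action_inv[of R h z z] by auto
qed (use assms in \<open>auto simp: right_action_one\<close>)

lemma letter_val_cancel:
  "s \<in> carrier G \<Longrightarrow> letter_val G (s, b) \<otimes> letter_val G (s, \<not> b) = \<one>"
  by (auto simp: letter_val.simps)

lemma inv_word_words_over: "w \<in> words_over S \<Longrightarrow> inv_word w \<in> words_over S"
  unfolding inv_word_def words_over_def by auto

lemma word_val_inv_word:
  assumes "S \<subseteq> carrier G" "w \<in> words_over S"
  shows "word_val G w \<otimes> word_val G (inv_word w) = \<one>"
  using assms(2)
proof (induction w)
  case Nil
  then show ?case by (simp add: inv_word_def)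
next
  case (Cons l w)
  obtain s b where l: "l = (s, b)" by force
  have lG: "fst l \<in> carrier G" "letter_val G l \<in> carrier G" "letter_val G (s, \<not> b) \<in> carrier G" "s \<in> carrier G"
    using Cons l assms(1) by auto
  have w: "word_val G w \<in> carrier G" "word_val G (inv_word w) \<in> carrier G"
    using Cons assms(1) by (auto intro!: word_val_closed[of S] inv_word_words_over)
  have "inv_word (l # w) = inv_word w @ [(s, \<not> b)]" unfolding inv_word_def l by simp
  then have "word_val G (inv_word (l # w)) = word_val G (inv_word w) \<otimes> letter_val G (s, \<not> b)"
    using Cons assms l lG inv_word_words_over[of w S] by (simp add: word_val_append[of S])
  then have "word_val G (l # w) \<otimes> word_val G (inv_word (l # w))
      = letter_val G l \<otimes> (word_val G w \<otimes> word_val G (inv_word w)) \<otimes> letter_val G (s, \<not> b)"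
    using w lG by (simp add: m_assoc)
  also have "\<dots> = letter_val G l \<otimes> letter_val G (s, \<not> b)"
    using Cons lG by simp
  also have "\<dots> = \<one>" unfolding l using lG by (intro letter_val_cancel)
  finally show ?case .
qed

text \<open>Cancelling adjacent inverse letters changes neither the value in the group nor the move.
  As one reduced word serves both, relations of the group carry over to the bijections.\<close>

lemma reduce_word:
  assumes "S \<subseteq> carrier G" "\<And>s. s \<in> S \<Longrightarrow> bij (\<pi> s)" "w \<in> words_over S"
  shows "\<exists>w'\<in>words_over S. reduced_word w' \<and> word_val G w' = word_val G w \<and> word_move \<pi> w' = word_move \<pi> w"
  using assms(3)
proof (induction w)
  case Nil
  then show ?case by (intro bexI[of _ "[]"]) (auto simp: reduced_word_def)
next
  case (Cons l w)
  then obtain w' where w': "w' \<in> words_over S" "reduced_word w'" "word_val G w' = word_val G w"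
      "word_move \<pi> w' = word_move \<pi> w" by auto
  have l: "fst l \<in> S" "fst l \<in> carrier G" using Cons assms(1) by auto
  have move: "word_move \<pi> (l # w) z = word_move \<pi> w' (letter_move \<pi> l z)" for z
    using w'(4) by (simp add: word_move_def)
  show ?case
  proof (cases "\<exists>m u. w' = m # u \<and> fst l = fst m \<and> snd l \<noteq> snd m")
    case True
    then obtain m u where mu: "w' = m # u" "fst l = fst m" "snd l \<noteq> snd m" by blast
    have "m = (fst l, \<not> snd l)" using mu(2,3) by (simp add: prod_eq_iff)
    with mu(1) have u: "w' = (fst l, \<not> snd l) # u" by simp
    have "reduced_word u" using w'(2) u unfolding reduced_word_def by (cases u) auto
    moreover have "word_val G u = word_val G (l # w)"
    proof -
      have "word_val G u \<in> carrier G" using w' u assms word_val_closed by auto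
      then have "letter_val G l \<otimes> (letter_val G (fst l, \<not> snd l) \<otimes> word_val G u) = word_val G u"
        using l letter_val_cancel[of "fst l" "snd l"] by (simp add: m_assoc[symmetric])
      then show ?thesis using w'(3) u by simp
    qed
    moreover have "word_move \<pi> u = word_move \<pi> (l # w)"
    proof
      fix z
      show "word_move \<pi> u z = word_move \<pi> (l # w) z"
        unfolding move u using letter_move_cancel[of S \<pi> "fst l" "snd l" z, OF assms(2) l(1)]
        by (simp add: word_move_def)
    qed
    moreover have "u \<in> words_over S" using w' u by auto
    ultimately show ?thesis by blast
  next
    case False
    then have "reduced_word (l # w')" using w'(2) unfolding reduced_word_def by (cases w') auto
    moreover have "word_move \<pi> (l # w') = word_move \<pi> (l # w)"
      using w'(4) by (simp add: word_move_def)
    ultimately show ?thesis using w' l by (intro bexI[of _ "l # w'"]) auto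
  qed
qed

text \<open>Universal property of a free group for maps into permutation groups: a word of value
  \<open>\<one>\<close> reduces to the empty word and moves nothing, whence words of equal value
  move alike.\<close>

lemma free_right_action:
  assumes free: "free_generating_set G S" and \<pi>: "\<And>s. s \<in> S \<Longrightarrow> bij (\<pi> s)"
  obtains R where "right_action R" "\<And>s. s \<in> S \<Longrightarrow> R s = \<pi> s"
proof -
  have S: "S \<subseteq> carrier G" "generate G S = carrier G"
    and red: "\<And>w. w \<in> words_over S \<Longrightarrow> reduced_word w \<Longrightarrow> word_val G w = \<one> \<Longrightarrow> w = []"
    using free unfolding free_generating_set_def by blast+
  have trivial: "word_move \<pi> w z = z" if w: "w \<in> words_over S" "word_val G w = \<one>" for w z
  proof -
    obtain w' where w': "w' \<in> words_over S" "reduced_word w'" "word_val G w' = word_val G w"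
        "word_move \<pi> w' = word_move \<pi> w"
      using reduce_word[of S \<pi> w, OF S(1) \<pi> w(1)] by auto
    then have "w' = []" using w red by auto
    then show ?thesis using w'(4) by (metis fold_Nil id_apply word_move_def)
  qed
  have eq: "word_move \<pi> u z = word_move \<pi> w z"
    if "u \<in> words_over S" "w \<in> words_over S" "word_val G u = word_val G w" for u w z
  proof -
    have "word_val G (u @ inv_word w) = \<one>"
      using word_val_append[OF S(1) that(1)] word_val_inv_word[OF S(1) that(2)] inv_word_words_over[OF that(2)] that(3) by auto
    then have "word_move \<pi> (inv_word w) (word_move \<pi> u z) = z"
      using trivial[of "u @ inv_word w" z] that(1) inv_word_words_over[OF that(2)]
      by (simp add: word_move_append)
    then show ?thesis using word_move_inv_word(2)[of S \<pi> w "word_move \<pi> u z", OF \<pi> that(2)] by simp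
  qed
  define W where "W = (\<lambda>g. SOME w. w \<in> words_over S \<and> word_val G w = g)"
  have W: "W g \<in> words_over S" "word_val G (W g) = g" if "g \<in> carrier G" for g
  proof -
    have "\<exists>w. w \<in> words_over S \<and> word_val G w = g"
      using generate_word[OF S(1), of g] that S(2) by blast
    from someI_ex[OF this] show "W g \<in> words_over S" "word_val G (W g) = g"
      unfolding W_def by auto
  qed
  define R where "R = (\<lambda>g. word_move \<pi> (W g))"
  have R: "R (word_val G w) z = word_move \<pi> w z" if "w \<in> words_over S" for w z
    unfolding R_def using that W word_val_closed[OF S(1)] by (intro eq) auto
  have "right_action R"
    unfolding right_action_def
  proof (intro conjI allI ballI)
    fix z show "R \<one> z = z" using R[of "[]" z] by (simp add: word_move_def)
  next
    fix g h z assume gh: "g \<in> carrier G" "h \<in> carrier G"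
    then have "word_val G (W g @ W h) = g \<otimes> h"
      using W word_val_append[OF S(1)] by simp
    then have "R (g \<otimes> h) z = word_move \<pi> (W g @ W h) z"
      using R[of "W g @ W h" z] W gh by simp
    then show "R (g \<otimes> h) z = R h (R g z)" by (simp add: word_move_append R_def)
  qed
  moreover have "R s = \<pi> s" if "s \<in> S" for s
  proof
    fix z
    have "word_val G [(s, True)] = s" using that S(1) by (auto simp: letter_val.simps)
    then show "R s z = \<pi> s z"
      using R[of "[(s, True)]" z] that by (simp add: word_move_def letter_move_def)
  qed
  ultimately show ?thesis using that by blast
qed

text \<open>A single letter is a reduced word. Hence no petal of a rose has the trivial label, and
  each can be subdivided along a nonempty word.\<close>

lemma free_generating_set_neq_one:
  assumes "free_generating_set G S" "s \<in> S"
  shows "s \<noteq> \<one>"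
proof -
  have "word_val G [(s, True)] \<noteq> \<one>"
    using assms unfolding free_generating_set_def
    by (auto simp: reduced_word_def simp del: word_val_Cons)
  then show ?thesis using assms by (auto simp: letter_val.simps free_generating_set_def)
qed

text \<open>Words for the elements of \<open>T\<close> involve only finitely many letters
  \<open>S0\<close>. A letter outside \<open>S0\<close> could act as the swap of two points while
  all other letters, and with them \<open>T\<close>, act trivially; but \<open>T\<close>
  generates.\<close>

lemma finite_free_generating_set:
  assumes free: "free_generating_set G S" and fg: "finitely_generated_group G"
  shows "finite S"
proof -
  obtain T where T: "finite T" "T \<subseteq> carrier G" "generate G T = carrier G"
    using fg unfolding finitely_generated_group_def by auto
  have S: "S \<subseteq> carrier G" "generate G S = carrier G"
    using free unfolding free_generating_set_def by auto
  have "\<exists>w. w \<in> words_over S \<and> word_val G w = t" if t: "t \<in> T" for t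
  proof -
    have "t \<in> generate G S" using t T S by auto
    then obtain w where "w \<in> words_over S" "word_val G w = t" by (rule generate_word[OF S(1)])
    then show ?thesis by blast
  qed
  then obtain W where W: "\<And>t. t \<in> T \<Longrightarrow> W t \<in> words_over S \<and> word_val G (W t) = t"
    by metis
  define S0 where "S0 = (\<Union>t\<in>T. fst ` set (W t))"
  have fin: "finite S0" unfolding S0_def using T by auto
  have "s \<in> S0" if s: "s \<in> S" for s
  proof (rule ccontr)
    assume nin: "s \<notin> S0"
    define \<pi> :: "'a \<Rightarrow> bool \<Rightarrow> bool" where "\<pi> = (\<lambda>u. if u = s then Not else id)"
    have "bij (\<pi> u)" for u unfolding \<pi>_def by (auto intro!: involuntory_imp_bij)
    then obtain R where R: "right_action R" "\<And>s. s \<in> S \<Longrightarrow> R s = \<pi> s"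
      using free_right_action[OF free, of \<pi>] by blast
    have "R t z = z" if t: "t \<in> T" for t z
    proof -
      have "w \<in> words_over S \<Longrightarrow> s \<notin> fst ` set w \<Longrightarrow> R (word_val G w) y = y" for w y
      proof (induction w arbitrary: y)
        case Nil
        then show ?case using R right_action_one by simp
      next
        case (Cons l w)
        obtain u b where l: "l = (u, b)" by force
        have u: "u \<in> S" "u \<in> carrier G" "u \<noteq> s" using Cons l S by auto
        have "R (letter_val G l) y = y"
          using right_action_inv[OF R(1) u(2), of y y] R(2)[OF u(1)] u
          by (cases b) (auto simp: l letter_val.simps \<pi>_def)
        then show ?case using Cons u l S R(1) word_val_closed[OF S(1)]
          by (auto simp: right_action_mult)
      qed
      moreover have "s \<notin> fst ` set (W t)" using nin t unfolding S0_def by auto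
      ultimately show ?thesis using W[OF t] by metis
    qed
    then have "R s False = False"
      using right_action_fixed[OF R(1) T(2), of False s] T s S by auto
    then show False using R(2)[OF s] by (simp add: \<pi>_def)
  qed
  then show ?thesis using fin by (meson finite_subset subsetI)
qed

end

section \<open>Independence of the basis by folding\<close>

context entropy_action
begin

text \<open>The bound \<open>c\<close> is an extended real because a limit of values of
  \<open>F\<close> may be \<open>-\<infinity>\<close>. The families refine \<open>a\<close> because
  the initial bound is obtained for refinements of the given partition.\<close>

definition bethe_bound :: "ereal \<Rightarrow> 'a \<Rightarrow> 'v set \<Rightarrow> ('v \<times> 'g \<times> 'v) multiset \<Rightarrow> bool" where
  "bethe_bound c a V E \<longleftrightarrow> (\<forall>\<beta>. (\<forall>v\<in>V. \<beta> v \<in> C \<and> a \<preceq> \<beta> v) \<longrightarrow> c \<le> ereal (bethe V E \<beta>))"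

text \<open>
  This expresses, without paths, that \<open>E\<close> is connected and that the labels of its closed paths
  at any vertex exhaust the group: a map from the graph to a Schreier graph is constant, and its value
  is a fixed point.
\<close>

definition full_graph :: "nat set \<Rightarrow> (nat \<times> 'g \<times> nat) multiset \<Rightarrow> bool" where
  "full_graph V E \<longleftrightarrow> (\<forall>(R :: 'g \<Rightarrow> nat \<Rightarrow> nat) \<rho>. right_action R \<longrightarrow>
      (\<forall>(v, g, w)\<in>#E. R g (\<rho> v) = \<rho> w) \<longrightarrow>
      (\<exists>z. (\<forall>v\<in>V. \<rho> v = z) \<and> (\<forall>g\<in>carrier G. R g z = z)))"

text \<open>The invariant maintained on the way from the rose of one basis to the rose of the
  other.\<close>

definition admissible :: "ereal \<Rightarrow> 'a \<Rightarrow> nat set \<Rightarrow> (nat \<times> 'g \<times> nat) multiset \<Rightarrow> bool" where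
  "admissible c a V E \<longleftrightarrow> graph V E \<and> V \<noteq> {} \<and> full_graph V E \<and> bethe_bound c a V E"

lemma full_graphD:
  fixes R :: "'g \<Rightarrow> nat \<Rightarrow> nat"
  assumes "full_graph V E" "right_action R" "\<And>v g w. (v, g, w) \<in># E \<Longrightarrow> R g (\<rho> v) = \<rho> w"
  obtains z where "\<And>v. v \<in> V \<Longrightarrow> \<rho> v = z" "\<And>g. g \<in> carrier G \<Longrightarrow> R g z = z"
proof -
  have "\<forall>(v, g, w)\<in>#E. R g (\<rho> v) = \<rho> w" using assms(3) by auto
  then obtain z where "\<forall>v\<in>V. \<rho> v = z" "\<forall>g\<in>carrier G. R g z = z"
    using assms(1,2) unfolding full_graph_def by blast
  then show ?thesis using that by simp
qed

lemma full_graphI: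
  assumes "\<And>(R :: 'g \<Rightarrow> nat \<Rightarrow> nat) \<rho>. right_action R \<Longrightarrow> (\<And>v g w. (v, g, w) \<in># E \<Longrightarrow> R g (\<rho> v) = \<rho> w) \<Longrightarrow>
      \<exists>z. (\<forall>v\<in>V. \<rho> v = z) \<and> (\<forall>g\<in>carrier G. R g z = z)"
  shows "full_graph V E"
  unfolding full_graph_def
proof (intro allI impI)
  fix R :: "'g \<Rightarrow> nat \<Rightarrow> nat" and \<rho>
  assume "right_action R" "\<forall>(v, g, w)\<in>#E. R g (\<rho> v) = \<rho> w"
  then show "\<exists>z. (\<forall>v\<in>V. \<rho> v = z) \<and> (\<forall>g\<in>carrier G. R g z = z)"
    by (intro assms) (auto dest: bspec)
qed

lemma bethe_boundD:
  "bethe_bound c a V E \<Longrightarrow> (\<And>v. v \<in> V \<Longrightarrow> \<beta> v \<in> C) \<Longrightarrow> (\<And>v. v \<in> V \<Longrightarrow> a \<preceq> \<beta> v) \<Longrightarrow> c \<le> ereal (bethe V E \<beta>)"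
  unfolding bethe_bound_def by blast

lemma bethe_add_edge:
  "bethe V (add_mset (v, g, w) E) \<beta> = bethe V E \<beta> - I (\<beta> v) (act g (\<beta> w))"
  unfolding bethe_def by simp

section \<open>Moves that keep a graph admissible: reversal, subdivision and folding\<close>

lemma admissible_flip:
  assumes "admissible c a V (add_mset (v, g, w) E)"
  shows "admissible c a V (add_mset (w, inv g, v) E)"
proof -
  have gr: "v \<in> V" "w \<in> V" "g \<in> carrier G" "graph V (add_mset (v, g, w) E)"
    and full: "full_graph V (add_mset (v, g, w) E)" and bd: "bethe_bound c a V (add_mset (v, g, w) E)"
    using assms unfolding admissible_def graph_def by auto
  have "full_graph V (add_mset (w, inv g, v) E)"
  proof (rule full_graphI)
    fix R :: "'g \<Rightarrow> nat \<Rightarrow> nat" and \<rho>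
    assume R: "right_action R" "\<And>x h y. (x, h, y) \<in># add_mset (w, inv g, v) E \<Longrightarrow> R h (\<rho> x) = \<rho> y"
    have "R g (\<rho> v) = \<rho> w"
      using R(2)[of w "inv g" v] right_action_inv[OF R(1) gr(3)] by auto
    then have "R h (\<rho> x) = \<rho> y" if "(x, h, y) \<in># add_mset (v, g, w) E" for x h y
      using that R(2)[of x h y] by auto
    then show "\<exists>z. (\<forall>v\<in>V. \<rho> v = z) \<and> (\<forall>g\<in>carrier G. R g z = z)"
      using full_graphD[OF full R(1)] by metis
  qed
  moreover have "bethe_bound c a V (add_mset (w, inv g, v) E)"
    unfolding bethe_bound_def
  proof (intro allI impI)
    fix \<beta> assume \<beta>: "\<forall>v\<in>V. \<beta> v \<in> C \<and> a \<preceq> \<beta> v"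
    then have "bethe V (add_mset (w, inv g, v) E) \<beta> = bethe V (add_mset (v, g, w) E) \<beta>"
      using gr by (simp add: bethe_add_edge I_act_inv)
    then show "c \<le> ereal (bethe V (add_mset (w, inv g, v) E) \<beta>)"
      using bd \<beta> unfolding bethe_bound_def by simp
  qed
  ultimately show ?thesis
    using assms gr unfolding admissible_def graph_def by auto
qed

text \<open>A family on the subdivided graph is pushed to the original one by forgetting
  \<open>x\<close> after joining its translate to \<open>v\<close>. The entropy gained at
  \<open>v\<close> is \<open>H (\<beta> x)\<close> minus the weight of the edge to \<open>x\<close>,
  and the weight of the second half is at most that of the undivided edge.\<close>

lemma admissible_subdivide:
  assumes adm: "admissible c a V (add_mset (v, g \<otimes> h, w) E)"
    and g: "g \<in> carrier G" and h: "h \<in> carrier G" and x: "x \<notin> V"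
  shows "admissible c a (insert x V) (add_mset (v, g, x) (add_mset (x, h, w) E))"
proof -
  have gr: "v \<in> V" "w \<in> V" "finite V" "set_mset E \<subseteq> V \<times> carrier G \<times> V" "V \<noteq> {}"
    and full: "full_graph V (add_mset (v, g \<otimes> h, w) E)"
    and bd: "bethe_bound c a V (add_mset (v, g \<otimes> h, w) E)"
    using adm unfolding admissible_def graph_def by auto
  let ?E = "add_mset (v, g, x) (add_mset (x, h, w) E)"
  have "graph (insert x V) ?E"
    using gr g h unfolding graph_def by auto
  moreover have "full_graph (insert x V) ?E"
  proof (rule full_graphI)
    fix R :: "'g \<Rightarrow> nat \<Rightarrow> nat" and \<rho>
    assume R: "right_action R" "\<And>y h z. (y, h, z) \<in># ?E \<Longrightarrow> R h (\<rho> y) = \<rho> z"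
    have x': "R g (\<rho> v) = \<rho> x" "R h (\<rho> x) = \<rho> w" using R(2) by auto
    then have "R (g \<otimes> h) (\<rho> v) = \<rho> w" using R(1) g h by (simp add: right_action_mult)
    then have "R k (\<rho> y) = \<rho> z" if "(y, k, z) \<in># add_mset (v, g \<otimes> h, w) E" for y k z
      using that R(2)[of y k z] by auto
    then obtain z where z: "\<And>u. u \<in> V \<Longrightarrow> \<rho> u = z" "\<And>g. g \<in> carrier G \<Longrightarrow> R g z = z"
      using full_graphD[OF full R(1)] by metis
    then show "\<exists>z. (\<forall>v\<in>insert x V. \<rho> v = z) \<and> (\<forall>g\<in>carrier G. R g z = z)"
      using x' gr g by (intro exI[of _ z]) auto
  qed
  moreover have "bethe_bound c a (insert x V) ?E"
    unfolding bethe_bound_def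
  proof (intro allI impI)
    fix \<beta> assume \<beta>: "\<forall>v\<in>insert x V. \<beta> v \<in> C \<and> a \<preceq> \<beta> v"
    let ?b = "\<beta> v \<curlyvee> act g (\<beta> x)"
    define \<beta>' where "\<beta>' = \<beta>(v := ?b)"
    have \<beta>': "\<beta>' u \<in> C" "\<beta> u \<preceq> \<beta>' u" if "u \<in> V" for u
      using that \<beta> gr g unfolding \<beta>'_def by (auto intro: le_refl join_ub1)
    have "a \<preceq> \<beta>' u" if "u \<in> V" for u using \<beta>'[OF that] \<beta> that le_trans by blast
    then have "c \<le> ereal (bethe V (add_mset (v, g \<otimes> h, w) E) \<beta>')"
      using bd \<beta>' by (intro bethe_boundD)
    also have "bethe V (add_mset (v, g \<otimes> h, w) E) \<beta>' \<le> bethe (insert x V) ?E \<beta>"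
    proof -
      \<comment> \<open>Translating by \<open>g\<close> moves the edge out of \<open>x\<close> to
        the vertex \<open>v\<close>.\<close>
      have "I (\<beta> x) (act h (\<beta> w)) = I (act g (\<beta> x)) (act (g \<otimes> h) (\<beta> w))"
        using \<beta> g h gr I_act[of g "\<beta> x" "act h (\<beta> w)"] by (simp add: act_act)
      also have "\<dots> \<le> I (\<beta>' v) (act (g \<otimes> h) (\<beta>' w))"
        using \<beta> \<beta>' g h gr by (intro I_mono act_mono) (auto simp: \<beta>'_def join_ub2)
      finally have 1: "I (\<beta> x) (act h (\<beta> w)) \<le> I (\<beta>' v) (act (g \<otimes> h) (\<beta>' w))" .
      have 2: "(\<Sum>(v, g, w)\<in>#E. I (\<beta> v) (act g (\<beta> w))) \<le> (\<Sum>(v, g, w)\<in>#E. I (\<beta>' v) (act g (\<beta>' w)))"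
        using gr \<beta> \<beta>' by (intro sum_I_mono) auto
      have 3: "(\<Sum>u\<in>V. H (\<beta>' u)) = (\<Sum>u\<in>V. H (\<beta> u)) - H (\<beta> v) + H ?b"
        unfolding \<beta>'_def using sum_fun_upd[OF gr(3,1)] by simp
      have 4: "H ?b = H (\<beta> v) + H (\<beta> x) - I (\<beta> v) (act g (\<beta> x))"
        unfolding I_def using \<beta> g gr by simp
      show ?thesis
        using 1 2 3 4 x gr(3) unfolding bethe_def by simp
    qed
    finally show "c \<le> ereal (bethe (insert x V) ?E \<beta>)" by simp
  qed
  ultimately show ?thesis unfolding admissible_def by simp
qed

text \<open>
  Pulling a family back from the folded graph, the partition at \<open>v\<close> is first enlarged by the
  translate of the one at \<open>w\<^sub>1\<close>; the additional vertex \<open>w\<^sub>2\<close> then has no entropy relative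
  to \<open>v\<close> and does not contribute.
\<close>
lemma admissible_fold:
  assumes adm: "admissible c a V (add_mset (v, g, w1) (add_mset (v, g, w2) E))"
    and ne: "w1 \<noteq> w2" "w2 \<noteq> v"
  defines "f \<equiv> (\<lambda>u. if u = w2 then w1 else u)"
  shows "admissible c a (V - {w2}) (add_mset (v, g, w1) (image_mset (\<lambda>(x, h, y). (f x, h, f y)) E))"
proof -
  let ?E = "add_mset (v, g, w1) (add_mset (v, g, w2) E)"
  let ?E' = "add_mset (v, g, w1) (image_mset (\<lambda>(x, h, y). (f x, h, f y)) E)"
  have gr: "v \<in> V" "w1 \<in> V" "w2 \<in> V" "g \<in> carrier G" "finite V" "set_mset E \<subseteq> V \<times> carrier G \<times> V"
    and full: "full_graph V ?E" and bd: "bethe_bound c a V ?E"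
    using adm unfolding admissible_def graph_def by auto
  have f: "f u \<in> V - {w2}" if "u \<in> V" for u using that gr ne unfolding f_def by auto
  have fid: "f u = u" if "u \<noteq> w2" for u using that unfolding f_def by auto
  have fw: "f w1 = w1" "f w2 = w1" "f v = v" using ne unfolding f_def by auto
  have "graph (V - {w2}) ?E'"
    using gr f ne unfolding graph_def by fastforce
  moreover have "full_graph (V - {w2}) ?E'"
  proof (rule full_graphI)
    fix R :: "'g \<Rightarrow> nat \<Rightarrow> nat" and \<rho>
    assume R: "right_action R" "\<And>x h y. (x, h, y) \<in># ?E' \<Longrightarrow> R h (\<rho> x) = \<rho> y"
    have "R h (\<rho> (f x)) = \<rho> (f y)" if "(x, h, y) \<in># ?E" for x h y
    proof -
      have "(f x, h, f y) \<in># ?E'" using that fw by force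
      then show ?thesis by (rule R(2))
    qed
    then obtain z where z: "\<And>u. u \<in> V \<Longrightarrow> \<rho> (f u) = z" "\<And>g. g \<in> carrier G \<Longrightarrow> R g z = z"
      using full_graphD[OF full R(1), of "\<lambda>u. \<rho> (f u)"] by metis
    have "\<rho> u = z" if "u \<in> V - {w2}" for u using z(1)[of u] fid[of u] that by simp
    then show "\<exists>z. (\<forall>v\<in>V - {w2}. \<rho> v = z) \<and> (\<forall>g\<in>carrier G. R g z = z)"
      using z(2) by blast
  qed
  moreover have "bethe_bound c a (V - {w2}) ?E'"
    unfolding bethe_bound_def
  proof (intro allI impI)
    fix \<beta>0 assume \<beta>0: "\<forall>v\<in>V - {w2}. \<beta>0 v \<in> C \<and> a \<preceq> \<beta>0 v"
    define \<beta> where "\<beta> = (\<lambda>u. \<beta>0 (f u))"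
    let ?b = "\<beta> v \<curlyvee> act g (\<beta> w1)"
    define \<beta>' where "\<beta>' = \<beta>(v := ?b)"
    have \<beta>: "\<beta> u \<in> C" "a \<preceq> \<beta> u" if "u \<in> V" for u
      using \<beta>0 f[OF that] unfolding \<beta>_def by auto
    have \<beta>': "\<beta>' u \<in> C" "\<beta> u \<preceq> \<beta>' u" if "u \<in> V" for u
      using that \<beta> gr unfolding \<beta>'_def by (auto intro: le_refl join_ub1)
    have "a \<preceq> \<beta>' u" if "u \<in> V" for u using \<beta>'[OF that] \<beta> that le_trans by blast
    then have "c \<le> ereal (bethe V ?E \<beta>')"
      using bd \<beta>' by (intro bethe_boundD)
    also have "bethe V ?E \<beta>' \<le> bethe (V - {w2}) ?E' \<beta>0"
    proof -
      have w12: "\<beta> w2 = \<beta> w1" unfolding \<beta>_def fw ..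
      have \<beta>'w2: "\<beta>' w2 = \<beta> w1" using ne w12 unfolding \<beta>'_def by auto
      have b: "?b \<in> C" "act g (\<beta> w1) \<in> C" using \<beta> gr by auto
      have 1: "H ?b - I ?b (act g (\<beta>' w1)) \<le> H (\<beta> v) - I (\<beta> v) (act g (\<beta> w1))"
      proof -
        \<comment> \<open>If \<open>w1\<close> is \<open>v\<close>, the partition at
          \<open>w1\<close> has grown too.\<close>
        have "I ?b (act g (\<beta> w1)) \<le> I ?b (act g (\<beta>' w1))"
          using \<beta> \<beta>' gr b by (intro I_mono act_mono) (auto intro: le_refl)
        moreover have "?b \<curlyvee> act g (\<beta> w1) = ?b"
          using \<beta> gr b by (intro join_absorb2) (auto intro: join_ub2)
        ultimately show ?thesis unfolding I_def by simp
      qed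
      have 2: "I ?b (act g (\<beta>' w2)) = H (\<beta> w1)"
        using \<beta> gr b by (simp add: I_def \<beta>'w2 join_absorb2 join_ub2)
      have 3: "(\<Sum>(v, g, w)\<in>#E. I (\<beta> v) (act g (\<beta> w))) \<le> (\<Sum>(v, g, w)\<in>#E. I (\<beta>' v) (act g (\<beta>' w)))"
        using gr \<beta> \<beta>' by (intro sum_I_mono) auto
      have 4: "(\<Sum>u\<in>V. H (\<beta>' u)) = (\<Sum>u\<in>V. H (\<beta> u)) - H (\<beta> v) + H ?b"
        unfolding \<beta>'_def using sum_fun_upd[OF gr(5,1)] by simp
      have 5: "(\<Sum>u\<in>V. H (\<beta> u)) = H (\<beta> w1) + (\<Sum>u\<in>V - {w2}. H (\<beta>0 u))"
        using gr w12 by (simp add: sum.remove[of V w2] \<beta>_def fid)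
      have 6: "(\<Sum>(v, g, w)\<in>#E. I (\<beta> v) (act g (\<beta> w))) =
          (\<Sum>(v, g, w)\<in>#image_mset (\<lambda>(x, h, y). (f x, h, f y)) E. I (\<beta>0 v) (act g (\<beta>0 w)))"
        unfolding image_mset.compositionality comp_def \<beta>_def
        by (rule arg_cong[of _ _ sum_mset], rule image_mset_cong) (auto split: prod.split)
      have 7: "\<beta> v = \<beta>0 v" "\<beta> w1 = \<beta>0 w1" unfolding \<beta>_def fw by auto
      have 8: "\<beta>' v = ?b" unfolding \<beta>'_def by simp
      show ?thesis
        using 1 2 3 6 unfolding bethe_def 4 5 sum_mset.add_mset image_mset_add_mset prod.case 8 7
        by linarith
    qed
    finally show "c \<le> ereal (bethe (V - {w2}) ?E' \<beta>0)" by simp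
  qed
  moreover have "V - {w2} \<noteq> {}" using gr ne by auto
  ultimately show ?thesis unfolding admissible_def by simp
qed

definition labelled :: "'g set \<Rightarrow> (nat \<times> 'g \<times> nat) multiset \<Rightarrow> bool" where
  "labelled S E \<longleftrightarrow> (\<forall>e\<in>#E. fst (snd e) \<in> S)"

lemma admissible_orient:
  assumes S: "S \<subseteq> carrier G" and adm: "admissible c a V (add_mset (v, letter_val G l, w) E)" and l: "fst l \<in> S"
  obtains e where "admissible c a V (add_mset e E)" "fst (snd e) \<in> S"
proof (cases "snd l")
  case True
  then have "letter_val G l = fst l" by (cases l) (simp add: letter_val.simps)
  then show ?thesis using adm l that[of "(v, fst l, w)"] by simp
next
  case False
  then have "letter_val G l = inv (fst l)" by (cases l) (simp add: letter_val.simps)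
  then have "inv (letter_val G l) = fst l" using l S by auto
  then show ?thesis using admissible_flip[OF adm] l that[of "(w, fst l, v)"] by simp
qed

text \<open>Letters are split off from the left, each but the last with a fresh vertex. The empty
  word is excluded, as it would require contracting the edge.\<close>

lemma admissible_subdivide_word:
  assumes "S \<subseteq> carrier G" "u \<in> words_over S" "u \<noteq> []" "admissible c a V (add_mset (v, word_val G u, w) E)"
  shows "\<exists>V' E'. admissible c a V' (E' + E) \<and> labelled S E'"
  using assms(2-)
proof (induction u arbitrary: V v E)
  case (Cons l u)
  have l: "fst l \<in> S" "letter_val G l \<in> carrier G" using Cons assms(1) by auto
  show ?case
  proof (cases "u = []")
    case True
    then have "admissible c a V (add_mset (v, letter_val G l, w) E)" using Cons l by simp
    then obtain e where "admissible c a V (add_mset e E)" "fst (snd e) \<in> S"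
      by (rule admissible_orient[OF assms(1) _ l(1)])
    then show ?thesis by (intro exI[of _ V] exI[of _ "{#e#}"]) (auto simp: labelled_def)
  next
    case False
    have "finite V" using Cons unfolding admissible_def graph_def by auto
    then obtain x :: nat where x: "x \<notin> V" using ex_new_if_finite[OF infinite_UNIV_nat] by auto
    have "admissible c a (insert x V) (add_mset (v, letter_val G l, x) (add_mset (x, word_val G u, w) E))"
      using Cons l x assms(1) word_val_closed by (intro admissible_subdivide) auto
    then obtain e where e: "admissible c a (insert x V) (add_mset e (add_mset (x, word_val G u, w) E))"
        "fst (snd e) \<in> S"
      by (rule admissible_orient[OF assms(1) _ l(1)])
    then have "admissible c a (insert x V) (add_mset (x, word_val G u, w) (add_mset e E))"
      by (simp add: add_mset_commute)
    from Cons.IH[OF _ False this] Cons.prems obtain V' E' where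
        "admissible c a V' (E' + add_mset e E)" "labelled S E'" by auto
    then show ?thesis using e(2)
      by (intro exI[of _ V'] exI[of _ "add_mset e E'"]) (auto simp: labelled_def)
  qed
qed simp

text \<open>Induction on the edges still to be treated; \<open>E\<close> carries the finished ones
  along.\<close>

lemma admissible_subdivide_all:
  assumes "S \<subseteq> carrier G" "generate G S = carrier G" "admissible c a V (E1 + E)"
    "\<And>e. e \<in># E1 \<Longrightarrow> fst (snd e) \<in> carrier G - {\<one>}"
  shows "\<exists>V' E'. admissible c a V' (E' + E) \<and> labelled S E'"
  using assms(3-)
proof (induction E1 arbitrary: V E)
  case empty
  then show ?case by (intro exI[of _ V] exI[of _ "{#}"]) (auto simp: labelled_def)
next
  case (add e E1)
  obtain v g w where e: "e = (v, g, w)" by (cases e)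
  have "g \<in> generate G S" using add.prems(2)[of e] e assms(2) by auto
  then obtain u where u: "u \<in> words_over S" "word_val G u = g"
    using generate_word[OF assms(1)] by blast
  have "u \<noteq> []" using add.prems(2)[of e] e u by auto
  moreover have "admissible c a V (add_mset (v, word_val G u, w) (E1 + E))"
    using add.prems(1) e u by simp
  ultimately obtain V' E' where E': "admissible c a V' (E' + (E1 + E))" "labelled S E'"
    using admissible_subdivide_word[OF assms(1) u(1)] by blast
  then have "admissible c a V' (E1 + (E' + E))" by (simp add: ac_simps)
  from add.IH[OF this] add.prems(2) obtain V'' E'' where
    "admissible c a V'' (E'' + (E' + E))" "labelled S E''" by auto
  then show ?case using E'(2)
    by (intro exI[of _ V''] exI[of _ "E'' + E'"]) (auto simp: labelled_def ac_simps)
qed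

text \<open>Each label is a partial injection of the vertices. Both directions are listed because a
  labelled graph keeps positive letters only.\<close>

definition folded :: "(nat \<times> 'g \<times> nat) multiset \<Rightarrow> bool" where
  "folded E \<longleftrightarrow> (\<forall>v g w1 w2. (v, g, w1) \<in># E \<longrightarrow> (v, g, w2) \<in># E \<longrightarrow> w1 = w2) \<and>
     (\<forall>v g w1 w2. (w1, g, v) \<in># E \<longrightarrow> (w2, g, v) \<in># E \<longrightarrow> w1 = w2)"

text \<open>\<open>admissible_fold\<close> removes an endpoint other than \<open>v\<close>; as the
  two endpoints differ, one of them qualifies.\<close>

lemma admissible_fold_labelled:
  assumes adm: "admissible c a V E" and lab: "labelled S E"
    and e: "(v, g, w1) \<in># E" "(v, g, w2) \<in># E" "w1 \<noteq> w2"
  shows "\<exists>V' E'. admissible c a V' E' \<and> labelled S E' \<and> card V' < card V"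
proof -
  have *: "\<exists>V' E'. admissible c a V' E' \<and> labelled S E' \<and> card V' < card V"
    if e: "(v, g, w1) \<in># E" "(v, g, w2) \<in># E" "w1 \<noteq> w2" "w2 \<noteq> v" for w1 w2
  proof -
    have "(v, g, w2) \<in># E - {#(v, g, w1)#}" using e by (simp add: in_diff_count)
    with e(1) obtain E0 where E0: "E = add_mset (v, g, w1) (add_mset (v, g, w2) E0)"
      by (metis insert_DiffM)
    have "w2 \<in> V" "finite V" using adm E0 unfolding admissible_def graph_def by auto
    then have "card (V - {w2}) < card V" by (rule card_Diff1_less[rotated])
    moreover have "labelled S (add_mset (v, g, w1) (image_mset
        (\<lambda>(x, h, y). (if x = w2 then w1 else x, h, if y = w2 then w1 else y)) E0))"
      using lab unfolding labelled_def E0 by auto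
    ultimately show ?thesis using admissible_fold[OF adm[unfolded E0] e(3,4)] by blast
  qed
  show ?thesis
  proof (cases "w2 = v")
    case True
    then show ?thesis using *[of w2 w1] e by auto
  next
    case False
    then show ?thesis using *[of w1 w2] e by auto
  qed
qed

text \<open>Reversing both edges turns the common target into a common source; the surviving edge is
  reversed back, so that its label lies in \<open>S\<close> again.\<close>

lemma admissible_fold_labelled_rev:
  assumes adm: "admissible c a V E" and lab: "labelled S E"
    and e: "(w1, g, v) \<in># E" "(w2, g, v) \<in># E" "w1 \<noteq> w2"
  shows "\<exists>V' E'. admissible c a V' E' \<and> labelled S E' \<and> card V' < card V"
proof -
  have *: "\<exists>V' E'. admissible c a V' E' \<and> labelled S E' \<and> card V' < card V"
    if e: "(w1, g, v) \<in># E" "(w2, g, v) \<in># E" "w1 \<noteq> w2" "w2 \<noteq> v" for w1 w2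
  proof -
    have "(w2, g, v) \<in># E - {#(w1, g, v)#}" using e by (simp add: in_diff_count)
    with e(1) obtain E0 where E0: "E = add_mset (w1, g, v) (add_mset (w2, g, v) E0)"
      by (metis insert_DiffM)
    have V: "w2 \<in> V" "finite V" "g \<in> carrier G" using adm E0 unfolding admissible_def graph_def by auto
    let ?E1 = "image_mset (\<lambda>(x, h, y). (if x = w2 then w1 else x, h, if y = w2 then w1 else y)) E0"
    have "admissible c a V (add_mset (v, inv g, w1) (add_mset (w2, g, v) E0))"
      using adm unfolding E0 by (rule admissible_flip)
    then have "admissible c a V (add_mset (w2, g, v) (add_mset (v, inv g, w1) E0))"
      by (simp add: add_mset_commute)
    then have "admissible c a V (add_mset (v, inv g, w2) (add_mset (v, inv g, w1) E0))"
      by (rule admissible_flip)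
    then have "admissible c a V (add_mset (v, inv g, w1) (add_mset (v, inv g, w2) E0))"
      by (simp add: add_mset_commute)
    from admissible_flip[OF admissible_fold[OF this e(3,4)]]
    have "admissible c a (V - {w2}) (add_mset (w1, g, v) ?E1)"
      using V by simp
    moreover have "card (V - {w2}) < card V" using V by (intro card_Diff1_less)
    moreover have "labelled S (add_mset (w1, g, v) ?E1)"
      using lab unfolding labelled_def E0 by auto
    ultimately show ?thesis by blast
  qed
  show ?thesis
  proof (cases "w2 = v")
    case True
    then show ?thesis using *[of w2 w1] e by auto
  next
    case False
    then show ?thesis using *[of w1 w2] e by auto
  qed
qed

text \<open>Each fold removes a vertex, so folding terminates.\<close>

lemma admissible_folded:
  assumes "admissible c a V E" "labelled S E"
  shows "\<exists>V' E'. admissible c a V' E' \<and> labelled S E' \<and> folded E'"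
  using assms
proof (induction "card V" arbitrary: V E rule: less_induct)
  case less
  show ?case
  proof (cases "folded E")
    case True
    then show ?thesis using less by blast
  next
    case False
    then consider v g w1 w2 where "(v, g, w1) \<in># E" "(v, g, w2) \<in># E" "w1 \<noteq> w2"
      | v g w1 w2 where "(w1, g, v) \<in># E" "(w2, g, v) \<in># E" "w1 \<noteq> w2"
      unfolding folded_def by blast
    then have "\<exists>V' E'. admissible c a V' E' \<and> labelled S E' \<and> card V' < card V"
      by cases (use admissible_fold_labelled admissible_fold_labelled_rev less.prems in blast)+
    then show ?thesis using less.hyps by blast
  qed
qed

text \<open>
  A missing edge at a vertex would allow the partial injections of a folded graph to be extended to
  permutations that move this vertex out of the graph.
\<close>
lemma folded_is_rose:
  assumes free: "free_generating_set G S" and adm: "admissible c a V E"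
    and lab: "labelled S E" and fold: "folded E"
  obtains z where "V = {z}" "\<And>s. s \<in> S \<Longrightarrow> (z, s, z) \<in># E"
proof -
  have V: "finite V" "V \<noteq> {}" "\<And>v g w. (v, g, w) \<in># E \<Longrightarrow> v \<in> V \<and> w \<in> V" and full: "full_graph V E"
    using adm unfolding admissible_def graph_def by auto
  \<comment> \<open>Adding \<open>M\<close> sends the vertices injectively outside \<open>V\<close>;
    a missing edge at \<open>v\<close> is replaced by a step to \<open>v + M\<close>.\<close>
  define M where "M = Suc (Max V)"
  have M: "v < M" if "v \<in> V" for v unfolding M_def using V that by (simp add: less_Suc_eq_le)
  define \<sigma> where "\<sigma> = (\<lambda>s v. if \<exists>w. (v, s, w) \<in># E then THE w. (v, s, w) \<in># E else v + M)"
  have \<sigma>1: "\<sigma> s v = w" if "(v, s, w) \<in># E" for s v w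
    using that fold unfolding \<sigma>_def folded_def by (auto intro!: the_equality)
  have \<sigma>2: "\<sigma> s v = v + M" if "\<not> (\<exists>w. (v, s, w) \<in># E)" for s v
    using that unfolding \<sigma>_def by auto
  have \<sigma>V: "\<sigma> s v \<in> V \<union> (\<lambda>v. v + M) ` V" if "v \<in> V" for s v
    using that \<sigma>1 \<sigma>2 V(3) by (cases "\<exists>w. (v, s, w) \<in># E") auto
  have inj: "inj_on (\<sigma> s) V" for s
  proof (rule inj_onI)
    fix x y assume xy: "x \<in> V" "y \<in> V" "\<sigma> s x = \<sigma> s y"
    consider w w' where "(x, s, w) \<in># E" "(y, s, w') \<in># E"
      | w where "(x, s, w) \<in># E" "\<not> (\<exists>w. (y, s, w) \<in># E)"
      | w where "\<not> (\<exists>w. (x, s, w) \<in># E)" "(y, s, w) \<in># E"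
      | "\<not> (\<exists>w. (x, s, w) \<in># E)" "\<not> (\<exists>w. (y, s, w) \<in># E)"
      by blast
    then show "x = y"
    proof cases
      case 1
      then have "(y, s, w) \<in># E" using \<sigma>1[OF 1(1)] \<sigma>1[OF 1(2)] xy(3) by simp
      then show ?thesis using 1(1) fold unfolding folded_def by blast
    next
      case 2
      show ?thesis using \<sigma>1[OF 2(1)] \<sigma>2[OF 2(2)] xy(3) V(3)[OF 2(1)] M[of w] by linarith
    next
      case 3
      show ?thesis using \<sigma>2[OF 3(1)] \<sigma>1[OF 3(2)] xy(3) V(3)[OF 3(2)] M[of w] by linarith
    next
      case 4
      show ?thesis using \<sigma>2[OF 4(1)] \<sigma>2[OF 4(2)] xy(3) by linarith
    qed
  qed
  have "\<exists>p. bij p \<and> (\<forall>v\<in>V. p v = \<sigma> s v)" for s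
  proof -
    have "finite (V \<union> (\<lambda>v. v + M) ` V)" "V \<subseteq> V \<union> (\<lambda>v. v + M) ` V" "\<sigma> s ` V \<subseteq> V \<union> (\<lambda>v. v + M) ` V"
      using V(1) \<sigma>V by auto
    then obtain p where "p permutes (V \<union> (\<lambda>v. v + M) ` V)" "\<And>v. v \<in> V \<Longrightarrow> p v = \<sigma> s v"
      using permutes_extension[of "V \<union> (\<lambda>v. v + M) ` V" V "\<sigma> s"] inj by metis
    then show ?thesis using permutes_bij by blast
  qed
  then obtain \<pi> where \<pi>: "\<And>s. bij (\<pi> s)" "\<And>s v. v \<in> V \<Longrightarrow> \<pi> s v = \<sigma> s v" by metis
  obtain R where R: "right_action R" "\<And>s. s \<in> S \<Longrightarrow> R s = \<pi> s"
    using free_right_action[OF free, of \<pi>] \<pi>(1) by blast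
  have "R g v = w" if "(v, g, w) \<in># E" for v g w
  proof -
    have "g \<in> S" using lab that unfolding labelled_def by force
    then show ?thesis using R(2) \<pi>(2) \<sigma>1[OF that] V(3)[OF that] by simp
  qed
  \<comment> \<open>Fullness is applied to the identity map into the Schreier graph of this action:
    there is only one vertex, and the whole group fixes it.\<close>
  then obtain z where z: "\<And>v. v \<in> V \<Longrightarrow> v = z" "\<And>g. g \<in> carrier G \<Longrightarrow> R g z = z"
    using full_graphD[OF full R(1), of "\<lambda>v. v"] by metis
  have Vz: "V = {z}" using z(1) V(2) by auto
  moreover have "(z, s, z) \<in># E" if s: "s \<in> S" for s
  proof -
    have "s \<in> carrier G" using s free unfolding free_generating_set_def by auto
    then have fixed: "\<sigma> s z = z" using z(2)[of s] R(2)[OF s] \<pi>(2)[of z s] Vz by simp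
    have "\<exists>w. (z, s, w) \<in># E"
    proof (rule ccontr)
      assume "\<not> (\<exists>w. (z, s, w) \<in># E)"
      then show False using \<sigma>2 fixed M[of z] Vz by simp
    qed
    then obtain w where w: "(z, s, w) \<in># E" by auto
    then have "w = z" using V(3)[OF w] Vz by auto
    then show ?thesis using w by simp
  qed
  ultimately show ?thesis using that by blast
qed

text \<open>The lower bound travels from the rose of \<open>S'\<close> to a graph with one vertex
  and a loop for each element of \<open>S\<close>. Repeated loops may remain, but the functional
  with them is at most \<open>F S b\<close>.\<close>

theorem F_bound_change_basis:
  assumes S': "free_generating_set G S'" "finite S'" and S: "free_generating_set G S" "finite S"
    and bound: "\<And>b. b \<in> C \<Longrightarrow> a \<preceq> b \<Longrightarrow> c \<le> ereal (F S' b)" and b: "b \<in> C" "a \<preceq> b"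
  shows "c \<le> ereal (F S b)"
proof -
  have S'G: "S' \<subseteq> carrier G" "generate G S' = carrier G" and SG: "S \<subseteq> carrier G" "generate G S = carrier G"
    using S S' unfolding free_generating_set_def by auto
  let ?E = "perm_graph {0::nat} S' (\<lambda>_ x. x)"
  have setE: "set_mset ?E = (\<lambda>s. (0, s, 0)) ` S'"
    unfolding perm_graph_def using S' by auto
  have "admissible c a {0} ?E"
    unfolding admissible_def
  proof (intro conjI)
    show "graph {0} ?E" unfolding graph_def setE using S'G by auto
    show "full_graph {0} ?E"
    proof (rule full_graphI)
      fix R :: "'g \<Rightarrow> nat \<Rightarrow> nat" and \<rho>
      assume R: "right_action R" "\<And>x h y. (x, h, y) \<in># ?E \<Longrightarrow> R h (\<rho> x) = \<rho> y"
      have "R s (\<rho> 0) = \<rho> 0" if "s \<in> S'" for s using R(2)[of 0 s 0] that setE by auto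
      then have "R g (\<rho> 0) = \<rho> 0" if "g \<in> carrier G" for g
        using right_action_fixed[OF R(1) S'G(1)] S'G(2) that by auto
      then show "\<exists>z. (\<forall>v\<in>{0}. \<rho> v = z) \<and> (\<forall>g\<in>carrier G. R g z = z)" by auto
    qed
    show "bethe_bound c a {0} ?E"
      unfolding bethe_bound_def
    proof (intro allI impI)
      fix \<beta> :: "nat \<Rightarrow> 'a" assume \<beta>: "\<forall>v\<in>{0}. \<beta> v \<in> C \<and> a \<preceq> \<beta> v"
      have "bethe {0} ?E \<beta> = bethe {0} ?E (\<lambda>_. \<beta> 0)"
        by (rule bethe_cong) (use S'G setE in \<open>auto simp: graph_def\<close>)
      also have "\<dots> = F S' (\<beta> 0)" using S' by (simp add: bethe_perm_graph_const)
      finally show "c \<le> ereal (bethe {0} ?E \<beta>)" using bound \<beta> by simp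
    qed
  qed simp
  then have "admissible c a {0} (?E + {#})" by simp
  moreover have "fst (snd e) \<in> carrier G - {\<one>}" if "e \<in># ?E" for e
    using that setE S'G free_generating_set_neq_one[OF S'(1)] by auto
  ultimately obtain V1 E1 where "admissible c a V1 (E1 + {#})" "labelled S E1"
    using admissible_subdivide_all[OF SG] by blast
  then obtain V E where VE: "admissible c a V E" "labelled S E" "folded E"
    using admissible_folded by (metis add.right_neutral)
  then obtain z where z: "V = {z}" "\<And>s. s \<in> S \<Longrightarrow> (z, s, z) \<in># E"
    using folded_is_rose[OF S(1)] by blast
  have "c \<le> ereal (bethe V E (\<lambda>_. b))"
    using VE(1) b unfolding admissible_def by (intro bethe_boundD) auto
  also have "bethe V E (\<lambda>_. b) \<le> F S b"
  proof -
    define E0 where "E0 = mset_set ((\<lambda>s. (z, s, z)) ` S)"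
    have "(\<lambda>s. (z, s, z)) ` S \<subseteq> set_mset E" using z(2) by auto
    then have "E0 \<subseteq># E" unfolding E0_def
      by (meson finite_set_mset msubset_mset_set_iff mset_set_set_mset_msubset finite_subset subset_mset.order_trans)
    then obtain E2 where E2: "E = E0 + E2" by (auto simp: subset_mset.le_iff_add)
    have "0 \<le> (\<Sum>(v, g, w)\<in>#E2. I b (act g b))"
      using VE(1) b E2 by (intro sum_I_nonneg[of E2 V "\<lambda>_. b"]) (auto simp: admissible_def graph_def)
    moreover have "(\<Sum>(v, g, w)\<in>#E0. I b (act g b)) = (\<Sum>s\<in>S. I b (act s b))"
      unfolding E0_def sum_unfold_sum_mset[symmetric]
      by (subst sum.reindex) (auto simp: inj_on_def)
    ultimately show ?thesis unfolding bethe_def F_def z(1) E2 by simp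
  qed
  finally show ?thesis by simp
qed

end

section \<open>Shannon entropy of countable partitions\<close>

text \<open>An enumeration of \<open>A\<close> exhausts the sum by finite subsets. This links
  unordered sums, which are suprema of finite ones, to integrals.\<close>

lemma nn_integral_count_space_eq_SUP_sum:
  fixes f :: "'i \<Rightarrow> ennreal"
  assumes "countable A"
  shows "(\<integral>\<^sup>+x. f x \<partial>count_space A) = (SUP F\<in>{F. finite F \<and> F \<subseteq> A}. sum f F)"
proof (rule antisym)
  show "(SUP F\<in>{F. finite F \<and> F \<subseteq> A}. sum f F) \<le> (\<integral>\<^sup>+x. f x \<partial>count_space A)"
  proof (rule SUP_least)
    fix F assume "F \<in> {F. finite F \<and> F \<subseteq> A}"
    then have F: "finite F" "F \<subseteq> A" by auto
    have "sum f F = (\<integral>\<^sup>+x. f x \<partial>count_space F)"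
      using F by (simp add: nn_integral_count_space_finite)
    also have "\<dots> = (\<integral>\<^sup>+x. f x * indicator F x \<partial>count_space A)"
      using F(2) by (simp add: nn_integral_count_space_indicator mult.assoc)
        (auto intro!: nn_integral_cong split: split_indicator)
    also have "\<dots> \<le> (\<integral>\<^sup>+x. f x \<partial>count_space A)"
      by (auto intro!: nn_integral_mono split: split_indicator)
    finally show "sum f F \<le> (\<integral>\<^sup>+x. f x \<partial>count_space A)" .
  qed
next
  show "(\<integral>\<^sup>+x. f x \<partial>count_space A) \<le> (SUP F\<in>{F. finite F \<and> F \<subseteq> A}. sum f F)"
  proof (cases "finite A")
    case True
    then show ?thesis by (auto simp: nn_integral_count_space_finite intro!: SUP_upper)
  next
    case False
    let ?e = "from_nat_into A"
    have e: "bij_betw ?e UNIV A"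
      using bij_betw_from_nat_into[OF assms False] .
    have "(\<integral>\<^sup>+x. f x \<partial>count_space A) = (\<integral>\<^sup>+n. f (?e n) \<partial>count_space UNIV)"
      using e by (rule nn_integral_bij_count_space[symmetric])
    also have "\<dots> = (\<Sum>n. f (?e n))"
      by (simp add: nn_integral_count_space_nat)
    also have "\<dots> = (SUP n. \<Sum>i<n. f (?e i))"
      by (simp add: suminf_eq_SUP)
    also have "\<dots> \<le> (SUP F\<in>{F. finite F \<and> F \<subseteq> A}. sum f F)"
    proof (rule SUP_least)
      fix n
      have "(\<Sum>i<n. f (?e i)) = sum f (?e ` {..<n})"
        using e by (subst sum.reindex) (auto simp: bij_betw_def intro: inj_on_subset)
      also have "\<dots> \<le> (SUP F\<in>{F. finite F \<and> F \<subseteq> A}. sum f F)"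
        using e by (intro SUP_upper) (auto simp: bij_betw_def)
      finally show "(\<Sum>i<n. f (?e i)) \<le> (SUP F\<in>{F. finite F \<and> F \<subseteq> A}. sum f F)" .
    qed
    finally show ?thesis .
  qed
qed

text \<open>Turns the entropy sum into a nonnegative integral, for which sums and integrals can be
  exchanged freely.\<close>

lemma infsum_ereal_eq_nn_integral:
  fixes f :: "'i \<Rightarrow> real"
  assumes "countable A" "\<And>x. x \<in> A \<Longrightarrow> 0 \<le> f x"
  shows "(\<Sum>\<^sub>\<infinity>x\<in>A. ereal (f x)) = enn2ereal (\<integral>\<^sup>+x. ennreal (f x) \<partial>count_space A)"
proof -
  have "(\<Sum>\<^sub>\<infinity>x\<in>A. ereal (f x)) = infsum (enn2ereal \<circ> (\<lambda>x. ennreal (f x))) A"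
    using assms(2) by (intro infsum_cong) (simp add: enn2ereal_ennreal)
  also have "\<dots> = enn2ereal (infsum (\<lambda>x. ennreal (f x)) A)"
    by (rule infsum_comm_additive_general) (auto simp: continuous_at_enn2ereal intro: nonneg_summable_on_complete)
  also have "infsum (\<lambda>x. ennreal (f x)) A = (\<integral>\<^sup>+x. ennreal (f x) \<partial>count_space A)"
    using assms(1) by (simp add: nonneg_infsum_complete nn_integral_count_space_eq_SUP_sum)
  finally show ?thesis .
qed

text \<open>Prepares \<open>ln t \<le> t - 1\<close> for \<open>ennreal\<close>: every negative term
  has been moved to the other side because subtraction truncates there.\<close>

lemma sum_ennreal_le:
  assumes "p + q + 1 \<le> u + v + w" "0 \<le> p" "0 \<le> q" "0 \<le> u" "0 \<le> v" "0 \<le> w"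
  shows "ennreal p + ennreal q + 1 \<le> ennreal u + ennreal v + ennreal w"
proof -
  have "ennreal p + ennreal q + 1 = ennreal (p + q + 1)"
    using assms by simp
  also have "\<dots> \<le> ennreal (u + v + w)" using assms(1) by (rule ennreal_leI)
  finally show ?thesis using assms by simp
qed

section \<open>Atoms of a partition\<close>

definition cell :: "'x set set \<Rightarrow> 'x \<Rightarrow> 'x set" where
  "cell P x = (THE A. A \<in> P \<and> x \<in> A)"

lemma cell_eqI: "partition_on X P \<Longrightarrow> A \<in> P \<Longrightarrow> x \<in> A \<Longrightarrow> cell P x = A"
  unfolding cell_def by (rule the_equality) (auto dest: partition_onD2 disjointD)

lemma
  assumes "partition_on X P" "x \<in> X"
  shows cell_in: "cell P x \<in> P" and in_cell: "x \<in> cell P x"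
proof -
  obtain A where "A \<in> P" "x \<in> A" using assms by (auto dest: partition_onD1)
  then show "cell P x \<in> P" "x \<in> cell P x" using cell_eqI[OF assms(1)] by auto
qed

lemma refines_cell:
  assumes "refines X Q P" "x \<in> X"
  shows "cell Q x \<subseteq> cell P x"
proof -
  have Q: "partition_on X Q" and P: "partition_on X P" using assms(1) by (auto simp: refines_def)
  obtain B where B: "B \<in> P" "cell Q x \<subseteq> B"
    using assms(1) cell_in[OF Q assms(2)] unfolding refines_def by blast
  then have "cell P x = B" using in_cell[OF Q assms(2)] by (intro cell_eqI[OF P]) auto
  then show ?thesis using B by simp
qed

lemma refines_cell_eq:
  assumes "refines X Q P" "x \<in> X" "y \<in> cell Q x"
  shows "cell P y = cell P x"
  using assms refines_cell[OF assms(1,2)] cell_in[of X P x] by (intro cell_eqI[of X]) (auto simp: refines_def)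

text \<open>Intended for \<open>D\<close> inside a single atom of \<open>P\<close>; then the chosen
  representative is immaterial.\<close>

definition cell_of :: "'x set set \<Rightarrow> 'x set \<Rightarrow> 'x set" where
  "cell_of P D = cell P (SOME x. x \<in> D)"

lemma cell_of_cell:
  assumes "refines X Q P" "x \<in> X"
  shows "cell_of P (cell Q x) = cell P x"
proof -
  have "(SOME y. y \<in> cell Q x) \<in> cell Q x"
    using in_cell[of X Q x] assms by (auto simp: refines_def intro: someI)
  then show ?thesis unfolding cell_of_def using refines_cell_eq[OF assms] by simp
qed

lemma countable_partitionD:
  assumes "countable_partition M P"
  shows "countable P" "P \<subseteq> sets M" "partition_on (space M) P"
  using assms unfolding countable_partition_def by auto

text \<open>At each point exactly one summand \<open>h A * indicator A x\<close> survives;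
  exchanging the countable sum with the integral gives the weights
  \<open>emeasure M A\<close>.\<close>

lemma nn_integral_cell:
  fixes h :: "'x set \<Rightarrow> ennreal"
  assumes "countable_partition M P"
  shows "(\<integral>\<^sup>+x. h (cell P x) \<partial>M) = (\<integral>\<^sup>+A. h A * emeasure M A \<partial>count_space P)"
proof -
  note P = countable_partitionD[OF assms]
  have "h (cell P x) = (\<integral>\<^sup>+A. h A * indicator A x \<partial>count_space P)" if x: "x \<in> space M" for x
  proof -
    have "(\<integral>\<^sup>+A. h A * indicator A x \<partial>count_space P) = (\<Sum>A\<in>{cell P x}. h A * indicator A x)"
    proof (rule nn_integral_count_space')
      fix A assume "A \<in> P" "A \<notin> {cell P x}"
      then have "x \<notin> A" using cell_eqI[OF P(3), of A x] by auto
      then show "h A * indicator A x = 0" by simp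
    qed (use cell_in[OF P(3) x] in auto)
    also have "\<dots> = h (cell P x)"
      using in_cell[OF P(3) x] by simp
    finally show ?thesis ..
  qed
  then have "(\<integral>\<^sup>+x. h (cell P x) \<partial>M) = (\<integral>\<^sup>+x. \<integral>\<^sup>+A. h A * indicator A x \<partial>count_space P \<partial>M)"
    by (intro nn_integral_cong) simp
  also have "\<dots> = (\<integral>\<^sup>+A. \<integral>\<^sup>+x. h A * indicator A x \<partial>M \<partial>count_space P)"
    using P by (intro nn_integral_count_space_nn_integral) auto
  also have "\<dots> = (\<integral>\<^sup>+A. h A * emeasure M A \<partial>count_space P)"
    using P by (intro nn_integral_cong) (auto simp: nn_integral_cmult_indicator)
  finally show ?thesis .
qed

lemma borel_measurable_cell:
  fixes h :: "'x set \<Rightarrow> ennreal"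
  assumes "countable_partition M P"
  shows "(\<lambda>x. h (cell P x)) \<in> borel_measurable M"
proof -
  note P = countable_partitionD[OF assms]
  have "cell P \<in> M \<rightarrow>\<^sub>M count_space P"
  proof (subst measurable_count_space_eq_countable[OF P(1)], intro conjI ballI)
    show "cell P \<in> space M \<rightarrow> P" using cell_in[OF P(3)] by auto
    fix A assume A: "A \<in> P"
    then have "cell P -` {A} \<inter> space M = A"
      using cell_eqI[OF P(3)] in_cell[OF P(3)] partition_onD1[OF P(3)] by blast
    then show "cell P -` {A} \<inter> space M \<in> sets M" using A P by auto
  qed
  then show ?thesis by (rule measurable_compose) simp
qed

section \<open>The information function and its submodularity\<close>

context prob_space
begin

abbreviation cell_prob :: "'a set set \<Rightarrow> 'a \<Rightarrow> real" where
  "cell_prob P x \<equiv> prob (cell P x)"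

text \<open>The expectation of the information function, with infinite values allowed.\<close>

definition info :: "'a set set \<Rightarrow> ennreal" where
  "info P = (\<integral>\<^sup>+x. ennreal (- ln (cell_prob P x)) \<partial>M)"

lemma shannon_entropy_eq_info:
  assumes "countable_partition M P"
  shows "shannon_entropy M P = enn2ereal (info P)"
proof -
  note P = countable_partitionD[OF assms]
  have "shannon_entropy M P = enn2ereal (\<integral>\<^sup>+A. ennreal (- prob A * ln (prob A)) \<partial>count_space P)"
    unfolding shannon_entropy_def
  proof (rule infsum_ereal_eq_nn_integral[OF P(1)])
    fix A
    have "prob A * ln (prob A) \<le> 0"
      by (cases "prob A = 0") (auto simp: mult_le_0_iff ln_le_zero_iff less_le)
    then show "0 \<le> - prob A * ln (prob A)" by simp
  qed
  also have "(\<integral>\<^sup>+A. ennreal (- prob A * ln (prob A)) \<partial>count_space P) =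
      (\<integral>\<^sup>+A. ennreal (- ln (prob A)) * emeasure M A \<partial>count_space P)"
  proof (intro nn_integral_cong)
    fix A
    show "ennreal (- prob A * ln (prob A)) = ennreal (- ln (prob A)) * emeasure M A"
    proof (cases "prob A = 0")
      case False
      then have "0 \<le> - ln (prob A)" by (simp add: less_le)
      then show ?thesis
        by (simp add: emeasure_eq_measure ennreal_mult[symmetric] mult.commute)
    qed (simp add: emeasure_eq_measure)
  qed
  also have "\<dots> = info P"
    unfolding info_def using nn_integral_cell[OF assms, of "\<lambda>A. ennreal (- ln (prob A))"] by simp
  finally show ?thesis .
qed

text \<open>The null atoms are countably many, so together they form a null set. Logarithms and
  quotients of atom masses therefore behave well almost everywhere.\<close>

lemma AE_cell_prob_pos:
  assumes "countable_partition M P"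
  shows "AE x in M. 0 < cell_prob P x"
proof -
  let ?h = "\<lambda>A. if prob A = 0 then 1 else 0 :: ennreal"
  have "(\<integral>\<^sup>+x. ?h (cell P x) \<partial>M) = (\<integral>\<^sup>+A. 0 \<partial>count_space P)"
    unfolding nn_integral_cell[OF assms, where h = ?h]
    by (intro nn_integral_cong) (auto simp: emeasure_eq_measure)
  then have "AE x in M. ?h (cell P x) = 0"
    by (subst nn_integral_0_iff_AE[symmetric]) (intro borel_measurable_cell[OF assms, where h = ?h], simp)
  then show ?thesis by eventually_elim (auto simp: less_le split: if_splits)
qed

lemma cell_in_sets:
  "countable_partition M P \<Longrightarrow> x \<in> space M \<Longrightarrow> cell P x \<in> sets M"
  by (rule subsetD[OF countable_partitionD(2) cell_in[OF countable_partitionD(3)]])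

lemma info_mono:
  assumes "countable_partition M P" "countable_partition M Q" "refines (space M) Q P"
  shows "info P \<le> info Q"
  unfolding info_def
proof (rule nn_integral_mono_AE)
  show "AE x in M. ennreal (- ln (cell_prob P x)) \<le> ennreal (- ln (cell_prob Q x))"
    using AE_cell_prob_pos[OF assms(2)] AE_space
  proof eventually_elim
    case (elim x)
    have "cell_prob Q x \<le> cell_prob P x"
      using refines_cell[OF assms(3)] elim assms(1) by (intro finite_measure_mono cell_in_sets) auto
    then show ?case using elim by (intro ennreal_leI) simp
  qed
qed

text \<open>Summed over the atoms \<open>D\<close> of \<open>r\<close>, the mass of \<open>D\<close>
  cancels and leaves \<open>prob A * prob B / prob C\<close> for the surrounding atoms of
  \<open>a\<close>, \<open>b\<close> and \<open>c\<close>. By injectivity this is at most the sum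
  over all pairs \<open>(A, B)\<close> inside a common \<open>C\<close>, and summing over
  \<open>B\<close> first leaves at most the mass of \<open>A\<close>.\<close>

lemma nn_integral_cell_prob_ratio:
  assumes abc: "countable_partition M a" "countable_partition M b" "countable_partition M c"
    and r: "countable_partition M r" "refines (space M) r a" "refines (space M) r b"
    and ac: "refines (space M) a c" and bc: "refines (space M) b c"
    and inj: "\<And>D D'. D \<in> r \<Longrightarrow> D' \<in> r \<Longrightarrow> cell_of a D = cell_of a D' \<Longrightarrow> cell_of b D = cell_of b D' \<Longrightarrow> D = D'"
  shows "(\<integral>\<^sup>+x. ennreal (cell_prob a x * cell_prob b x / (cell_prob r x * cell_prob c x)) \<partial>M) \<le> 1"
proof -
  note a = countable_partitionD[OF abc(1)] and b = countable_partitionD[OF abc(2)]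
    and c = countable_partitionD[OF abc(3)] and rp = countable_partitionD[OF r(1)]
  have rc: "refines (space M) r c" using r ac refines_trans by blast
  \<comment> \<open>The weight under which \<open>a\<close> and \<open>b\<close> are conditionally
    independent given \<open>c\<close>; it vanishes unless \<open>A\<close> and \<open>B\<close> lie
    in the same atom of \<open>c\<close>.\<close>
  define \<psi> :: "'a set \<times> 'a set \<Rightarrow> ennreal" where
    "\<psi> = (\<lambda>(A, B). if A \<in> a \<and> B \<in> b \<and> cell_of c A = cell_of c B
              then ennreal (prob A * prob B / prob (cell_of c A)) else 0)"
  have cellD: "\<exists>x\<in>space M. D = cell r x" if "D \<in> r" for D
  proof -
    have "D \<noteq> {}" "D \<subseteq> space M" using that rp(3) by (auto simp: partition_on_def)
    then obtain x where "x \<in> D" "x \<in> space M" by auto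
    then show ?thesis using cell_eqI[OF rp(3) that] by auto
  qed
  have "(\<integral>\<^sup>+x. ennreal (cell_prob a x * cell_prob b x / (cell_prob r x * cell_prob c x)) \<partial>M) =
      (\<integral>\<^sup>+x. ennreal (prob (cell_of a (cell r x)) * prob (cell_of b (cell r x)) /
        (cell_prob r x * prob (cell_of c (cell r x)))) \<partial>M)"
    using r rc by (intro nn_integral_cong) (simp add: cell_of_cell)
  also have "\<dots> = (\<integral>\<^sup>+D. ennreal (prob (cell_of a D) * prob (cell_of b D) /
        (prob D * prob (cell_of c D))) * emeasure M D \<partial>count_space r)"
    by (rule nn_integral_cell[OF r(1), where h = "\<lambda>D. ennreal (prob (cell_of a D) * prob (cell_of b D) /
        (prob D * prob (cell_of c D)))"])
  also have "\<dots> \<le> (\<integral>\<^sup>+D. \<psi> (cell_of a D, cell_of b D) \<partial>count_space r)"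
  proof (rule nn_integral_mono)
    fix D assume "D \<in> space (count_space r)"
    then obtain x where x: "x \<in> space M" "D = cell r x" using cellD by auto
    have [simp]: "cell_of a D = cell a x" "cell_of b D = cell b x" "cell_of c D = cell c x"
      using x r rc by (auto simp: cell_of_cell)
    have "\<psi> (cell_of a D, cell_of b D) = ennreal (prob (cell a x) * prob (cell b x) / prob (cell c x))"
      unfolding \<psi>_def using x ac bc r rc cell_in[OF a(3)] cell_in[OF b(3)] by (simp add: cell_of_cell)
    \<comment> \<open>An equality unless \<open>D\<close> is null, in which case the left side is
      \<open>0\<close>.\<close>
    moreover have "ennreal (prob (cell_of a D) * prob (cell_of b D) / (prob D * prob (cell_of c D))) * emeasure M D
        \<le> ennreal (prob (cell a x) * prob (cell b x) / prob (cell c x))"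
      by (cases "prob D = 0") (simp_all add: emeasure_eq_measure ennreal_mult[symmetric])
    ultimately show "ennreal (prob (cell_of a D) * prob (cell_of b D) / (prob D * prob (cell_of c D))) * emeasure M D
        \<le> \<psi> (cell_of a D, cell_of b D)" by simp
  qed
  \<comment> \<open>By \<open>inj\<close> each pair of atoms is met at most once.\<close>
  also have "\<dots> = (\<integral>\<^sup>+p. \<psi> p \<partial>count_space ((\<lambda>D. (cell_of a D, cell_of b D)) ` r))"
    using inj by (intro nn_integral_bij_count_space inj_on_imp_bij_betw) (auto intro!: inj_onI)
  also have "\<dots> \<le> (\<integral>\<^sup>+p. \<psi> p \<partial>count_space UNIV)"
    by (subst nn_integral_count_space_indicator) (auto intro!: nn_integral_mono split: split_indicator)
  also have "\<dots> = (\<integral>\<^sup>+A. \<integral>\<^sup>+B. \<psi> (A, B) \<partial>count_space UNIV \<partial>count_space UNIV)"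
    by (rule nn_integral_fst_count_space[symmetric])
  also have "\<dots> \<le> (\<integral>\<^sup>+A. emeasure M A * indicator a A \<partial>count_space UNIV)"
  proof (rule nn_integral_mono)
    fix A
    show "(\<integral>\<^sup>+B. \<psi> (A, B) \<partial>count_space UNIV) \<le> emeasure M A * indicator a A"
    proof (cases "A \<in> a")
      case True
      let ?C = "cell_of c A"
      have "A \<noteq> {}" "A \<subseteq> space M" using True a(3) by (auto simp: partition_on_def)
      then obtain y where y: "y \<in> A" "y \<in> space M" by auto
      then have "A = cell a y" using cell_eqI[OF a(3) True] by auto
      then have C: "?C = cell c y" using cell_of_cell[OF ac y(2)] by simp
      have "(\<integral>\<^sup>+B. \<psi> (A, B) \<partial>count_space UNIV) =
          (\<integral>\<^sup>+B. \<psi> (A, B) * indicator b B \<partial>count_space UNIV)"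
        unfolding \<psi>_def by (intro nn_integral_cong) (auto split: split_indicator)
      also have "\<dots> = (\<integral>\<^sup>+B. \<psi> (A, B) \<partial>count_space b)"
        by (simp add: nn_integral_count_space_indicator)
      also have "\<dots> = (\<integral>\<^sup>+B. (ennreal (prob A / prob ?C) * (if cell_of c B = ?C then 1 else 0)) * emeasure M B \<partial>count_space b)"
        unfolding \<psi>_def using True
        by (intro nn_integral_cong) (auto simp: emeasure_eq_measure ennreal_mult[symmetric])
      also have "\<dots> = (\<integral>\<^sup>+x. ennreal (prob A / prob ?C) * (if cell_of c (cell b x) = ?C then 1 else 0) \<partial>M)"
        by (rule nn_integral_cell[OF abc(2), symmetric])
      also have "\<dots> = (\<integral>\<^sup>+x. ennreal (prob A / prob ?C) * indicator ?C x \<partial>M)"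
      proof (rule nn_integral_cong)
        fix x assume x: "x \<in> space M"
        have "cell_of c (cell b x) = cell c x" using cell_of_cell[OF bc x] .
        moreover have "cell c x = cell c y \<longleftrightarrow> x \<in> cell c y"
          using in_cell[OF c(3) x] cell_eqI[OF c(3) cell_in[OF c(3) y(2)]] by auto
        ultimately show "ennreal (prob A / prob ?C) * (if cell_of c (cell b x) = ?C then 1 else 0) =
            ennreal (prob A / prob ?C) * indicator ?C x"
          unfolding C by (auto split: split_indicator)
      qed
      also have "\<dots> = ennreal (prob A / prob ?C) * emeasure M ?C"
        using cell_in_sets[OF abc(3) y(2)] C by (simp add: nn_integral_cmult_indicator)
      also have "\<dots> \<le> emeasure M A"
        by (cases "prob ?C = 0") (simp_all add: emeasure_eq_measure ennreal_mult[symmetric])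
      finally show ?thesis using True by simp
    next
      case False
      then show ?thesis unfolding \<psi>_def by simp
    qed
  qed
  also have "\<dots> = (\<integral>\<^sup>+A. 1 * emeasure M A \<partial>count_space a)"
    by (simp add: nn_integral_count_space_indicator)
  also have "\<dots> = (\<integral>\<^sup>+x. 1 \<partial>M)"
    by (rule nn_integral_cell[OF abc(1), symmetric])
  also have "\<dots> = 1" by (simp add: emeasure_space_1)
  finally show ?thesis .
qed

text \<open>Gibbs' inequality: \<open>ln t \<le> t - 1\<close> is integrated for the ratio
  \<open>t\<close> of \<open>nn_integral_cell_prob_ratio\<close>, whose expectation is at most
  \<open>1\<close>. The \<open>1\<close> is carried along on both sides and cancelled at the end, so
  nothing is ever subtracted in \<open>ennreal\<close>.\<close>

lemma info_submodular:
  assumes abc: "countable_partition M a" "countable_partition M b" "countable_partition M c"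
    and r: "countable_partition M r" "refines (space M) r a" "refines (space M) r b"
    and ac: "refines (space M) a c" and bc: "refines (space M) b c"
    and inj: "\<And>D D'. D \<in> r \<Longrightarrow> D' \<in> r \<Longrightarrow> cell_of a D = cell_of a D' \<Longrightarrow> cell_of b D = cell_of b D' \<Longrightarrow> D = D'"
  shows "info r + info c \<le> info a + info b"
proof -
  let ?t = "\<lambda>x. cell_prob a x * cell_prob b x / (cell_prob r x * cell_prob c x)"
  have meas: "(\<lambda>x. ennreal (- ln (cell_prob P x))) \<in> borel_measurable M" if "countable_partition M P" for P
    using borel_measurable_cell[OF that, of "\<lambda>A. ennreal (- ln (prob A))"] .
  have measr: "(\<lambda>x. cell_prob P x) \<in> borel_measurable M" if "countable_partition M P" for P
    using borel_measurable_enn2real[OF borel_measurable_cell[OF that, of "\<lambda>A. ennreal (prob A)"]] by simp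
  note [measurable] = meas[OF abc(1)] meas[OF abc(2)] meas[OF abc(3)] meas[OF r(1)]
    measr[OF abc(1)] measr[OF abc(2)] measr[OF abc(3)] measr[OF r(1)]
  have "info r + info c + 1 = (\<integral>\<^sup>+x. ennreal (- ln (cell_prob r x)) + ennreal (- ln (cell_prob c x)) + 1 \<partial>M)"
    unfolding info_def by (simp add: nn_integral_add emeasure_space_1)
  also have "\<dots> \<le> (\<integral>\<^sup>+x. ennreal (- ln (cell_prob a x)) + ennreal (- ln (cell_prob b x)) + ennreal (?t x) \<partial>M)"
  proof (rule nn_integral_mono_AE)
    show "AE x in M. ennreal (- ln (cell_prob r x)) + ennreal (- ln (cell_prob c x)) + 1
        \<le> ennreal (- ln (cell_prob a x)) + ennreal (- ln (cell_prob b x)) + ennreal (?t x)"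
      using AE_cell_prob_pos[OF abc(1)] AE_cell_prob_pos[OF abc(2)] AE_cell_prob_pos[OF abc(3)]
        AE_cell_prob_pos[OF r(1)]
    proof eventually_elim
      case (elim x)
      have "ln (?t x) \<le> ?t x - 1"
        using elim by (intro ln_le_minus_one) auto
      moreover have "ln (?t x) = ln (cell_prob a x) + ln (cell_prob b x) - (ln (cell_prob r x) + ln (cell_prob c x))"
        using elim by (simp add: ln_div ln_mult)
      ultimately have "- ln (cell_prob r x) + - ln (cell_prob c x) + 1
          \<le> - ln (cell_prob a x) + - ln (cell_prob b x) + ?t x"
        by simp
      moreover have "0 \<le> - ln (cell_prob P x)" if "0 < cell_prob P x" for P
        using that by simp
      ultimately show ?case
        using elim by (intro sum_ennreal_le) auto
    qed
  qed
  also have "\<dots> = info a + info b + (\<integral>\<^sup>+x. ennreal (?t x) \<partial>M)"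
    unfolding info_def by (simp add: nn_integral_add)
  also have "\<dots> \<le> info a + info b + 1"
    using nn_integral_cell_prob_ratio[OF assms] by (intro add_left_mono)
  finally show ?thesis
    by (simp add: add.commute[of _ 1] ennreal_add_left_cancel_le)
qed

end

section \<open>Partitions of finite entropy as an entropy lattice\<close>

definition finite_entropy_partitions :: "'x measure \<Rightarrow> 'x set set set" where
  "finite_entropy_partitions M = {P. countable_partition M P \<and> shannon_entropy M P < \<infinity>}"

text \<open>The order runs from coarse to fine, so that the common refinement is a least upper
  bound.\<close>

definition coarser :: "'x measure \<Rightarrow> 'x set set \<Rightarrow> 'x set set \<Rightarrow> bool" where
  "coarser M P Q \<longleftrightarrow> refines (space M) Q P"

definition real_entropy :: "'x measure \<Rightarrow> 'x set set \<Rightarrow> real" where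
  "real_entropy M P = real_of_ereal (shannon_entropy M P)"

lemma countable_partition_common_refinement:
  assumes X: "finite X" "X \<noteq> {}" and P: "\<And>P. P \<in> X \<Longrightarrow> countable_partition M P"
  shows "countable_partition M (common_refinement X)"
  unfolding countable_partition_def
proof (intro conjI)
  have "countable (\<Pi>\<^sub>E P\<in>X. P)"
    using X P by (intro countable_PiE) (auto simp: countable_partition_def)
  then show "countable (common_refinement X)"
    unfolding common_refinement_def by (intro countable_Diff countable_UN) auto
  show "common_refinement X \<subseteq> sets M"
  proof
    fix D assume "D \<in> common_refinement X"
    then obtain f where f: "f \<in> (\<Pi>\<^sub>E P\<in>X. P)" "D = \<Inter> (f ` X)"
      unfolding common_refinement_def by auto
    have "f P \<in> sets M" if "P \<in> X" for P
      using f(1) that P[OF that] by (auto simp: countable_partition_def PiE_def Pi_def)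
    then show "D \<in> sets M" unfolding f(2) using X by (intro sets.finite_INT) auto
  qed
  show "partition_on (space M) (common_refinement X)"
    using X P by (intro partition_on_common_refinement) (auto simp: countable_partition_def)
qed

text \<open>Allows induction over finite joins with the binary inequality for entropy.\<close>

lemma common_refinement_insert:
  assumes X: "finite X" "X \<noteq> {}" and P: "\<And>P. P \<in> insert Q X \<Longrightarrow> partition_on A P"
  shows "common_refinement (insert Q X) = common_refinement {Q, common_refinement X}"
proof (rule refines_asym)
  have X': "partition_on A (common_refinement X)"
    using X P by (intro partition_on_common_refinement) auto
  have 1: "partition_on A (common_refinement (insert Q X))"
    using P by (intro partition_on_common_refinement) auto
  have 2: "partition_on A (common_refinement {Q, common_refinement X})"
    using P X' by (intro partition_on_common_refinement) auto
  show "refines A (common_refinement (insert Q X)) (common_refinement {Q, common_refinement X})"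
  proof (rule common_refinement_coarsest)
    fix R assume "R \<in> {Q, common_refinement X}"
    then show "refines A (common_refinement (insert Q X)) R"
    proof (elim insertE)
      assume "R = Q"
      then show ?thesis using P by (intro refines_common_refinement) auto
    next
      assume R: "R = common_refinement X"
      have "refines A (common_refinement (insert Q X)) S" if "S \<in> X" for S
        using P that by (intro refines_common_refinement) auto
      then show ?thesis unfolding R using P X 1 by (intro common_refinement_coarsest) auto
    qed simp
  qed (use P X' 1 in auto)
  show "refines A (common_refinement {Q, common_refinement X}) (common_refinement (insert Q X))"
  proof (rule common_refinement_coarsest)
    fix R assume "R \<in> insert Q X"
    then show "refines A (common_refinement {Q, common_refinement X}) R"
    proof
      assume "R = Q"
      then show ?thesis using P X' by (intro refines_common_refinement) auto
    next
      assume R: "R \<in> X"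
      have "refines A (common_refinement {Q, common_refinement X}) (common_refinement X)"
        using P X' by (intro refines_common_refinement) auto
      moreover have "refines A (common_refinement X) R"
        using P R by (intro refines_common_refinement) auto
      ultimately show ?thesis by (rule refines_trans)
    qed
  qed (use P 2 in auto)
qed

text \<open>Supplies the injectivity asked by \<open>info_submodular\<close>: equal pairs of
  surrounding atoms force equal atoms of the join.\<close>

lemma common_refinement_pair_cells:
  assumes "partition_on X a" "partition_on X b" "D \<in> common_refinement {a, b}"
  shows "D = cell_of a D \<inter> cell_of b D"
proof -
  obtain f where f: "f \<in> (\<Pi>\<^sub>E P\<in>{a, b}. P)" "D = \<Inter> (f ` {a, b})" "D \<noteq> {}"
    using assms(3) unfolding common_refinement_def by auto
  then have D: "D = f a \<inter> f b" "f a \<in> a" "f b \<in> b" by auto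
  have "(SOME x. x \<in> D) \<in> D" using f(3) by (simp add: some_in_eq)
  then have "cell_of a D = f a" "cell_of b D = f b"
    unfolding cell_of_def using D cell_eqI[OF assms(1)] cell_eqI[OF assms(2)] by auto
  then show ?thesis using D by simp
qed

context prob_space
begin

lemma info_common_refinement:
  assumes "countable_partition M a" "countable_partition M b" "countable_partition M c"
    "refines (space M) a c" "refines (space M) b c"
  shows "info (common_refinement {a, b}) + info c \<le> info a + info b"
proof -
  have ab: "P \<in> {a, b} \<Longrightarrow> partition_on (space M) P" for P
    using assms countable_partitionD(3) by auto
  have "countable_partition M (common_refinement {a, b})"
    using assms by (intro countable_partition_common_refinement) auto
  moreover have "refines (space M) (common_refinement {a, b}) a" "refines (space M) (common_refinement {a, b}) b"
    using ab by (auto intro: refines_common_refinement)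
  moreover have "D = D'" if "D \<in> common_refinement {a, b}" "D' \<in> common_refinement {a, b}"
    "cell_of a D = cell_of a D'" "cell_of b D = cell_of b D'" for D D'
    using that common_refinement_pair_cells[OF ab[of a] ab[of b]] by (metis insertI1 insert_commute)
  ultimately show ?thesis using assms by (intro info_submodular)
qed

lemma countable_partition_trivial: "countable_partition M {space M}"
  unfolding countable_partition_def using not_empty by (auto intro: partition_on_space)

lemma refines_trivial: "partition_on (space M) P \<Longrightarrow> refines (space M) P {space M}"
  unfolding refines_def using not_empty partition_on_space
  by (auto simp: partition_on_def)

lemma info_trivial: "info {space M} = 0"
proof -
  have "info {space M} = (\<integral>\<^sup>+x. 0 \<partial>M)"
    unfolding info_def
  proof (rule nn_integral_cong)
    fix x assume "x \<in> space M"
    then have "cell {space M} x = space M"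
      using cell_eqI[OF countable_partitionD(3)[OF countable_partition_trivial]] by simp
    then show "ennreal (- ln (cell_prob {space M} x)) = 0" by (simp add: prob_space)
  qed
  then show ?thesis by simp
qed

lemma finite_entropy_iff:
  "P \<in> finite_entropy_partitions M \<longleftrightarrow> countable_partition M P \<and> info P < \<top>"
proof -
  have "enn2ereal (info P) < \<infinity> \<longleftrightarrow> info P < \<top>"
    by (metis enn2ereal_eq_top_iff infinity_ereal_def less_top top_ereal_def)
  then show ?thesis
    unfolding finite_entropy_partitions_def
    by (cases "countable_partition M P") (simp_all add: shannon_entropy_eq_info)
qed

lemma shannon_entropy_nonneg: "countable_partition M P \<Longrightarrow> 0 \<le> shannon_entropy M P"
  by (simp add: shannon_entropy_eq_info)

lemma ereal_real_entropy:
  "P \<in> finite_entropy_partitions M \<Longrightarrow> ereal (real_entropy M P) = shannon_entropy M P"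
  unfolding real_entropy_def using shannon_entropy_nonneg[of P]
  by (auto simp: finite_entropy_partitions_def ereal_real)

lemma real_entropy_info:
  "countable_partition M P \<Longrightarrow> real_entropy M P = enn2real (info P)"
  unfolding real_entropy_def by (simp add: shannon_entropy_eq_info)

lemma info_real_entropy:
  "P \<in> finite_entropy_partitions M \<Longrightarrow> info P = ennreal (real_entropy M P)"
  by (simp add: finite_entropy_iff real_entropy_info)

lemma real_entropy_nonneg: "countable_partition M P \<Longrightarrow> 0 \<le> real_entropy M P"
  by (simp add: real_entropy_info)

text \<open>Subadditivity, that is \<open>info_common_refinement\<close> over the trivial partition,
  keeps the entropy of a finite join finite.\<close>

lemma common_refinement_closed:
  assumes "finite X" "X \<noteq> {}" "X \<subseteq> finite_entropy_partitions M"
  shows "common_refinement X \<in> finite_entropy_partitions M"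
  using assms
proof (induction rule: finite_ne_induct)
  case (singleton P)
  then have P: "partition_on (space M) P" "P \<in> finite_entropy_partitions M"
    by (auto simp: finite_entropy_partitions_def countable_partition_def)
  then have "refines (space M) P (common_refinement {P})" "refines (space M) (common_refinement {P}) P"
    by (auto intro!: common_refinement_coarsest refines_common_refinement refines_refl)
  then have "common_refinement {P} = P" by (rule refines_asym[rotated])
  then show ?case using P by simp
next
  case (insert Q X)
  have Q: "countable_partition M Q" "info Q < \<top>"
    using insert by (auto simp: finite_entropy_iff)
  have X: "countable_partition M (common_refinement X)" "info (common_refinement X) < \<top>"
    using insert by (auto simp: finite_entropy_iff)
  have eq: "common_refinement (insert Q X) = common_refinement {Q, common_refinement X}"
    using insert by (intro common_refinement_insert[of _ _ "space M"])
      (auto simp: finite_entropy_partitions_def countable_partition_def)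
  have "info (common_refinement {Q, common_refinement X}) + info {space M} \<le> info Q + info (common_refinement X)"
    using Q X countable_partitionD(3) by (intro info_common_refinement refines_trivial countable_partition_trivial)
  then have "info (common_refinement {Q, common_refinement X}) < \<top>"
    using Q X by (auto simp: info_trivial intro: le_less_trans)
  then show ?case unfolding eq finite_entropy_iff
    using Q X by (auto intro: countable_partition_common_refinement)
qed

lemma entropy_lattice_partitions:
  "entropy_lattice (finite_entropy_partitions M) (coarser M) common_refinement (real_entropy M) {space M}"
proof
  have part: "partition_on (space M) P" "countable_partition M P" if "P \<in> finite_entropy_partitions M" for P
    using that by (auto simp: finite_entropy_partitions_def countable_partition_def)
  show "coarser M a a" if "a \<in> finite_entropy_partitions M" for a
    using part[OF that] by (simp add: coarser_def refines_refl)
  show "coarser M a c" if "coarser M a b" "coarser M b c" for a b c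
    using that unfolding coarser_def by (rule refines_trans[rotated])
  show "a = b" if "coarser M a b" "coarser M b a" for a b
    using that unfolding coarser_def by (rule refines_asym[rotated])
  show "coarser M a (common_refinement X)" if "finite X" "X \<subseteq> finite_entropy_partitions M" "a \<in> X" for X a
    unfolding coarser_def using that part by (intro refines_common_refinement) auto
  show "coarser M (common_refinement X) c"
    if "finite X" "X \<noteq> {}" "X \<subseteq> finite_entropy_partitions M" "c \<in> finite_entropy_partitions M"
      "\<And>a. a \<in> X \<Longrightarrow> coarser M a c" for X c
    using that part unfolding coarser_def by (intro common_refinement_coarsest) auto
  show "{space M} \<in> finite_entropy_partitions M"
    by (simp add: finite_entropy_iff countable_partition_trivial info_trivial)
  show "coarser M {space M} a" if "a \<in> finite_entropy_partitions M" for a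
    using part[OF that] by (simp add: coarser_def refines_trivial)
  show "real_entropy M {space M} = 0"
    by (simp add: real_entropy_info countable_partition_trivial info_trivial)
  show "real_entropy M a \<le> real_entropy M b"
    if "a \<in> finite_entropy_partitions M" "b \<in> finite_entropy_partitions M" "coarser M a b" for a b
    using info_mono[of a b] that part info_real_entropy real_entropy_nonneg unfolding coarser_def by simp
  show "real_entropy M (common_refinement {a, b}) + real_entropy M c \<le> real_entropy M a + real_entropy M b"
    if "a \<in> finite_entropy_partitions M" "b \<in> finite_entropy_partitions M" "c \<in> finite_entropy_partitions M"
      "coarser M c a" "coarser M c b" for a b c
  proof -
    have "common_refinement {a, b} \<in> finite_entropy_partitions M"
      using that by (intro common_refinement_closed) auto
    moreover have "info (common_refinement {a, b}) + info c \<le> info a + info b"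
      using that part unfolding coarser_def by (intro info_common_refinement)
    ultimately show ?thesis
      using that part by (simp add: info_real_entropy real_entropy_nonneg ennreal_plus[symmetric] del: ennreal_plus)
  qed
qed (rule common_refinement_closed)

end

text \<open>An image under \<open>\<phi> g\<close> is a preimage under the inverse element, which
  gives measurability and the same measure. Atoms thus keep their masses, and the entropy sum is
  merely reindexed.\<close>

lemma entropy_action_partitions:
  assumes prob: "prob_space M" and act: "pmp_action G M \<phi>"
  shows "entropy_action (finite_entropy_partitions M) (coarser M) common_refinement (real_entropy M) {space M}
     G (translate \<phi>)"
proof -
  interpret prob_space M by fact
  interpret group_action G "space M" \<phi> using act by (simp add: pmp_action_def)
  interpret group G using group_hom by (simp add: group_hom_def)
  interpret entropy_lattice "finite_entropy_partitions M" "coarser M" common_refinement "real_entropy M" "{space M}"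
    by (rule entropy_lattice_partitions)
  have meas: "\<phi> g \<in> M \<rightarrow>\<^sub>M M" "distr M M (\<phi> g) = M" if "g \<in> carrier G" for g
    using act that by (auto simp: pmp_action_def)
  have inv: "\<phi> (inv\<^bsub>G\<^esub> g) (\<phi> g x) = x" "\<phi> g (\<phi> (inv\<^bsub>G\<^esub> g) x) = x" if "g \<in> carrier G" "x \<in> space M" for g x
  proof -
    have one: "\<phi> \<one>\<^bsub>G\<^esub> x = x" using id_eq_one that by (metis restrict_apply')
    show "\<phi> (inv\<^bsub>G\<^esub> g) (\<phi> g x) = x" "\<phi> g (\<phi> (inv\<^bsub>G\<^esub> g) x) = x"
      using that one composition_rule[of x "inv\<^bsub>G\<^esub> g" g] composition_rule[of x g "inv\<^bsub>G\<^esub> g"] by auto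
  qed
  have in_space: "\<phi> g x \<in> space M" if "g \<in> carrier G" "x \<in> space M" for g x
    using meas(1)[OF that(1)] that(2) by (rule measurable_space)
  have image: "\<phi> g ` A = \<phi> (inv\<^bsub>G\<^esub> g) -` A \<inter> space M" if "g \<in> carrier G" "A \<subseteq> space M" for g A
  proof (intro equalityI subsetI)
    fix y assume "y \<in> \<phi> g ` A"
    then show "y \<in> \<phi> (inv\<^bsub>G\<^esub> g) -` A \<inter> space M"
      using that inv(1)[OF that(1)] in_space[OF that(1)] by auto
  next
    fix y assume y: "y \<in> \<phi> (inv\<^bsub>G\<^esub> g) -` A \<inter> space M"
    then show "y \<in> \<phi> g ` A" using inv(2)[OF that(1), of y] by (intro image_eqI[of _ _ "\<phi> (inv\<^bsub>G\<^esub> g) y"]) auto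
  qed
  have sets: "\<phi> g ` A \<in> sets M" if "g \<in> carrier G" "A \<in> sets M" for g A
    unfolding image[OF that(1) sets.sets_into_space[OF that(2)]]
    using meas(1)[of "inv\<^bsub>G\<^esub> g"] that by (auto intro: measurable_sets)
  have measure: "measure M (\<phi> g ` A) = measure M A" if "g \<in> carrier G" "A \<in> sets M" for g A
  proof -
    have "measure M A = measure (distr M M (\<phi> (inv\<^bsub>G\<^esub> g))) A"
      using meas(2)[of "inv\<^bsub>G\<^esub> g"] that by simp
    also have "\<dots> = measure M (\<phi> (inv\<^bsub>G\<^esub> g) -` A \<inter> space M)"
      using meas(1)[of "inv\<^bsub>G\<^esub> g"] that by (intro measure_distr) auto
    finally show ?thesis using image[OF that(1) sets.sets_into_space[OF that(2)]] by simp
  qed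
  have part: "countable_partition M (translate \<phi> g P)" if g: "g \<in> carrier G" and P: "countable_partition M P" for g P
    unfolding countable_partition_def translate_def
  proof (intro conjI)
    note P' = countable_partitionD[OF P]
    show "countable ((`) (\<phi> g) ` P)" using P' by auto
    show "(`) (\<phi> g) ` P \<subseteq> sets M" using P' sets[OF g] by auto
    have "partition_on (\<phi> g ` space M) ((`) (\<phi> g) ` P - {{}})"
      using P'(3) inj_prop[OF g] by (rule partition_on_inj_image)
    moreover have "(`) (\<phi> g) ` P - {{}} = (`) (\<phi> g) ` P"
      using partition_onD3[OF P'(3)] by auto
    ultimately show "partition_on (space M) ((`) (\<phi> g) ` P)"
      using surj_prop[OF g] by simp
  qed
  have entropy: "shannon_entropy M (translate \<phi> g P) = shannon_entropy M P"
    if g: "g \<in> carrier G" and P: "countable_partition M P" for g P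
  proof -
    have "inj_on ((`) (\<phi> g)) P"
    proof (rule inj_onI)
      fix A B assume "A \<in> P" "B \<in> P" and eq: "\<phi> g ` A = \<phi> g ` B"
      then have "A \<subseteq> space M" "B \<subseteq> space M"
        using P by (auto simp: countable_partition_def dest: sets.sets_into_space)
      then show "A = B" using inj_on_image_eq_iff[OF inj_prop[OF g]] eq by blast
    qed
    then have "shannon_entropy M (translate \<phi> g P) =
        (\<Sum>\<^sub>\<infinity>A\<in>P. ereal (- measure M (\<phi> g ` A) * ln (measure M (\<phi> g ` A))))"
      unfolding shannon_entropy_def translate_def by (subst infsum_reindex) (auto simp: comp_def)
    also have "\<dots> = shannon_entropy M P"
      unfolding shannon_entropy_def
    proof (rule infsum_cong)
      fix A assume "A \<in> P"
      then have "A \<in> sets M" using P by (auto simp: countable_partition_def)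
      then show "ereal (- measure M (\<phi> g ` A) * ln (measure M (\<phi> g ` A))) = ereal (- measure M A * ln (measure M A))"
        using measure[OF g] by simp
    qed
    finally show ?thesis .
  qed
  have sub: "A \<subseteq> space M" if "P \<in> finite_entropy_partitions M" "A \<in> P" for P A
    using that sets.sets_into_space by (auto simp: finite_entropy_partitions_def countable_partition_def)
  show ?thesis
  proof
    show "translate \<phi> g a \<in> finite_entropy_partitions M"
      if "g \<in> carrier G" "a \<in> finite_entropy_partitions M" for g a
      using that part entropy by (auto simp: finite_entropy_partitions_def)
    show "coarser M (translate \<phi> g a) (translate \<phi> g b)"
      if "g \<in> carrier G" "a \<in> finite_entropy_partitions M" "b \<in> finite_entropy_partitions M" "coarser M a b" for g a b
    proof -
      have "\<exists>Y\<in>translate \<phi> g a. X \<subseteq> Y" if X: "X \<in> translate \<phi> g b" for X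
      proof -
        obtain B where "B \<in> b" "X = \<phi> g ` B" using X by (auto simp: translate_def)
        moreover from this obtain A where "A \<in> a" "B \<subseteq> A"
          using \<open>coarser M a b\<close> unfolding coarser_def refines_def by blast
        ultimately show ?thesis unfolding translate_def by blast
      qed
      then show ?thesis
        using part that unfolding coarser_def refines_def
        by (auto simp: finite_entropy_partitions_def countable_partition_def)
    qed
    show "translate \<phi> g (translate \<phi> h a) = translate \<phi> (g \<otimes>\<^bsub>G\<^esub> h) a"
      if "g \<in> carrier G" "h \<in> carrier G" "a \<in> finite_entropy_partitions M" for g h a
    proof -
      have "\<phi> g ` \<phi> h ` A = \<phi> (g \<otimes>\<^bsub>G\<^esub> h) ` A" if "A \<in> a" for A
        unfolding image_image using sub[OF \<open>a \<in> _\<close> that] \<open>g \<in> _\<close> \<open>h \<in> _\<close>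
        by (intro image_cong refl composition_rule[symmetric]) auto
      then have "(\<lambda>A. \<phi> g ` \<phi> h ` A) ` a = (\<lambda>A. \<phi> (g \<otimes>\<^bsub>G\<^esub> h) ` A) ` a"
        by (rule image_cong[OF refl])
      then show ?thesis unfolding translate_def by (simp only: image_image)
    qed
    show "translate \<phi> \<one>\<^bsub>G\<^esub> a = a" if "a \<in> finite_entropy_partitions M" for a
    proof -
      have "\<phi> \<one>\<^bsub>G\<^esub> x = x" if "x \<in> space M" for x
        using that unfolding id_eq_one[symmetric] by simp
      then have "\<phi> \<one>\<^bsub>G\<^esub> ` A = A" if "A \<in> a" for A
        using sub[OF \<open>a \<in> _\<close> that] by (auto simp: subset_iff image_iff)
      then show ?thesis unfolding translate_def by simp
    qed
    show "real_entropy M (translate \<phi> g a) = real_entropy M a"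
      if "g \<in> carrier G" "a \<in> finite_entropy_partitions M" for g a
      using that entropy by (simp add: real_entropy_def finite_entropy_partitions_def)
  qed
qed

section \<open>Generating partitions\<close>

context entropy_action
begin

text \<open>Conditional entropy of \<open>c\<close> given the ball of radius \<open>n\<close> over
  \<open>a\<close>.\<close>

definition cond :: "'g set \<Rightarrow> 'a \<Rightarrow> 'a \<Rightarrow> nat \<Rightarrow> real" where
  "cond S a c n = H (c \<curlyvee> orbit_join (word_ball G S n) a) - H (orbit_join (word_ball G S n) a)"

definition resolves :: "'g set \<Rightarrow> 'a \<Rightarrow> 'a \<Rightarrow> bool" where
  "resolves S a c \<longleftrightarrow> (\<forall>\<epsilon>>0. \<exists>n. cond S a c n < \<epsilon>)"

lemma asymptotically_fine_iff: "asymptotically_fine S a \<longleftrightarrow> (\<forall>c\<in>C. resolves S a c)"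
  unfolding asymptotically_fine_def resolves_def cond_def ..

lemma resolvesD: "resolves S a c \<Longrightarrow> \<epsilon> > 0 \<Longrightarrow> \<exists>n. cond S a c n < \<epsilon>"
  unfolding resolves_def by blast

context
  fixes S and a
  assumes S: "finite S" "S \<subseteq> carrier G" and a: "a \<in> C"
begin

lemma ball_closed [simp, intro]: "orbit_join (word_ball G S n) a \<in> C"
  using S a by (intro orbit_join_closed finite_word_ball word_ball_subset) auto

lemma cond_antimono:
  assumes "c \<in> C" "m \<le> n"
  shows "cond S a c n \<le> cond S a c m"
  unfolding cond_def using assms S a
  by (intro cond_entropy_antimono orbit_join_subset finite_word_ball word_ball_mono word_ball_subset) auto

lemma cond_mono: "c \<in> C \<Longrightarrow> d \<in> C \<Longrightarrow> c \<preceq> d \<Longrightarrow> cond S a c n \<le> cond S a d n"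
  unfolding cond_def by (intro cond_entropy_mono) auto

lemma cond_join: "c \<in> C \<Longrightarrow> d \<in> C \<Longrightarrow> cond S a (c \<curlyvee> d) n \<le> cond S a c n + cond S a d n"
  unfolding cond_def by (intro cond_entropy_subadditive) auto

lemma resolves_join:
  assumes "c \<in> C" "d \<in> C" "resolves S a c" "resolves S a d"
  shows "resolves S a (c \<curlyvee> d)"
  unfolding resolves_def
proof (intro allI impI)
  fix \<epsilon> :: real assume "\<epsilon> > 0"
  then obtain m n where "cond S a c m < \<epsilon> / 2" "cond S a d n < \<epsilon> / 2"
    using assms resolvesD by (meson half_gt_zero)
  then have "cond S a (c \<curlyvee> d) (max m n) < \<epsilon>"
    using cond_join[OF assms(1,2), of "max m n"] cond_antimono[OF assms(1), of m "max m n"]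
      cond_antimono[OF assms(2), of n "max m n"] by simp
  then show "\<exists>n. cond S a (c \<curlyvee> d) n < \<epsilon>" ..
qed

lemma resolves_mono: "c \<in> C \<Longrightarrow> d \<in> C \<Longrightarrow> c \<preceq> d \<Longrightarrow> resolves S a d \<Longrightarrow> resolves S a c"
  unfolding resolves_def using cond_mono le_less_trans by meson

lemma resolves_Jn:
  assumes "finite X" "X \<noteq> {}" "X \<subseteq> C" "\<And>c. c \<in> X \<Longrightarrow> resolves S a c"
  shows "resolves S a (Jn X)"
  using assms
proof (induction rule: finite_ne_induct)
  case (singleton x)
  then have "Jn {x} = x" by (intro le_antisym Jn_least Jn_upper) (auto intro: le_refl)
  then show ?case using singleton by simp
next
  case (insert x X)
  then show ?case using Jn_insert[of X x] Jn_closed[of X] by (auto intro!: resolves_join)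
qed

text \<open>Closure under approximation, by the triangle inequality for conditional entropy.\<close>

lemma resolves_approx:
  assumes c: "c \<in> C"
    and "\<And>\<epsilon>. \<epsilon> > 0 \<Longrightarrow> \<exists>d\<in>C. resolves S a d \<and> H (c \<curlyvee> d) - H d < \<epsilon>"
  shows "resolves S a c"
  unfolding resolves_def
proof (intro allI impI)
  fix \<epsilon> :: real assume "\<epsilon> > 0"
  then obtain d where d: "d \<in> C" "resolves S a d" "H (c \<curlyvee> d) - H d < \<epsilon> / 2"
    using assms(2)[of "\<epsilon> / 2"] by auto
  obtain n where "cond S a d n < \<epsilon> / 2" using resolvesD[OF d(2), of "\<epsilon> / 2"] \<open>\<epsilon> > 0\<close> by auto
  moreover have "cond S a c n \<le> (H (c \<curlyvee> d) - H d) + cond S a d n"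
    unfolding cond_def using c d by (intro cond_entropy_chain) auto
  ultimately show "\<exists>n. cond S a c n < \<epsilon>" using d(3) by (intro exI[of _ n]) simp
qed

lemma resolves_base: "c \<in> C \<Longrightarrow> c \<preceq> a \<Longrightarrow> resolves S a c"
proof -
  assume c: "c \<in> C" "c \<preceq> a"
  have "orbit_join (word_ball G S 0) a = a"
    using a unfolding orbit_join_def by (intro le_antisym Jn_least Jn_upper) (auto intro: le_refl)
  then have "cond S a c 0 = 0" unfolding cond_def using c a by (simp add: join_absorb1)
  then show "resolves S a c" unfolding resolves_def by (metis order_le_less_trans order_refl)
qed

text \<open>If \<open>g\<close> lies in the ball of radius \<open>m\<close>, the translate by
  \<open>g\<close> of a ball over \<open>a\<close> lies below the ball with radius larger by
  \<open>m\<close>; conditional entropy itself is invariant.\<close>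

lemma resolves_act:
  assumes gen: "generate G S = carrier G" and c: "c \<in> C" and g: "g \<in> carrier G" and r: "resolves S a c"
  shows "resolves S a (act g c)"
  unfolding resolves_def
proof (intro allI impI)
  fix \<epsilon> :: real assume "\<epsilon> > 0"
  then obtain n where n: "cond S a c n < \<epsilon>" using resolvesD[OF r] by auto
  obtain m where m: "{g} \<subseteq> word_ball G S m"
    using finite_subset_word_ball[OF S(2) gen, of "{g}"] g by auto
  let ?B = "\<lambda>n. orbit_join (word_ball G S n) a"
  have "act g (?B n) = orbit_join ((\<lambda>h. g \<otimes> h) ` word_ball G S n) a"
    using S a g by (intro act_orbit_join finite_word_ball word_ball_subset) auto
  also have "\<dots> \<preceq> ?B (m + n)"
    using S a m by (intro orbit_join_subset finite_word_ball word_ball_subset) (auto intro: word_ball_mult)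
  finally have "H (act g c \<curlyvee> ?B (m + n)) - H (?B (m + n)) \<le> H (act g c \<curlyvee> act g (?B n)) - H (act g (?B n))"
    using c g by (intro cond_entropy_antimono) auto
  also have "\<dots> = cond S a c n"
    unfolding cond_def using c g by (simp flip: act_join)
  finally show "\<exists>n. cond S a (act g c) n < \<epsilon>"
    using n unfolding cond_def[of S a "act g c"] by (intro exI[of _ "m + n"]) simp
qed

end

end

section \<open>Partitions into a set and its complement\<close>

definition binary_partition :: "'x measure \<Rightarrow> 'x set \<Rightarrow> 'x set set" where
  "binary_partition M A = {A, space M - A} - {{}}"

lemma partition_on_binary: "A \<in> sets M \<Longrightarrow> partition_on (space M) (binary_partition M A)"
  using sets.sets_into_space[of A M] unfolding binary_partition_def partition_on_def disjoint_def
  by auto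

lemma countable_partition_binary: "A \<in> sets M \<Longrightarrow> countable_partition M (binary_partition M A)"
  using partition_on_binary[of A M] unfolding countable_partition_def binary_partition_def by auto

lemma coarser_binary:
  assumes "A \<in> sets M" "partition_on (space M) P" "\<And>D. D \<in> P \<Longrightarrow> D \<subseteq> A \<or> D \<inter> A = {}"
  shows "coarser M (binary_partition M A) P"
  unfolding coarser_def refines_def
proof (intro conjI ballI)
  fix D assume D: "D \<in> P"
  then have "D \<noteq> {}" "D \<subseteq> space M" using assms(2) by (auto simp: partition_on_def)
  then show "\<exists>Y\<in>binary_partition M A. D \<subseteq> Y"
    using assms(3)[OF D] unfolding binary_partition_def by auto
qed (use assms partition_on_binary in auto)

text \<open>The last hypothesis lets membership in \<open>B\<close> and \<open>D\<close> decide
  membership in \<open>A\<close>, the converse arising by exchanging \<open>x\<close> and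
  \<open>y\<close>. Each atom of the join is therefore inside \<open>A\<close> or disjoint from
  it.\<close>

lemma coarser_binary_pair:
  assumes "A \<in> sets M" "B \<in> sets M" "D \<in> sets M"
    and "\<And>x y. x \<in> space M \<Longrightarrow> y \<in> space M \<Longrightarrow> x \<in> B \<longleftrightarrow> y \<in> B \<Longrightarrow> x \<in> D \<longleftrightarrow> y \<in> D \<Longrightarrow> x \<in> A \<Longrightarrow> y \<in> A"
  shows "coarser M (binary_partition M A) (common_refinement {binary_partition M B, binary_partition M D})"
proof (rule coarser_binary[OF assms(1)])
  have P: "\<And>P. P \<in> {binary_partition M B, binary_partition M D} \<Longrightarrow> partition_on (space M) P"
    using assms partition_on_binary by auto
  then show part: "partition_on (space M) (common_refinement {binary_partition M B, binary_partition M D})"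
    by (intro partition_on_common_refinement) auto
  fix E assume E: "E \<in> common_refinement {binary_partition M B, binary_partition M D}"
  have "\<exists>X\<in>binary_partition M B. E \<subseteq> X" "\<exists>Y\<in>binary_partition M D. E \<subseteq> Y"
    by (rule common_refinement_exists[OF E], simp)+
  then obtain X Y where "X \<in> binary_partition M B" "E \<subseteq> X" "Y \<in> binary_partition M D" "E \<subseteq> Y"
    by auto
  moreover have "E \<subseteq> space M" using part E by (auto simp: partition_on_def)
  ultimately have "x \<in> B \<longleftrightarrow> y \<in> B" "x \<in> D \<longleftrightarrow> y \<in> D" "x \<in> space M" "y \<in> space M" if "x \<in> E" "y \<in> E" for x y
    using that unfolding binary_partition_def by auto
  then show "E \<subseteq> A \<or> E \<inter> A = {}" using assms(4) by blast
qed

context prob_space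
begin

lemma shannon_entropy_finite:
  "finite P \<Longrightarrow> shannon_entropy M P = ereal (\<Sum>A\<in>P. - prob A * ln (prob A))"
  unfolding shannon_entropy_def by (simp add: infsum_finite)

lemma entropy_term_nonneg: "0 \<le> - prob A * ln (prob A)"
  by (cases "prob A = 0") (auto simp: mult_le_0_iff less_le)

lemma sum_le_real_entropy:
  assumes "P \<in> finite_entropy_partitions M" "finite Y" "Y \<subseteq> P"
  shows "(\<Sum>A\<in>Y. - prob A * ln (prob A)) \<le> real_entropy M P"
proof -
  have "(\<Sum>A\<in>Y. ereal (- prob A * ln (prob A))) \<le> shannon_entropy M P"
    unfolding shannon_entropy_def using assms entropy_term_nonneg
    by (subst nonneg_infsum_complete) (auto intro!: SUP_upper)
  then have "ereal (\<Sum>A\<in>Y. - prob A * ln (prob A)) \<le> ereal (real_entropy M P)"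
    using ereal_real_entropy[OF assms(1)] by simp
  then show ?thesis by simp
qed

lemma real_entropy_approx:
  assumes P: "P \<in> finite_entropy_partitions M" and \<epsilon>: "\<epsilon> > 0"
  obtains Y where "finite Y" "Y \<subseteq> P" "Y \<noteq> {}" "real_entropy M P - \<epsilon> < (\<Sum>A\<in>Y. - prob A * ln (prob A))"
proof -
  have "ereal (real_entropy M P - \<epsilon>) < shannon_entropy M P"
    unfolding ereal_real_entropy[OF P, symmetric] using \<epsilon> by simp
  also have "shannon_entropy M P = (SUP F\<in>{F. finite F \<and> F \<subseteq> P}. \<Sum>A\<in>F. ereal (- prob A * ln (prob A)))"
    unfolding shannon_entropy_def by (intro nonneg_infsum_complete) (use entropy_term_nonneg in auto)
  finally obtain F where F: "finite F" "F \<subseteq> P" "real_entropy M P - \<epsilon> < (\<Sum>A\<in>F. - prob A * ln (prob A))"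
    by (auto simp: less_SUP_iff)
  have "\<Union>P \<noteq> {}"
    using P not_empty by (auto simp: finite_entropy_partitions_def countable_partition_def partition_on_def)
  \<comment> \<open>An atom is added so that \<open>Y\<close> is nonempty and joins indexed by it
    exist; entropy terms are nonnegative, so the sum does not drop.\<close>
  then obtain A where A: "A \<in> P" by auto
  have "(\<Sum>A\<in>F. - prob A * ln (prob A)) \<le> (\<Sum>A\<in>insert A F. - prob A * ln (prob A))"
    using F by (intro sum_mono2) (use entropy_term_nonneg in auto)
  then show ?thesis using F A by (intro that[of "insert A F"]) auto
qed

lemma binary_partition_finite_entropy:
  "A \<in> sets M \<Longrightarrow> binary_partition M A \<in> finite_entropy_partitions M"
  unfolding finite_entropy_partitions_def using countable_partition_binary[of A M]
  by (auto simp: shannon_entropy_finite binary_partition_def)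

text \<open>An explicit bound tending to \<open>0\<close> with \<open>prob A\<close>. The term of
  \<open>A\<close> is estimated through the logarithm of \<open>1 / sqrt (prob A)\<close>, that of
  the complement by \<open>prob A\<close>; both rest on \<open>ln x \<le> x - 1\<close>.\<close>

lemma real_entropy_binary_le:
  assumes A: "A \<in> sets M"
  shows "real_entropy M (binary_partition M A) \<le> 2 * sqrt (prob A) + prob A"
proof -
  let ?h = "\<lambda>A. - prob A * ln (prob A)"
  have fin: "finite (binary_partition M A)" unfolding binary_partition_def by auto
  have "real_entropy M (binary_partition M A) = sum ?h (binary_partition M A)"
    unfolding real_entropy_def shannon_entropy_finite[OF fin] by simp
  also have "\<dots> = sum ?h {A, space M - A}"
    unfolding binary_partition_def by (rule sum.mono_neutral_left) auto
  also have "\<dots> \<le> ?h A + ?h (space M - A)"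
    using entropy_term_nonneg[of A] by (cases "A = space M - A") auto
  also have "prob (space M - A) = 1 - prob A" using A by (rule prob_compl)
  also have "?h A \<le> 2 * sqrt (prob A)"
  proof (cases "prob A = 0")
    case False
    then have p: "0 < prob A" by (simp add: less_le)
    have "ln (1 / sqrt (prob A)) \<le> 1 / sqrt (prob A) - 1"
      using p by (intro ln_le_minus_one) simp
    also have "\<dots> \<le> 1 / sqrt (prob A)" by simp
    finally have "- ln (prob A) \<le> 2 / sqrt (prob A)"
      using p by (simp add: ln_div ln_sqrt)
    then have "prob A * (- ln (prob A)) \<le> prob A * (2 / sqrt (prob A))"
      using p by (intro mult_left_mono) auto
    also have "\<dots> = 2 * sqrt (prob A)"
      using real_div_sqrt[of "prob A"] by (simp add: field_simps)
    finally show ?thesis by simp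
  qed simp
  also have "- (1 - prob A) * ln (1 - prob A) \<le> prob A"
  proof (cases "prob A = 1")
    case False
    then have p: "0 < 1 - prob A" using False by (simp add: less_le)
    have "ln (1 / (1 - prob A)) \<le> 1 / (1 - prob A) - 1"
      using p by (intro ln_le_minus_one) simp
    then have "- ln (1 - prob A) \<le> 1 / (1 - prob A) - 1"
      using p by (simp add: ln_div)
    then have "(1 - prob A) * (- ln (1 - prob A)) \<le> (1 - prob A) * (1 / (1 - prob A) - 1)"
      using p by (intro mult_left_mono) auto
    also have "\<dots> = prob A" using p by (simp add: right_diff_distrib)
    finally show ?thesis by (simp add: algebra_simps)
  qed simp
  finally show ?thesis by simp
qed

end

text \<open>The sets whose two-part partition is resolved form an invariant \<sigma>-algebra
  containing \<open>\<alpha>\<close>; as null sets do not matter, these are all measurable sets. An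
  arbitrary partition is then approximated by one that separates finitely many of its atoms.\<close>

lemma generating_asymptotically_fine:
  assumes prob: "prob_space M" and act: "pmp_action G M \<phi>"
    and gen: "generating_partition G M \<phi> \<alpha>" and ent: "shannon_entropy M \<alpha> < \<infinity>"
    and S: "finite S" "S \<subseteq> carrier G" "generate G S = carrier G"
  shows "entropy_action.asymptotically_fine (finite_entropy_partitions M) common_refinement (real_entropy M)
     G (translate \<phi>) S \<alpha>"
proof -
  interpret prob_space M by fact
  interpret entropy_action "finite_entropy_partitions M" "coarser M" common_refinement "real_entropy M" "{space M}"
     G "translate \<phi>"
    using prob act by (rule entropy_action_partitions)
  interpret ga: group_action G "space M" \<phi> using act by (simp add: pmp_action_def)
  let ?C = "finite_entropy_partitions M" and ?bin = "binary_partition M"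
  have \<alpha>: "\<alpha> \<in> ?C" "partition_on (space M) \<alpha>" "\<alpha> \<subseteq> sets M"
    using gen ent by (auto simp: generating_partition_def finite_entropy_partitions_def countable_partition_def)
  note res = S(1,2) \<alpha>(1)
  note bin = binary_partition_finite_entropy
  have pair: "resolves S \<alpha> (?bin A)"
    if "A \<in> sets M" "B \<in> sets M" "D \<in> sets M" "resolves S \<alpha> (?bin B)" "resolves S \<alpha> (?bin D)"
      "\<And>x y. x \<in> space M \<Longrightarrow> y \<in> space M \<Longrightarrow> x \<in> B \<longleftrightarrow> y \<in> B \<Longrightarrow> x \<in> D \<longleftrightarrow> y \<in> D \<Longrightarrow> x \<in> A \<Longrightarrow> y \<in> A" for A B D
  proof -
    have "coarser M (?bin A) (join (?bin B) (?bin D))"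
      unfolding join_def using that by (intro coarser_binary_pair)
    then show ?thesis
      by (rule resolves_mono[OF res bin[OF that(1)] join_closed[OF bin[OF that(2)] bin[OF that(3)]] _
            resolves_join[OF res bin[OF that(2)] bin[OF that(3)] that(4,5)]])
  qed
  \<comment> \<open>Given \<open>B\<close>, the set \<open>A\<close> is determined by the symmetric
    difference, so the entropy of \<open>A\<close> given \<open>B\<close> is at most that of the
    difference, which is small with its measure.\<close>
  have small: "resolves S \<alpha> (?bin A)"
    if A: "A \<in> sets M" and approx: "\<And>\<epsilon>. \<epsilon> > 0 \<Longrightarrow> \<exists>B\<in>sets M. resolves S \<alpha> (?bin B) \<and>
        2 * sqrt (prob (sym_diff A B)) + prob (sym_diff A B) < \<epsilon>" for A
  proof (rule resolves_approx[OF res bin[OF A]])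
    fix \<epsilon> :: real assume "\<epsilon> > 0"
    then obtain B where B: "B \<in> sets M" "resolves S \<alpha> (?bin B)"
        "2 * sqrt (prob (sym_diff A B)) + prob (sym_diff A B) < \<epsilon>"
      using approx by blast
    have D: "sym_diff A B \<in> sets M" using A B by auto
    have "coarser M (?bin A) (join (?bin B) (?bin (sym_diff A B)))"
      unfolding join_def using A B D by (intro coarser_binary_pair) auto
    moreover have "coarser M (?bin B) (join (?bin B) (?bin (sym_diff A B)))"
      using bin B D by (intro join_ub1) auto
    ultimately have "real_entropy M (join (?bin A) (?bin B)) \<le> real_entropy M (join (?bin B) (?bin (sym_diff A B)))"
      using A B D bin by (intro H_mono join_least) auto
    also have "\<dots> \<le> real_entropy M (?bin B) + real_entropy M (?bin (sym_diff A B))"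
      using B D bin by (intro subadditive) auto
    also have "real_entropy M (?bin (sym_diff A B)) < \<epsilon>"
      using real_entropy_binary_le[OF D] B(3) by simp
    finally have "real_entropy M (join (?bin A) (?bin B)) - real_entropy M (?bin B) < \<epsilon>" by simp
    then show "\<exists>d\<in>?C. resolves S \<alpha> d \<and> real_entropy M (join (?bin A) d) - real_entropy M d < \<epsilon>"
      using B bin by auto
  qed
  define \<A> where "\<A> = {A \<in> sets M. resolves S \<alpha> (?bin A)}"
  have empty: "{} \<in> \<A>"
  proof -
    have "?bin {} = {space M}" unfolding binary_partition_def using not_empty by auto
    then show ?thesis unfolding \<A>_def using resolves_base[OF res bt_closed bt_le[OF \<alpha>(1)]] by simp
  qed
  have "sigma_algebra (space M) \<A>"
    unfolding sigma_algebra_iff2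
  proof (intro conjI ballI allI impI)
    show "\<A> \<subseteq> Pow (space M)" unfolding \<A>_def using sets.sets_into_space by auto
    show "{} \<in> \<A>" by (rule empty)
    show "space M - A \<in> \<A>" if "A \<in> \<A>" for A
    proof -
      have "A \<in> sets M" using that by (auto simp: \<A>_def)
      then have "space M - (space M - A) = A" using sets.sets_into_space by blast
      then have "?bin (space M - A) = ?bin A" unfolding binary_partition_def by auto
      then show ?thesis using that unfolding \<A>_def by auto
    qed
    fix A :: "nat \<Rightarrow> 'a set" assume "range A \<subseteq> \<A>"
    then have A: "A i \<in> sets M" "resolves S \<alpha> (?bin (A i))" for i unfolding \<A>_def by auto
    let ?U = "\<lambda>n. \<Union>i<n. A i"
    have Usets: "?U n \<in> sets M" for n using A by auto
    have U: "resolves S \<alpha> (?bin (?U n))" for n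
    proof (induction n)
      case 0
      then show ?case using empty by (simp add: \<A>_def)
    next
      case (Suc n)
      show ?case
        by (rule pair[OF Usets Usets[of n] A(1)[of n] Suc A(2)]) (auto simp: less_Suc_eq)
    qed
    \<comment> \<open>The finite unions are resolved one set at a time and approximate the whole
      union by continuity of the measure.\<close>
    have "resolves S \<alpha> (?bin (\<Union>i. A i))"
    proof (rule small)
      show "(\<Union>i. A i) \<in> sets M" using A by auto
      fix \<epsilon> :: real assume \<epsilon>: "\<epsilon> > 0"
      let ?p = "\<lambda>n. prob (sym_diff (\<Union>i. A i) (?U n))"
      have "(\<lambda>n. prob (?U n)) \<longlonglongrightarrow> prob (\<Union>n. ?U n)"
      proof (rule finite_Lim_measure_incseq)
        show "incseq ?U" by (rule incseq_SucI) (auto simp: less_Suc_eq)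
      qed (use Usets in auto)
      also have "(\<Union>n. ?U n) = (\<Union>i. A i)" by auto
      finally have "(\<lambda>n. prob (\<Union>i. A i) - prob (?U n)) \<longlonglongrightarrow> prob (\<Union>i. A i) - prob (\<Union>i. A i)"
        by (intro tendsto_diff tendsto_const)
      moreover have "?p n = prob (\<Union>i. A i) - prob (?U n)" for n
      proof -
        have "sym_diff (\<Union>i. A i) (?U n) = (\<Union>i. A i) - ?U n" by auto
        then show ?thesis using A Usets by (simp add: finite_measure_Diff UN_mono)
      qed
      ultimately have p: "?p \<longlonglongrightarrow> 0" by simp
      have "(\<lambda>n. 2 * sqrt (?p n) + ?p n) \<longlonglongrightarrow> 2 * sqrt 0 + 0"
        by (intro tendsto_intros p)
      then have "eventually (\<lambda>n. 2 * sqrt (?p n) + ?p n < \<epsilon>) sequentially"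
        using \<epsilon> by (intro order_tendstoD) auto
      then obtain n where "2 * sqrt (?p n) + ?p n < \<epsilon>"
        unfolding eventually_sequentially by blast
      then show "\<exists>B\<in>sets M. resolves S \<alpha> (?bin B) \<and>
          2 * sqrt (prob (sym_diff (\<Union>i. A i) B)) + prob (sym_diff (\<Union>i. A i) B) < \<epsilon>"
        using U Usets by blast
    qed
    then show "(\<Union>i. A i) \<in> \<A>" unfolding \<A>_def using A by auto
  qed
  moreover have "\<phi> g ` A \<in> \<A>" if g: "g \<in> carrier G" and "A \<in> \<A>" for g A
  proof -
    have A: "A \<in> sets M" "resolves S \<alpha> (?bin A)" "A \<subseteq> space M"
      using \<open>A \<in> \<A>\<close> sets.sets_into_space by (auto simp: \<A>_def)
    have "\<phi> g ` (space M - A) = space M - \<phi> g ` A"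
      using inj_on_image_set_diff[OF ga.inj_prop[OF g], of "space M" A] A(3) ga.surj_prop[OF g] by auto
    moreover have "(`) (\<phi> g) ` (X - {{}}) = (`) (\<phi> g) ` X - {{}}" for X
      by auto
    ultimately have eq: "translate \<phi> g (?bin A) = ?bin (\<phi> g ` A)"
      unfolding translate_def binary_partition_def by simp
    have "translate \<phi> g (?bin A) \<in> ?C" using act_closed[OF g bin[OF A(1)]] .
    then have cp: "countable_partition M (?bin (\<phi> g ` A))"
      unfolding eq finite_entropy_partitions_def by auto
    have "\<phi> g ` A \<in> sets M"
    proof (cases "A = {}")
      case False
      then have "\<phi> g ` A \<in> ?bin (\<phi> g ` A)" by (simp add: binary_partition_def)
      then show ?thesis using cp by (auto simp: countable_partition_def)
    qed simp
    moreover have "resolves S \<alpha> (?bin (\<phi> g ` A))"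
      unfolding eq[symmetric] by (rule resolves_act[OF res S(3) bin[OF A(1)] g A(2)])
    ultimately show ?thesis unfolding \<A>_def by simp
  qed
  ultimately have "invariant_sigma_algebra G M \<phi> \<A>"
    unfolding invariant_sigma_algebra_def by blast
  moreover have "\<alpha> \<subseteq> \<A>"
  proof
    fix A assume A: "A \<in> \<alpha>"
    then have As: "A \<in> sets M" using \<alpha> by auto
    have "D \<subseteq> A \<or> D \<inter> A = {}" if "D \<in> \<alpha>" for D
      using that A \<alpha>(2) by (auto simp: partition_on_def disjoint_def)
    then have "coarser M (?bin A) \<alpha>" using As \<alpha>(2) by (intro coarser_binary)
    then show "A \<in> \<A>" unfolding \<A>_def using As resolves_base[OF res bin[OF As]] by simp
  qed
  ultimately have sub: "generated_invariant_sigma_algebra G M \<phi> \<alpha> \<subseteq> \<A>"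
    unfolding generated_invariant_sigma_algebra_def by blast
  have all: "resolves S \<alpha> (?bin B)" if B: "B \<in> sets M" for B
  proof (rule small[OF B])
    fix \<epsilon> :: real assume "\<epsilon> > 0"
    obtain A where A: "A \<in> \<A>" "sym_diff A B \<in> null_sets M"
      using gen B sub unfolding generating_partition_def by blast
    have "prob (sym_diff B A) = 0"
      using A(2) by (simp add: Un_commute null_sets_def measure_def)
    then show "\<exists>A\<in>sets M. resolves S \<alpha> (?bin A) \<and> 2 * sqrt (prob (sym_diff B A)) + prob (sym_diff B A) < \<epsilon>"
      using A(1) \<open>\<epsilon> > 0\<close> unfolding \<A>_def by auto
  qed
  show ?thesis
    unfolding asymptotically_fine_iff
  proof
    fix c assume c: "c \<in> ?C"
    then have cp: "partition_on (space M) c" "c \<subseteq> sets M"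
      by (auto simp: finite_entropy_partitions_def countable_partition_def)
    show "resolves S \<alpha> c"
    proof (rule resolves_approx[OF res c])
      fix \<epsilon> :: real assume "\<epsilon> > 0"
      then obtain Y where Y: "finite Y" "Y \<subseteq> c" "Y \<noteq> {}"
          "real_entropy M c - \<epsilon> < (\<Sum>A\<in>Y. - prob A * ln (prob A))"
        using real_entropy_approx[OF c] by metis
      \<comment> \<open>\<open>d\<close> isolates the atoms in \<open>Y\<close> and lumps the others
        together, so it misses less than \<open>\<epsilon>\<close> of the entropy of
        \<open>c\<close>.\<close>
      define d where "d = common_refinement (?bin ` Y)"
      have YC: "?bin ` Y \<subseteq> ?C" using Y cp bin by auto
      have d: "d \<in> ?C" unfolding d_def using Y YC by (intro Jn_closed) auto
      have coarse: "coarser M (?bin A) c" if "A \<in> Y" for A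
      proof (rule coarser_binary[OF _ cp(1)])
        show "A \<in> sets M" using that Y cp by auto
        show "D \<subseteq> A \<or> D \<inter> A = {}" if "D \<in> c" for D
          using disjointD[OF partition_onD2[OF cp(1)] that, of A] \<open>A \<in> Y\<close> Y(2) by auto
      qed
      then have dc: "coarser M d c"
        unfolding d_def using Y YC c by (intro Jn_least) auto
      \<comment> \<open>The atom of \<open>d\<close> around \<open>A\<close> lies in
        \<open>A\<close> or in its complement, and the latter is excluded because it contains
        \<open>A\<close>.\<close>
      have "Y \<subseteq> d"
      proof
        fix A assume A: "A \<in> Y"
        then have Ac: "A \<in> c" "A \<noteq> {}" using Y cp by (auto simp: partition_on_def)
        then obtain D where D: "D \<in> d" "A \<subseteq> D" using dc unfolding coarser_def refines_def by blast
        have "coarser M (?bin A) d"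
          unfolding d_def using A Y YC by (intro Jn_upper) auto
        then obtain E where "E \<in> ?bin A" "D \<subseteq> E" using D(1) unfolding coarser_def refines_def by blast
        then have "D = A" using D(2) Ac(2) unfolding binary_partition_def by auto
        then show "A \<in> d" using D by simp
      qed
      then have "(\<Sum>A\<in>Y. - prob A * ln (prob A)) \<le> real_entropy M d"
        using d Y by (intro sum_le_real_entropy)
      then have "real_entropy M (join c d) - real_entropy M d < \<epsilon>"
        using Y(4) c d dc by (simp add: join_absorb2)
      moreover have "resolves S \<alpha> d"
        unfolding d_def using Y YC cp by (intro resolves_Jn[OF res]) (auto intro!: all)
      ultimately show "\<exists>d\<in>?C. resolves S \<alpha> d \<and> real_entropy M (join c d) - real_entropy M d < \<epsilon>"
        using d by blast
    qed
  qed
qed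

section \<open>The f-invariant\<close>

context entropy_action
begin

text \<open>Enlarging the radius by one is a single expansion over the rose; this is the
  monotonicity behind the existence of the limit.\<close>

lemma F_ball_decseq:
  assumes S: "finite S" "S \<subseteq> carrier G" and a: "a \<in> C"
  shows "decseq (\<lambda>n. F S (orbit_join (word_ball G S n) a))"
proof (rule decseq_SucI)
  fix n
  let ?B = "\<lambda>n. orbit_join (word_ball G S n) a" and ?\<pi> = "\<lambda>(_ :: 'g) (x :: unit). x"
  have B: "?B m \<in> C" for m using S a by (rule ball_closed)
  have \<pi>: "\<And>s. s \<in> S \<Longrightarrow> ?\<pi> s permutes {()}" by (auto simp: permutes_def)
  have gr: "graph {()} (perm_graph {()} S ?\<pi>)" using S \<pi> by (intro graph_perm_graph) auto
  have eq: "expand S ?\<pi> (\<lambda>_. ?B n) v = ?B (Suc n)" for v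
    by (rule expand_orbit_join[of "{()}", OF _ S \<pi> a]) auto
  have "expands {()} (perm_graph {()} S ?\<pi>) (\<lambda>_. ?B n) (expand S ?\<pi> (\<lambda>_. ?B n))"
    by (rule expands_expand[OF _ S \<pi>]) (use B in auto)
  then have "bethe {()} (perm_graph {()} S ?\<pi>) (\<lambda>_. ?B (Suc n)) \<le> bethe {()} (perm_graph {()} S ?\<pi>) (\<lambda>_. ?B n)"
    unfolding eq by (rule expandsD_plain[OF _ gr]) (use B in auto)
  then show "F S (?B (Suc n)) \<le> F S (?B n)"
    using S by (simp add: bethe_perm_graph_const)
qed

end

theorem corollary1p5:
  fixes G :: "('g, 'm) monoid_scheme"
    and M :: "'x measure"
    and \<phi> :: "'g \<Rightarrow> 'x \<Rightarrow> 'x"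
    and \<alpha> :: "'x set set"
    and S \<Delta> :: "'g set"
  assumes "free_group G" and "finitely_generated_group G"
    and "standard_prob_space M"
    and "pmp_action G M \<phi>"
    and "generating_partition G M \<phi> \<alpha>" and "shannon_entropy M \<alpha> < \<infinity>"
    and "free_generating_set G S"
    and "finite \<Delta>" and "\<Delta> \<noteq> {}" and "right_connected G S \<Delta>"
  shows "f_invariant G M \<phi> \<le> shannon_entropy M (translates_join \<phi> \<Delta> \<alpha>) / ereal (real (card \<Delta>)) \<and>
         shannon_entropy M (translates_join \<phi> \<Delta> \<alpha>) / ereal (real (card \<Delta>)) \<le> shannon_entropy M \<alpha>"
proof -
  have prob: "prob_space M" using assms(3) by (simp add: standard_prob_space_def)
  interpret prob_space M by (rule prob)
  interpret entropy_action "finite_entropy_partitions M" "coarser M" common_refinement "real_entropy M" "{space M}"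
     G "translate \<phi>"
    using prob assms(4) by (rule entropy_action_partitions)
  let ?C = "finite_entropy_partitions M"
  let ?B = "\<lambda>S n \<alpha>. orbit_join (word_ball G S n) \<alpha>"
  have free: "finite T" "T \<subseteq> carrier G" "generate G T = carrier G" if "free_generating_set G T" for T
    using finite_free_generating_set[OF that assms(2)] that by (auto simp: free_generating_set_def)
  have inC: "\<beta> \<in> ?C" if "generating_partition G M \<phi> \<beta>" "shannon_entropy M \<beta> < \<infinity>" for \<beta>
    using that by (auto simp: generating_partition_def finite_entropy_partitions_def)
  have \<alpha>: "\<alpha> \<in> ?C" using assms by (intro inC)
  have tj: "translates_join \<phi> D \<beta> = orbit_join D \<beta>" for D \<beta>
    unfolding translates_join_def orbit_join_def ..
  have F: "F_entropy M \<phi> T P = ereal (F T P)" if T: "T \<subseteq> carrier G" and P: "P \<in> ?C" for T P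
  proof -
    have "shannon_entropy M (common_refinement {translate \<phi> s P, P}) = ereal (real_entropy M (join P (translate \<phi> s P)))"
      if "s \<in> T" for s
      using that T P by (subst ereal_real_entropy) (auto simp: join_def[symmetric] join_commute)
    then show ?thesis
      unfolding F_entropy_def F_eq[OF T P] by (simp add: ereal_real_entropy[OF P, symmetric])
  qed
  have lim_le: "L \<le> ereal (F T (?B T n \<beta>))"
    if T: "free_generating_set G T" and \<beta>: "\<beta> \<in> ?C"
      and L: "(\<lambda>n. F_entropy M \<phi> T (translates_join \<phi> (word_ball G T n) \<beta>)) \<longlonglongrightarrow> L" for T \<beta> L n
  proof -
    have "(\<lambda>n. ereal (F T (?B T n \<beta>))) \<longlonglongrightarrow> L"
      using L free[OF T] \<beta> by (simp add: tj F ball_closed)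
    moreover have "decseq (\<lambda>n. ereal (F T (?B T n \<beta>)))"
      using F_ball_decseq[OF free(1,2)[OF T] \<beta>] by (simp add: decseq_def)
    ultimately show ?thesis using decseq_ge by blast
  qed
  have "decseq (\<lambda>n. ereal (F S (?B S n \<alpha>)))"
    using F_ball_decseq[OF free(1,2)[OF assms(7)] \<alpha>] by (simp add: decseq_def)
  then have "(\<lambda>n. ereal (F S (?B S n \<alpha>))) \<longlonglongrightarrow> (INF n. ereal (F S (?B S n \<alpha>)))"
    by (rule LIMSEQ_INF)
  \<comment> \<open>The choice in \<open>f_invariant\<close> must have a candidate; the infimum for
    \<open>S\<close> and \<open>\<alpha>\<close> is one.\<close>
  then have ex: "\<exists>L T \<beta>. free_generating_set G T \<and> generating_partition G M \<phi> \<beta> \<and> shannon_entropy M \<beta> < \<infinity> \<and>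
        (\<lambda>n. F_entropy M \<phi> T (translates_join \<phi> (word_ball G T n) \<beta>)) \<longlonglongrightarrow> L"
    using assms(5-7) free[OF assms(7)] \<alpha>
    by (intro exI[of _ "INF n. ereal (F S (?B S n \<alpha>))"] exI[of _ S] exI[of _ \<alpha>]) (simp add: tj F ball_closed)
  have \<Delta>: "\<Delta> \<subseteq> carrier G" "0 < real (card \<Delta>)"
    using assms(8-10) by (auto simp: right_connected_def card_gt_0_iff)
  have \<Delta>C: "orbit_join \<Delta> \<alpha> \<in> ?C" using \<Delta> assms(8,9) \<alpha> by (intro orbit_join_closed)
  have quotient: "shannon_entropy M (translates_join \<phi> \<Delta> \<alpha>) / ereal (real (card \<Delta>)) =
      ereal (real_entropy M (orbit_join \<Delta> \<alpha>) / real (card \<Delta>))"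
    unfolding tj ereal_real_entropy[OF \<Delta>C, symmetric] using \<Delta> by simp
  obtain n where n: "real (card \<Delta>) * F S (?B S n \<alpha>) \<le> real_entropy M (orbit_join \<Delta> \<alpha>)"
    using F_ball_le_connected[OF free[OF assms(7)] assms(8-10) \<alpha>] by blast
  \<comment> \<open>The chosen limit may stem from any basis \<open>T\<close> and any generating
    partition \<open>\<beta>\<close>, so the bound is shown for every candidate.\<close>
  have "f_invariant G M \<phi> \<le> ereal (F S (?B S n \<alpha>))"
    unfolding f_invariant_def
  proof (rule someI2_ex[OF ex])
    fix L
    assume "\<exists>T \<beta>. free_generating_set G T \<and> generating_partition G M \<phi> \<beta> \<and> shannon_entropy M \<beta> < \<infinity> \<and>
        (\<lambda>n. F_entropy M \<phi> T (translates_join \<phi> (word_ball G T n) \<beta>)) \<longlonglongrightarrow> L"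
    then obtain T \<beta> where T: "free_generating_set G T" and \<beta>: "generating_partition G M \<phi> \<beta>" "shannon_entropy M \<beta> < \<infinity>"
        and L: "(\<lambda>n. F_entropy M \<phi> T (translates_join \<phi> (word_ball G T n) \<beta>)) \<longlonglongrightarrow> L"
      by blast
    have fine: "asymptotically_fine T \<beta>" "asymptotically_fine T \<alpha>"
      using generating_asymptotically_fine[OF prob assms(4)] \<beta> assms(5,6) free[OF T] by auto
    \<comment> \<open>Balls over \<open>\<beta>\<close> are compared with \<open>b\<close> through
      the generating partition \<open>\<alpha>\<close> below \<open>b\<close>, at the cost of an
      arbitrary \<open>\<epsilon>\<close>.\<close>
    have bound: "L \<le> ereal (F T b)" if b: "b \<in> ?C" "coarser M \<alpha> b" for b
    proof (rule ereal_le_epsilon2)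
      fix \<epsilon> :: real assume "0 < \<epsilon>"
      then obtain m where m: "F T (?B T m \<beta>) \<le> F T b + \<epsilon>"
        using F_ball_le_F[OF free(1,2)[OF T] inC[OF \<beta>] b(1) \<alpha> fine b(2)] by blast
      have "L \<le> ereal (F T (?B T m \<beta>))" using lim_le[OF T inC[OF \<beta>] L] .
      also have "\<dots> \<le> ereal (F T b) + ereal \<epsilon>" using m by simp
      finally show "L \<le> ereal (F T b) + ereal \<epsilon>" .
    qed
    \<comment> \<open>The identity lies in every ball, so the ball over \<open>\<alpha>\<close> is
      among the partitions covered by \<open>bound\<close>.\<close>
    have "coarser M (translate \<phi> \<one>\<^bsub>G\<^esub> \<alpha>) (?B S n \<alpha>)"
      using free[OF assms(7)] \<alpha> by (intro orbit_join_upper finite_word_ball word_ball_subset one_in_word_ball)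
    then have "coarser M \<alpha> (?B S n \<alpha>)" using \<alpha> by simp
    then show "L \<le> ereal (F S (?B S n \<alpha>))"
      using free[OF T] free[OF assms(7)] \<alpha>
      by (intro F_bound_change_basis[OF T _ assms(7) _ bound] ball_closed)
  qed
  also have "F S (?B S n \<alpha>) \<le> real_entropy M (orbit_join \<Delta> \<alpha>) / real (card \<Delta>)"
    using n \<Delta>(2) by (simp add: field_simps)
  finally have "f_invariant G M \<phi> \<le> ereal (real_entropy M (orbit_join \<Delta> \<alpha>) / real (card \<Delta>))"
    by simp
  moreover have "real_entropy M (orbit_join \<Delta> \<alpha>) / real (card \<Delta>) \<le> real_entropy M \<alpha>"
    using H_orbit_join_le[OF assms(8,9) \<Delta>(1) \<alpha>] \<Delta>(2) by (simp add: field_simps)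
  ultimately show ?thesis
    unfolding quotient ereal_real_entropy[OF \<alpha>, symmetric] by simp
qed

end
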